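(* Let $\overline M$ be a $7$-dimensional Riemannian manifold with a $G_2$-structure of type $\mathcal X_2$. Let $\iota:M\to\overline M$ be an orientable hypersurface with unit normal vector field $n$, with the induced $SU(3)$-structure determined by $n$ and the constant function $\theta=0$ (resp. $\theta=\pi/2$). Put $\varepsilon=+$ if $\theta=0$ and $\varepsilon=-$ if $\theta=\pi/2$. Then $M$ is of type $\mathcal W_1^{\varepsilon}+\mathcal W_2^{\varepsilon}+\mathcal W_3+\mathcal W_4+\mathcal W_5$ and $d^*\omega=6I\eta=-2\,\overline r(\varphi)(\iota_*\cdot,n)$. Moreover, the $SU(3)$-structure on $M$ is of the type given on the left if and only if the condition on the right holds: 1. $\mathcal W_1^{\varepsilon}+\mathcal W_2^{\varepsilon}+\mathcal W_3$: $\overline r(\varphi)(\iota_*\cdot,n)=0$. 2. $\mathcal W_1^{\varepsilon}+\mathcal W_2^{\varepsilon}+\mathcal W_4+\mathcal W_5$: $IB=B$. 3. $\mathcal W_1^{\varepsilon}+\mathcal W_3+\mathcal W_4+\mathcal W_5$: $(I_{(1)}-I_{(2)})\iota^*\overline r(\varphi)+(1+I)B=2h\langle\cdot,\cdot\rangle$. 4. $\mathcal W_2^{\varepsilon}+\mathcal W_3+\mathcal W_4+\mathcal W_5$: $M$ is a minimal variety.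
   Context: $G_2$-structures: a $G_2$-structure on a Riemannian $7$-manifold $(\overline M,\langle\cdot,\cdot\rangle)$ is given by a global three-form $\varphi$ such that locally there is an orthonormal frame $\{e_0,\dots,e_6\}$ (a Cayley frame, indices in $\mathbb Z_7$) with $\varphi=\sum_ie_i\wedge e_{i+1}\wedge e_{i+3}$ (vectors are identified with one-forms via the metric). $\langle P(x,y),z\rangle=\varphi(x,y,z)$, and $*\varphi=-\sum_{i}e_{i+2}\wedge e_{i+4}\wedge e_{i+5}\wedge e_{i+6}$ (Hodge dual for the orientation $e_0\wedge\dots\wedge e_6$). $\overline\nabla$ is the Levi-Civita connection and $\overline r(\varphi)(x,y)=\frac14\langle\overline\nabla_x\varphi,y\lrcorner*\varphi\rangle$, where $\langle a,b\rangle=\frac1{p!}\sum a(e_{i_1},\dots)b(e_{i_1},\dots)$ for $p$-forms. Type $\mathcal X_2$ (almost parallel): $\overline r(\varphi)\in\mathfrak g_2$, i.e. $b=\overline r(\varphi)$ is skew-symmetric and $\sum_{j,k}\varphi(e_i,e_j,e_k)b(e_j,e_k)=0$ for all $i$. Induced structure on $M$: the induced metric, $Ix=P(n,x)$, and $\Psi=\psi_++i\psi_-$ with $\psi_+=\cos\theta\,\iota^*\varphi-\sin\theta\,\iota^*(n\lrcorner*\varphi)$, $\psi_-=\sin\theta\,\iota^*\varphi+\cos\theta\,\iota^*(n\lrcorner*\varphi)$. $B(x,y)=\langle II(x,y),n\rangle=\langle\overline\nabla_xy,n\rangle$ is the second fundamental form, $h=\frac16\mathrm{Tr}\,B$ (so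 $h=\langle H,n\rangle$, $H$ the mean curvature); minimal variety means $h=0$. For a bilinear form $b$ on $M$, $(I_{(1)}b)(x,y)=-b(Ix,y)$, $(I_{(2)}b)(x,y)=-b(x,Iy)$, $(Ib)(x,y)=b(Ix,Iy)$; for a one-form $\mu$, $(I\mu)(x)=-\mu(Ix)$. Types of $SU(3)$-structure: $\nabla$ is the Levi-Civita connection of $M$, $\omega(x,y)=\langle x,Iy\rangle$, $d^*\omega=-\sum_ie_i\lrcorner\nabla_{e_i}\omega$. $\nabla\omega$ lies in $\{\alpha\mid\alpha(x,y,z)=-\alpha(x,z,y)=-\alpha(x,Iy,Iz)\}=\mathcal W_1\oplus\mathcal W_2\oplus\mathcal W_3\oplus\mathcal W_4$ (Gray–Hervella), where $\mathcal W_1$: $\alpha$ totally skew; $\mathcal W_2$: cyclic sum of $\alpha(x,y,z)$ is zero; $\mathcal W_3$: $\alpha(Ix,Iy,z)=\alpha(x,y,z)$ and $\sum_i\alpha(e_i,e_i,z)=0$; $\mathcal W_4$: $\alpha(x,y,z)=\langle x,y\rangle\tau(z)-\langle x,z\rangle\tau(y)-\langle x,Iy\rangle\tau(Iz)+\langle x,Iz\rangle\tau(Iy)$ for some one-form $\tau$. With $r(\alpha)(x,y)=\frac12\langle x\lrcorner\alpha,y\lrcorner\psi_+\rangle$, for $i=1,2$ one has $\mathcal W_i=\mathcal W_i^+\oplus\mathcal W_i^-$, where $\mathcal W_i^+$ (resp. $\mathcal W_i^-$) is the set of $\alpha\in\mathcal W_i$ with $r(\alpha)$ symmetric (resp. skew-symmetric).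 The $\mathcal W_5$-part of the torsion is the one-form $\eta$ determined by requiring that the metric connection $\nabla+\eta+\xi$, with $\eta_XY=(I\eta)(X)IY$ and $\xi_XY=-\frac12I(\nabla_XI)Y$, makes $\omega,\psi_+,\psi_-$ parallel; equivalently $(I\eta)(X)=-\frac1{12}\langle\nabla_X\psi_+,\psi_-\rangle$. $M$ is of type $\mathcal U$, a sum of some of $\mathcal W_1^\pm,\mathcal W_2^\pm,\mathcal W_3,\mathcal W_4,\mathcal W_5$, if the components of $\nabla\omega$ in the $\mathcal W$'s not occurring in $\mathcal U$ vanish everywhere and, when $\mathcal W_5$ does not occur, $\eta=0$. *)

theory Defs
  imports "HOL-Analysis.Analysis"
begin

text \<open>
  Tensor fields are given in the classical way: a field on a manifold assigns to each chart of the
  atlas, and to each point of the coordinate domain of that chart, its components there, and the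
  components in two charts are related by the differential of the change of coordinates.
  So in a chart a tangent vector is an element of \<open>real ^ 'n\<close>, and a \<open>k\<close>-form is a curried
  function of \<open>k\<close> such vectors. Indices of type \<open>7\<close> are added modulo 7.
\<close>

section \<open>Smooth manifolds\<close>

text \<open>Meant for open sets.\<close>

primrec Ck_on :: "nat \<Rightarrow> 'a::real_normed_vector set \<Rightarrow> ('a \<Rightarrow> 'b::real_normed_vector) \<Rightarrow> bool" where
  "Ck_on 0 S f \<longleftrightarrow> continuous_on S f"
| "Ck_on (Suc k) S f \<longleftrightarrow> (\<forall>x\<in>S. f differentiable (at x)) \<and>
     (\<forall>v. Ck_on k S (\<lambda>x. frechet_derivative f (at x) v))"

definition smooth_on :: "'a::real_normed_vector set \<Rightarrow> ('a \<Rightarrow> 'b::real_normed_vector) \<Rightarrow> bool" where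
  "smooth_on S f \<longleftrightarrow> (\<forall>k. Ck_on k S f)"

text \<open>A chart is a domain together with a coordinate map, of which only the values on the domain
  matter.\<close>

type_synonym ('a, 'n) chart = "'a set \<times> ('a \<Rightarrow> real ^ 'n)"

abbreviation coord_dom :: "('a, 'n::finite) chart \<Rightarrow> (real ^ 'n) set" where
  "coord_dom c \<equiv> snd c ` fst c"

definition coord_inv :: "('a, 'n::finite) chart \<Rightarrow> real ^ 'n \<Rightarrow> 'a" where
  "coord_inv c = inv_into (fst c) (snd c)"

definition transition :: "('a, 'n::finite) chart \<Rightarrow> ('a, 'n) chart \<Rightarrow> real ^ 'n \<Rightarrow> real ^ 'n" where
  "transition c d = snd d \<circ> coord_inv c"

abbreviation overlap :: "('a, 'n::finite) chart \<Rightarrow> ('a, 'n) chart \<Rightarrow> (real ^ 'n) set" where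
  "overlap c d \<equiv> snd c ` (fst c \<inter> fst d)"

abbreviation ddir ::
  "('x::real_normed_vector \<Rightarrow> 'y::real_normed_vector) \<Rightarrow> 'x \<Rightarrow> 'x \<Rightarrow> 'y" where
  "ddir f u \<equiv> frechet_derivative f (at u)"

definition smooth_manifold :: "'a topology \<Rightarrow> ('a, 'n::finite) chart set \<Rightarrow> bool" where
  "smooth_manifold X A \<longleftrightarrow>
     Hausdorff_space X \<and> second_countable X \<and> topspace X = (\<Union>c\<in>A. fst c) \<and>
     (\<forall>c\<in>A. openin X (fst c) \<and> open (coord_dom c) \<and>
        homeomorphic_map (subtopology X (fst c)) (top_of_set (coord_dom c)) (snd c)) \<and>
     (\<forall>c\<in>A. \<forall>d\<in>A. smooth_on (overlap c d) (transition c d))"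

section \<open>Multilinear algebra in one tangent space\<close>

definition trilinear :: "(real ^ 'n \<Rightarrow> real ^ 'n \<Rightarrow> real ^ 'n \<Rightarrow> real) \<Rightarrow> bool" where
  "trilinear f \<longleftrightarrow> (\<forall>y z. linear (\<lambda>x. f x y z)) \<and> (\<forall>x z. linear (\<lambda>y. f x y z)) \<and>
     (\<forall>x y. linear (\<lambda>z. f x y z))"

definition alternating3 :: "(real ^ 'n \<Rightarrow> real ^ 'n \<Rightarrow> real ^ 'n \<Rightarrow> real) \<Rightarrow> bool" where
  "alternating3 f \<longleftrightarrow> (\<forall>x y z. f x y z = - f y x z \<and> f x y z = - f x z y)"

definition wedge2 :: "('v \<Rightarrow> real) \<Rightarrow> ('v \<Rightarrow> real) \<Rightarrow> 'v \<Rightarrow> 'v \<Rightarrow> real" where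
  "wedge2 a b x y = a x * b y - a y * b x"

definition wedge3 :: "('v \<Rightarrow> real) \<Rightarrow> ('v \<Rightarrow> real) \<Rightarrow> ('v \<Rightarrow> real) \<Rightarrow> 'v \<Rightarrow> 'v \<Rightarrow> 'v \<Rightarrow> real" where
  "wedge3 a b c x y z = a x * wedge2 b c y z - a y * wedge2 b c x z + a z * wedge2 b c x y"

definition wedge4 :: "('v \<Rightarrow> real) \<Rightarrow> ('v \<Rightarrow> real) \<Rightarrow> ('v \<Rightarrow> real) \<Rightarrow> ('v \<Rightarrow> real) \<Rightarrow>
    'v \<Rightarrow> 'v \<Rightarrow> 'v \<Rightarrow> 'v \<Rightarrow> real" where
  "wedge4 a b c d x y z w =
     a x * wedge3 b c d y z w - a y * wedge3 b c d x z w
     + a z * wedge3 b c d x y w - a w * wedge3 b c d x y z"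

definition orthonormal :: "(real ^ 'n \<Rightarrow> real ^ 'n \<Rightarrow> real) \<Rightarrow> ('n::finite \<Rightarrow> real ^ 'n) \<Rightarrow> bool" where
  "orthonormal G e \<longleftrightarrow> (\<forall>i j. G (e i) (e j) = (if i = j then 1 else 0))"

text \<open>Used below only in expressions that do not depend on the choice of the orthonormal basis.\<close>

definition some_frame :: "(real ^ 'n \<Rightarrow> real ^ 'n \<Rightarrow> real) \<Rightarrow> 'n::finite \<Rightarrow> real ^ 'n" where
  "some_frame G = (SOME e. orthonormal G e)"

definition form_inner2 :: "(real ^ 'n \<Rightarrow> real ^ 'n \<Rightarrow> real) \<Rightarrow>
    (real ^ 'n \<Rightarrow> real ^ 'n \<Rightarrow> real) \<Rightarrow> (real ^ 'n::finite \<Rightarrow> real ^ 'n \<Rightarrow> real) \<Rightarrow> real" where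
  "form_inner2 G a b = (let e = some_frame G in
     (\<Sum>i\<in>UNIV. \<Sum>j\<in>UNIV. a (e i) (e j) * b (e i) (e j)) / fact 2)"

definition form_inner3 :: "(real ^ 'n \<Rightarrow> real ^ 'n \<Rightarrow> real) \<Rightarrow>
    (real ^ 'n \<Rightarrow> real ^ 'n \<Rightarrow> real ^ 'n \<Rightarrow> real) \<Rightarrow>
    (real ^ 'n::finite \<Rightarrow> real ^ 'n \<Rightarrow> real ^ 'n \<Rightarrow> real) \<Rightarrow> real" where
  "form_inner3 G a b = (let e = some_frame G in
     (\<Sum>i\<in>UNIV. \<Sum>j\<in>UNIV. \<Sum>k\<in>UNIV. a (e i) (e j) (e k) * b (e i) (e j) (e k)) / fact 3)"

section \<open>Riemannian manifolds\<close>

record ('a, 'n) riemannian =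
  mtop :: "'a topology"
  charts :: "('a, 'n) chart set"
  metric :: "('a, 'n) chart \<Rightarrow> real ^ 'n \<Rightarrow> real ^ 'n \<Rightarrow> real ^ 'n \<Rightarrow> real"

definition riemannian_manifold :: "('a, 'n::finite, 'z) riemannian_scheme \<Rightarrow> bool" where
  "riemannian_manifold R \<longleftrightarrow>
     smooth_manifold (mtop R) (charts R) \<and>
     (\<forall>c\<in>charts R. \<forall>u\<in>coord_dom c. bilinear (metric R c u) \<and>
        (\<forall>x y. metric R c u x y = metric R c u y x) \<and> (\<forall>x. x \<noteq> 0 \<longrightarrow> metric R c u x x > 0)) \<and>
     (\<forall>c\<in>charts R. \<forall>x y. smooth_on (coord_dom c) (\<lambda>u. metric R c u x y)) \<and>
     (\<forall>c\<in>charts R. \<forall>d\<in>charts R. \<forall>u\<in>overlap c d. \<forall>x y.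
        metric R c u x y = metric R d (transition c d u)
          (ddir (transition c d) u x) (ddir (transition c d) u y))"

text \<open>
  In a chart a connection has the form \<open>\<nabla>\<^sub>x Y = D\<^sub>x Y + \<Gamma>(x, Y)\<close> with \<open>\<Gamma>\<close> bilinear at each point.
  It is torsion-free iff \<open>\<Gamma>\<close> is symmetric, and the last condition says that it is metric.
  The value below is \<open>\<Gamma>\<close> of the Levi-Civita connection at the point with coordinates \<open>u\<close>.
\<close>

definition levi_civita :: "('a, 'n::finite, 'z) riemannian_scheme \<Rightarrow> ('a, 'n) chart \<Rightarrow> real ^ 'n \<Rightarrow>
    real ^ 'n \<Rightarrow> real ^ 'n \<Rightarrow> real ^ 'n" where
  "levi_civita R c u = (THE \<Gamma>. bilinear \<Gamma> \<and> (\<forall>x y. \<Gamma> x y = \<Gamma> y x) \<and>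
     (\<forall>x y z. ddir (\<lambda>v. metric R c v y z) u x
        = metric R c u (\<Gamma> x y) z + metric R c u y (\<Gamma> x z)))"

text \<open>Covariant derivatives \<open>(\<nabla>\<^sub>x T)(y, z)\<close> and \<open>(\<nabla>\<^sub>x T)(y, z, w)\<close> at \<open>u\<close> of a tensor field \<open>T\<close> in a
  chart, for the connection whose \<open>\<Gamma>\<close> at \<open>u\<close> is given.\<close>

definition nabla2 :: "(real ^ 'n \<Rightarrow> real ^ 'n \<Rightarrow> real ^ 'n) \<Rightarrow>
    (real ^ 'n \<Rightarrow> real ^ 'n \<Rightarrow> real ^ 'n \<Rightarrow> real) \<Rightarrow> real ^ 'n::finite \<Rightarrow>
    real ^ 'n \<Rightarrow> real ^ 'n \<Rightarrow> real ^ 'n \<Rightarrow> real" where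
  "nabla2 \<Gamma> T u x y z = ddir (\<lambda>v. T v y z) u x - T u (\<Gamma> x y) z - T u y (\<Gamma> x z)"

definition nabla3 :: "(real ^ 'n \<Rightarrow> real ^ 'n \<Rightarrow> real ^ 'n) \<Rightarrow>
    (real ^ 'n \<Rightarrow> real ^ 'n \<Rightarrow> real ^ 'n \<Rightarrow> real ^ 'n \<Rightarrow> real) \<Rightarrow> real ^ 'n::finite \<Rightarrow>
    real ^ 'n \<Rightarrow> real ^ 'n \<Rightarrow> real ^ 'n \<Rightarrow> real ^ 'n \<Rightarrow> real" where
  "nabla3 \<Gamma> T u x y z w = ddir (\<lambda>v. T v y z w) u x
     - T u (\<Gamma> x y) z w - T u y (\<Gamma> x z) w - T u y z (\<Gamma> x w)"

section \<open>\<open>G\<^sub>2\<close>-structures\<close>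

record 'b g2_mfd = "('b, 7) riemannian" +
  phi :: "('b, 7) chart \<Rightarrow> real ^ 7 \<Rightarrow> real ^ 7 \<Rightarrow> real ^ 7 \<Rightarrow> real ^ 7 \<Rightarrow> real"

definition cayley_frame :: "(real ^ 7 \<Rightarrow> real ^ 7 \<Rightarrow> real) \<Rightarrow>
    (real ^ 7 \<Rightarrow> real ^ 7 \<Rightarrow> real ^ 7 \<Rightarrow> real) \<Rightarrow> (7 \<Rightarrow> real ^ 7) \<Rightarrow> bool" where
  "cayley_frame G f e \<longleftrightarrow> orthonormal G e \<and>
     (\<forall>x y z. f x y z = (\<Sum>i\<in>UNIV. wedge3 (G (e i)) (G (e (i + 1))) (G (e (i + 3))) x y z))"

definition g2_manifold :: "'b g2_mfd \<Rightarrow> bool" where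
  "g2_manifold N \<longleftrightarrow>
     riemannian_manifold N \<and>
     (\<forall>c\<in>charts N. \<forall>u\<in>coord_dom c. trilinear (phi N c u) \<and> alternating3 (phi N c u)) \<and>
     (\<forall>c\<in>charts N. \<forall>x y z. smooth_on (coord_dom c) (\<lambda>u. phi N c u x y z)) \<and>
     (\<forall>c\<in>charts N. \<forall>d\<in>charts N. \<forall>u\<in>overlap c d. \<forall>x y z.
        phi N c u x y z = phi N d (transition c d u)
          (ddir (transition c d) u x) (ddir (transition c d) u y) (ddir (transition c d) u z)) \<and>
     (\<forall>c\<in>charts N. \<forall>u\<in>coord_dom c. \<exists>W e. open W \<and> u \<in> W \<and> W \<subseteq> coord_dom c \<and>
        (\<forall>i. smooth_on W (\<lambda>v. e v i)) \<and>
        (\<forall>v\<in>W. cayley_frame (metric N c v) (phi N c v) (e v)))"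

definition cross :: "'b g2_mfd \<Rightarrow> ('b, 7) chart \<Rightarrow> real ^ 7 \<Rightarrow> real ^ 7 \<Rightarrow> real ^ 7 \<Rightarrow> real ^ 7" where
  "cross N c u x y = (THE w. \<forall>z. metric N c u w z = phi N c u x y z)"

text \<open>The Hodge dual of \<open>\<phi>\<close>, which does not depend on the Cayley frame.\<close>

definition star_phi :: "'b g2_mfd \<Rightarrow> ('b, 7) chart \<Rightarrow> real ^ 7 \<Rightarrow>
    real ^ 7 \<Rightarrow> real ^ 7 \<Rightarrow> real ^ 7 \<Rightarrow> real ^ 7 \<Rightarrow> real" where
  "star_phi N c u x y z w =
     (let G = metric N c u; e = (SOME e. cayley_frame G (phi N c u) e) in
      - (\<Sum>i\<in>UNIV. wedge4 (G (e (i + 2))) (G (e (i + 4))) (G (e (i + 5))) (G (e (i + 6))) x y z w))"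

definition rbar :: "'b g2_mfd \<Rightarrow> ('b, 7) chart \<Rightarrow> real ^ 7 \<Rightarrow> real ^ 7 \<Rightarrow> real ^ 7 \<Rightarrow> real" where
  "rbar N c u x y = 1 / 4 * form_inner3 (metric N c u)
     (nabla3 (levi_civita N c u) (phi N c) u x) (star_phi N c u y)"

definition type_X2 :: "'b g2_mfd \<Rightarrow> bool" where
  "type_X2 N \<longleftrightarrow> (\<forall>c\<in>charts N. \<forall>u\<in>coord_dom c.
     (\<forall>x y. rbar N c u x y = - rbar N c u y x) \<and>
     (\<forall>e. cayley_frame (metric N c u) (phi N c u) e \<longrightarrow>
        (\<forall>i. (\<Sum>j\<in>UNIV. \<Sum>k\<in>UNIV. phi N c u (e i) (e j) (e k) * rbar N c u (e j) (e k)) = 0)))"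

section \<open>Hypersurfaces\<close>

text \<open>\<open>nrm M d p\<close> are the components in the ambient chart \<open>d\<close> of the normal vector at \<open>imm M p\<close>.\<close>

record ('a, 'b) hypersurf =
  amb :: "'b g2_mfd"
  htop :: "'a topology"
  hcharts :: "('a, 6) chart set"
  imm :: "'a \<Rightarrow> 'b"
  nrm :: "('b, 7) chart \<Rightarrow> 'a \<Rightarrow> real ^ 7"

definition local_rep :: "('a, 'b) hypersurf \<Rightarrow> ('b, 7) chart \<Rightarrow> ('a, 6) chart \<Rightarrow> real ^ 6 \<Rightarrow> real ^ 7" where
  "local_rep M d c = snd d \<circ> imm M \<circ> coord_inv c"

abbreviation local_dom :: "('a, 'b) hypersurf \<Rightarrow> ('b, 7) chart \<Rightarrow> ('a, 6) chart \<Rightarrow> (real ^ 6) set" where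
  "local_dom M d c \<equiv> snd c ` (fst c \<inter> imm M -` fst d)"

text \<open>An immersed hypersurface with a global unit normal field. As a \<open>G\<^sub>2\<close>-structure orients the
  ambient manifold, a hypersurface carries such a field exactly when it is orientable.\<close>

definition hypersurface :: "('a, 'b) hypersurf \<Rightarrow> bool" where
  "hypersurface M \<longleftrightarrow>
     smooth_manifold (htop M) (hcharts M) \<and>
     continuous_map (htop M) (mtop (amb M)) (imm M) \<and>
     (\<forall>c\<in>hcharts M. \<forall>d\<in>charts (amb M).
        smooth_on (local_dom M d c) (local_rep M d c) \<and>
        smooth_on (local_dom M d c) (\<lambda>u. nrm M d (coord_inv c u)) \<and>
        (\<forall>u\<in>local_dom M d c.
           let G = metric (amb M) d (local_rep M d c u); n = nrm M d (coord_inv c u) in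
           inj (ddir (local_rep M d c) u) \<and> G n n = 1 \<and>
           (\<forall>x. G n (ddir (local_rep M d c) u x) = 0))) \<and>
     (\<forall>d\<in>charts (amb M). \<forall>d'\<in>charts (amb M). \<forall>p\<in>topspace (htop M).
        imm M p \<in> fst d \<inter> fst d' \<longrightarrow>
        nrm M d' p = ddir (transition d d') (snd d (imm M p)) (nrm M d p))"

text \<open>Some ambient chart around the image of the point with coordinates \<open>u\<close> in \<open>c\<close>. The tensors
  on \<open>M\<close> defined with it do not depend on the choice, by the transformation laws.\<close>

definition amb_chart :: "('a, 'b) hypersurf \<Rightarrow> ('a, 6) chart \<Rightarrow> real ^ 6 \<Rightarrow> ('b, 7) chart" where
  "amb_chart M c u = (SOME d. d \<in> charts (amb M) \<and> imm M (coord_inv c u) \<in> fst d)"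

text \<open>The value at the image point of an ambient tensor field.\<close>

definition along :: "('a, 'b) hypersurf \<Rightarrow> ('a, 6) chart \<Rightarrow> real ^ 6 \<Rightarrow>
    (('b, 7) chart \<Rightarrow> real ^ 7 \<Rightarrow> 't) \<Rightarrow> 't" where
  "along M c u T = T (amb_chart M c u) (local_rep M (amb_chart M c u) c u)"

definition push :: "('a, 'b) hypersurf \<Rightarrow> ('a, 6) chart \<Rightarrow> real ^ 6 \<Rightarrow> real ^ 6 \<Rightarrow> real ^ 7" where
  "push M c u = ddir (local_rep M (amb_chart M c u) c) u"

definition normal :: "('a, 'b) hypersurf \<Rightarrow> ('a, 6) chart \<Rightarrow> real ^ 6 \<Rightarrow> real ^ 7" where
  "normal M c u = nrm M (amb_chart M c u) (coord_inv c u)"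

definition induced :: "('a, 'b) hypersurf \<Rightarrow> ('a, 6) riemannian" where
  "induced M = \<lparr> mtop = htop M, charts = hcharts M,
     metric = (\<lambda>c u x y. along M c u (metric (amb M)) (push M c u x) (push M c u y)) \<rparr>"

abbreviation hmetric :: "('a, 'b) hypersurf \<Rightarrow> ('a, 6) chart \<Rightarrow> real ^ 6 \<Rightarrow> real ^ 6 \<Rightarrow> real ^ 6 \<Rightarrow> real" where
  "hmetric M \<equiv> metric (induced M)"

abbreviation hconn :: "('a, 'b) hypersurf \<Rightarrow> ('a, 6) chart \<Rightarrow> real ^ 6 \<Rightarrow> real ^ 6 \<Rightarrow> real ^ 6 \<Rightarrow> real ^ 6" where
  "hconn M \<equiv> levi_civita (induced M)"

text \<open>
  For a vector field \<open>Y\<close> on \<open>M\<close> the ambient derivative is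
  \<open>\<nabla>\<^sub>x (\<iota>\<^sub>* Y) = D\<^sub>x (F' Y) + \<Gamma>(F' x, F' Y)\<close>, where \<open>F\<close> represents \<open>\<iota>\<close> and \<open>\<Gamma>\<close> the ambient Levi-Civita
  connection in charts. Its normal part is tensorial in \<open>Y\<close>, so \<open>Y\<close> is taken constant in the chart.
\<close>

definition second_ff :: "('a, 'b) hypersurf \<Rightarrow> ('a, 6) chart \<Rightarrow> real ^ 6 \<Rightarrow> real ^ 6 \<Rightarrow> real ^ 6 \<Rightarrow> real" where
  "second_ff M c u x y = (let F = local_rep M (amb_chart M c u) c in
     along M c u (metric (amb M))
       (ddir (\<lambda>v. ddir F v y) u x + along M c u (levi_civita (amb M)) (push M c u x) (push M c u y))
       (normal M c u))"

definition mean_curv :: "('a, 'b) hypersurf \<Rightarrow> ('a, 6) chart \<Rightarrow> real ^ 6 \<Rightarrow> real" where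
  "mean_curv M c u = (let e = some_frame (hmetric M c u) in
     1 / 6 * (\<Sum>i\<in>UNIV. second_ff M c u (e i) (e i)))"

definition minimal_variety :: "('a, 'b) hypersurf \<Rightarrow> bool" where
  "minimal_variety M \<longleftrightarrow> (\<forall>c\<in>hcharts M. \<forall>u\<in>coord_dom c. mean_curv M c u = 0)"

definition rbar_tt :: "('a, 'b) hypersurf \<Rightarrow> ('a, 6) chart \<Rightarrow> real ^ 6 \<Rightarrow> real ^ 6 \<Rightarrow> real ^ 6 \<Rightarrow> real" where
  "rbar_tt M c u x y = along M c u (rbar (amb M)) (push M c u x) (push M c u y)"

definition rbar_tn :: "('a, 'b) hypersurf \<Rightarrow> ('a, 6) chart \<Rightarrow> real ^ 6 \<Rightarrow> real ^ 6 \<Rightarrow> real" where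
  "rbar_tn M c u x = along M c u (rbar (amb M)) (push M c u x) (normal M c u)"

section \<open>The induced \<open>SU(3)\<close>-structure\<close>

definition act_I :: "('a, 'b) hypersurf \<Rightarrow> ('a, 6) chart \<Rightarrow> real ^ 6 \<Rightarrow> real ^ 6 \<Rightarrow> real ^ 6" where
  "act_I M c u x =
     (THE y. push M c u y = along M c u (cross (amb M)) (normal M c u) (push M c u x))"

definition omega :: "('a, 'b) hypersurf \<Rightarrow> ('a, 6) chart \<Rightarrow> real ^ 6 \<Rightarrow> real ^ 6 \<Rightarrow> real ^ 6 \<Rightarrow> real" where
  "omega M c u x y = hmetric M c u x (act_I M c u y)"

definition pull_phi :: "('a, 'b) hypersurf \<Rightarrow> ('a, 6) chart \<Rightarrow> real ^ 6 \<Rightarrow>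
    real ^ 6 \<Rightarrow> real ^ 6 \<Rightarrow> real ^ 6 \<Rightarrow> real" where
  "pull_phi M c u x y z =
     along M c u (phi (amb M)) (push M c u x) (push M c u y) (push M c u z)"

definition pull_n_star :: "('a, 'b) hypersurf \<Rightarrow> ('a, 6) chart \<Rightarrow> real ^ 6 \<Rightarrow>
    real ^ 6 \<Rightarrow> real ^ 6 \<Rightarrow> real ^ 6 \<Rightarrow> real" where
  "pull_n_star M c u x y z =
     along M c u (star_phi (amb M)) (normal M c u) (push M c u x) (push M c u y) (push M c u z)"

definition psi_plus :: "('a, 'b) hypersurf \<Rightarrow> ('a \<Rightarrow> real) \<Rightarrow> ('a, 6) chart \<Rightarrow> real ^ 6 \<Rightarrow>
    real ^ 6 \<Rightarrow> real ^ 6 \<Rightarrow> real ^ 6 \<Rightarrow> real" where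
  "psi_plus M \<theta> c u x y z = cos (\<theta> (coord_inv c u)) * pull_phi M c u x y z
     - sin (\<theta> (coord_inv c u)) * pull_n_star M c u x y z"

definition psi_minus :: "('a, 'b) hypersurf \<Rightarrow> ('a \<Rightarrow> real) \<Rightarrow> ('a, 6) chart \<Rightarrow> real ^ 6 \<Rightarrow>
    real ^ 6 \<Rightarrow> real ^ 6 \<Rightarrow> real ^ 6 \<Rightarrow> real" where
  "psi_minus M \<theta> c u x y z = sin (\<theta> (coord_inv c u)) * pull_phi M c u x y z
     + cos (\<theta> (coord_inv c u)) * pull_n_star M c u x y z"

definition nabla_omega :: "('a, 'b) hypersurf \<Rightarrow> ('a, 6) chart \<Rightarrow> real ^ 6 \<Rightarrow>
    real ^ 6 \<Rightarrow> real ^ 6 \<Rightarrow> real ^ 6 \<Rightarrow> real" where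
  "nabla_omega M c u = nabla2 (hconn M c u) (omega M c) u"

definition dstar_omega :: "('a, 'b) hypersurf \<Rightarrow> ('a, 6) chart \<Rightarrow> real ^ 6 \<Rightarrow> real ^ 6 \<Rightarrow> real" where
  "dstar_omega M c u x = (let e = some_frame (hmetric M c u) in
     - (\<Sum>i\<in>UNIV. nabla_omega M c u (e i) (e i) x))"

definition I_one :: "('v \<Rightarrow> 'v) \<Rightarrow> ('v \<Rightarrow> real) \<Rightarrow> 'v \<Rightarrow> real" where
  "I_one J m x = - m (J x)"

definition I_first :: "('v \<Rightarrow> 'v) \<Rightarrow> ('v \<Rightarrow> 'v \<Rightarrow> real) \<Rightarrow> 'v \<Rightarrow> 'v \<Rightarrow> real" where
  "I_first J b x y = - b (J x) y"

definition I_second :: "('v \<Rightarrow> 'v) \<Rightarrow> ('v \<Rightarrow> 'v \<Rightarrow> real) \<Rightarrow> 'v \<Rightarrow> 'v \<Rightarrow> real" where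
  "I_second J b x y = - b x (J y)"

definition I_both :: "('v \<Rightarrow> 'v) \<Rightarrow> ('v \<Rightarrow> 'v \<Rightarrow> real) \<Rightarrow> 'v \<Rightarrow> 'v \<Rightarrow> real" where
  "I_both J b x y = b (J x) (J y)"

definition nabla_I :: "('a, 'b) hypersurf \<Rightarrow> ('a, 6) chart \<Rightarrow> real ^ 6 \<Rightarrow> real ^ 6 \<Rightarrow> real ^ 6 \<Rightarrow> real ^ 6" where
  "nabla_I M c u x y = ddir (\<lambda>v. act_I M c v y) u x
     + hconn M c u x (act_I M c u y) - act_I M c u (hconn M c u x y)"

definition xi :: "('a, 'b) hypersurf \<Rightarrow> ('a, 6) chart \<Rightarrow> real ^ 6 \<Rightarrow> real ^ 6 \<Rightarrow> real ^ 6 \<Rightarrow> real ^ 6" where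
  "xi M c u x y = - (1 / 2) *\<^sub>R act_I M c u (nabla_I M c u x y)"

text \<open>The \<open>W\<^sub>5\<close>-part of the torsion: the one-form for which \<open>D = \<nabla> + \<eta> + \<xi>\<close> makes \<open>\<omega>\<close>, \<open>\<psi>\<^sub>+\<close> and
  \<open>\<psi>\<^sub>-\<close> parallel.\<close>

definition eta :: "('a, 'b) hypersurf \<Rightarrow> ('a \<Rightarrow> real) \<Rightarrow> ('a, 6) chart \<Rightarrow> real ^ 6 \<Rightarrow> real ^ 6 \<Rightarrow> real" where
  "eta M \<theta> c u = (THE m. linear m \<and>
     (let D = (\<lambda>x y. hconn M c u x y + I_one (act_I M c u) m x *\<^sub>R act_I M c u y + xi M c u x y) in
      (\<forall>x y z. nabla2 D (omega M c) u x y z = 0) \<and>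
      (\<forall>x y z w. nabla3 D (psi_plus M \<theta> c) u x y z w = 0) \<and>
      (\<forall>x y z w. nabla3 D (psi_minus M \<theta> c) u x y z w = 0)))"

section \<open>Types of \<open>SU(3)\<close>-structures\<close>

datatype torsion_sign = Plus | Minus

datatype torsion_class = W1 torsion_sign | W2 torsion_sign | W3 | W4 | W5

definition gray_hervella :: "(real ^ 6 \<Rightarrow> real ^ 6) \<Rightarrow> (real ^ 6 \<Rightarrow> real ^ 6 \<Rightarrow> real ^ 6 \<Rightarrow> real) \<Rightarrow> bool" where
  "gray_hervella J a \<longleftrightarrow> trilinear a \<and>
     (\<forall>x y z. a x y z = - a x z y \<and> a x y z = - a x (J y) (J z))"

definition r_map :: "(real ^ 6 \<Rightarrow> real ^ 6 \<Rightarrow> real) \<Rightarrow> (real ^ 6 \<Rightarrow> real ^ 6 \<Rightarrow> real ^ 6 \<Rightarrow> real) \<Rightarrow>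
    (real ^ 6 \<Rightarrow> real ^ 6 \<Rightarrow> real ^ 6 \<Rightarrow> real) \<Rightarrow> real ^ 6 \<Rightarrow> real ^ 6 \<Rightarrow> real" where
  "r_map G psi a x y = 1 / 2 * form_inner2 G (a x) (psi y)"

definition signed_bilinear :: "torsion_sign \<Rightarrow> (real ^ 6 \<Rightarrow> real ^ 6 \<Rightarrow> real) \<Rightarrow> bool" where
  "signed_bilinear s b \<longleftrightarrow>
     (\<forall>x y. b x y = (case s of Plus \<Rightarrow> b y x | Minus \<Rightarrow> - b y x))"

text \<open>\<open>W5\<close> is not a component of \<open>\<nabla>\<omega>\<close> and gets a dummy value that is never used.\<close>

definition torsion_module :: "(real ^ 6 \<Rightarrow> real ^ 6 \<Rightarrow> real) \<Rightarrow> (real ^ 6 \<Rightarrow> real ^ 6) \<Rightarrow>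
    (real ^ 6 \<Rightarrow> real ^ 6 \<Rightarrow> real ^ 6 \<Rightarrow> real) \<Rightarrow> torsion_class \<Rightarrow>
    (real ^ 6 \<Rightarrow> real ^ 6 \<Rightarrow> real ^ 6 \<Rightarrow> real) set" where
  "torsion_module G J psi k = {a. gray_hervella J a \<and> (case k of
       W1 s \<Rightarrow> alternating3 a \<and> signed_bilinear s (r_map G psi a)
     | W2 s \<Rightarrow> (\<forall>x y z. a x y z + a y z x + a z x y = 0) \<and> signed_bilinear s (r_map G psi a)
     | W3 \<Rightarrow> (\<forall>x y z. a (J x) (J y) z = a x y z) \<and>
           (\<forall>z. (\<Sum>i\<in>UNIV. a (some_frame G i) (some_frame G i) z) = 0)
     | W4 \<Rightarrow> (\<exists>t. linear t \<and> (\<forall>x y z. a x y z =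
           G x y * t z - G x z * t y - G x (J y) * t (J z) + G x (J z) * t (J y)))
     | W5 \<Rightarrow> False)}"

definition gh_classes :: "torsion_class set" where
  "gh_classes = {W1 Plus, W1 Minus, W2 Plus, W2 Minus, W3, W4}"

text \<open>
  As the six modules form a direct sum, the family \<open>a\<close> below is unique: \<open>a k\<close> is the component of
  \<open>\<nabla>\<omega>\<close> of class \<open>k\<close>.
\<close>

definition of_type :: "('a, 'b) hypersurf \<Rightarrow> ('a \<Rightarrow> real) \<Rightarrow> torsion_class set \<Rightarrow> bool" where
  "of_type M \<theta> U \<longleftrightarrow> (\<forall>c\<in>hcharts M. \<forall>u\<in>coord_dom c.
     (\<exists>a. (\<forall>k\<in>gh_classes. a k \<in> torsion_module (hmetric M c u) (act_I M c u) (psi_plus M \<theta> c u) k) \<and>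
          (\<forall>x y z. nabla_omega M c u x y z = (\<Sum>k\<in>gh_classes. a k x y z)) \<and>
          (\<forall>k\<in>gh_classes - U. \<forall>x y z. a k x y z = 0)) \<and>
     (W5 \<notin> U \<longrightarrow> (\<forall>x. eta M \<theta> c u x = 0)))"

end

theory Submission
  imports Defs
begin

text \<open>
  In a Cayley frame along the immersion everything becomes algebra on \<open>real ^ 7\<close> with the standard
  forms. The covariant derivative of \<open>\<phi>\<close> is the derivation by the skew connection matrix, hence
  \<open>\<nabla>\<^sub>x \<phi>\<close> is the contraction of the dual four-form with the vector
  dual to \<open>r(\<phi>)(x, _)\<close>. With the Gauss and Weingarten formulas this gives
  \<open>(\<nabla>\<^sub>x \<omega>)(y, z) = \<psi>(R x, y, z)\<close> with \<open>\<psi> = \<iota>\<^sup>* \<phi>\<close> and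
  \<open>\<langle>R x, y\<rangle> = B(x, y) + r(\<phi>)(x, I y)\<close>. The map \<open>R \<mapsto> \<psi>(R _, _, _)\<close> identifies endomorphisms of
  the tangent space with Gray-Hervella tensors, so that for \<open>\<psi>\<^sub>+ = \<psi>\<close> the modules \<open>W\<^sub>1\<close> and \<open>W\<^sub>2\<close> are
  the trace and the trace-free part of the endomorphisms that commute with \<open>I\<close> (the sign separating the
  symmetric from the skew ones), and \<open>W\<^sub>3\<close>, \<open>W\<^sub>4\<close> are the symmetric and the skew endomorphisms that
  anticommute with \<open>I\<close>. The condition \<open>X\<^sub>2\<close> makes the commuting part of \<open>R\<close> symmetric with trace
  \<open>6 h\<close>. For \<open>\<theta> = \<pi> / 2\<close> one has \<open>\<psi>\<^sub>+ = \<psi>(I _, _, _)\<close>, which exchanges the two signs.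
\<close>

section \<open>Inner products and orthonormal frames\<close>

text \<open>The tensors on the hypersurface are defined by choice: an ambient chart that may jump
  from point to point, some orthonormal frame, and \<open>THE\<close> for \<open>I\<close>, the
  connection and \<open>eta\<close>. None of these can be differentiated directly. So each is first
  computed, near a given point, in one fixed ambient chart and Cayley frame. Skew matrices that
  annihilate \<phi> form g_2, so \<nabla>\<phi> sees only a seven-dimensional quotient of the
  connection matrix; this is why it is encoded by a vector. The two halves of X_2 enter separately.
  Skewness of r(\<phi>) makes the commuting part of R symmetric. The vanishing contraction with
  \<phi> says two things. Tested on n, it makes r(\<phi>)(_, I _) trace-free, whence the trace 6 h.
  Tested on tangent vectors, it makes the divergence of \<nabla>\<omega> equal to 2 r(\<phi>)(_, n).
  The same one-form is the coefficient left over in \<nabla>\<psi>, which determines \<eta>; hence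
  \<eta> = 0 forces the W_4-part to vanish too, and in the first equivalence one condition removes
  both W_4 and W_5.\<close>

definition inner_form :: "(real ^ 'n \<Rightarrow> real ^ 'n \<Rightarrow> real) \<Rightarrow> bool" where
  "inner_form G \<longleftrightarrow> bilinear G \<and> (\<forall>x y. G x y = G y x) \<and> (\<forall>x. x \<noteq> 0 \<longrightarrow> G x x > 0)"

lemma inner_formD:
  assumes "inner_form G"
  shows inner_form_bilinear: "bilinear G"
    and inner_form_sym: "G x y = G y x"
    and inner_form_pos: "x \<noteq> 0 \<Longrightarrow> G x x > 0"
  using assms unfolding inner_form_def by blast+

lemma inner_form_linear:
  assumes "inner_form G"
  shows "linear (G x)" "linear (\<lambda>x. G x y)"
  using inner_form_bilinear[OF assms] by (simp_all add: bilinear_def)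

lemma inner_form_eqI:
  assumes "inner_form G" "\<And>z. G x z = G y z"
  shows "x = y"
proof (rule ccontr)
  assume "x \<noteq> y"
  then have "G (x - y) (x - y) > 0"
    using inner_form_pos[OF assms(1)] by simp
  then show False
    using assms(2) by (simp add: bilinear_lsub[OF inner_form_bilinear[OF assms(1)]])
qed

definition comps :: "(real ^ 'n \<Rightarrow> real ^ 'n \<Rightarrow> real) \<Rightarrow> ('n::finite \<Rightarrow> real ^ 'n) \<Rightarrow> real ^ 'n \<Rightarrow> real ^ 'n" where
  "comps G e x = (\<chi> i. G (e i) x)"

lemma comps_nth [simp]: "comps G e x $ i = G (e i) x"
  by (simp add: comps_def)

lemma linear_comps: "inner_form G \<Longrightarrow> linear (comps G e)"
  using inner_form_linear(1)[of G] by (simp add: linear_iff vec_eq_iff)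

lemma comps_frame: "orthonormal G e \<Longrightarrow> comps G e (e i) = axis i 1"
  by (auto simp: vec_eq_iff orthonormal_def axis_def)

lemma comps_surj:
  assumes "inner_form G" "orthonormal G e"
  shows "comps G e (\<Sum>i\<in>UNIV. v $ i *\<^sub>R e i) = v"
proof -
  note l = linear_comps[OF assms(1), of e]
  show ?thesis
    by (simp add: linear_sum[OF l] linear_scale[OF l] comps_frame[OF assms(2)])
      (simp add: basis_expansion flip: scalar_mult_eq_scaleR)
qed

lemma orthonormal_expand:
  assumes "inner_form G" "orthonormal G e"
  shows "(\<Sum>i\<in>UNIV. G (e i) x *\<^sub>R e i) = x"
proof -
  define g where "g v = (\<Sum>i\<in>UNIV. v $ i *\<^sub>R e i)" for v
  have g: "linear g"
    by (simp add: linear_iff g_def scaleR_left_distrib sum.distrib scaleR_sum_right)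
  have "comps G e \<circ> g = id"
    using comps_surj[OF assms] by (simp add: fun_eq_iff g_def)
  \<comment> \<open>A right inverse of an endomorphism in finite dimension is also a left inverse,
    so spanning needs no separate argument.\<close>
  then have "g \<circ> comps G e = id"
    using linear_inverse_left[OF linear_comps[OF assms(1)] g] by simp
  then show ?thesis
    by (simp add: fun_eq_iff g_def)
qed

lemma frame_expand:
  assumes "inner_form G" "orthonormal G e" "linear f"
  shows "(\<Sum>i\<in>UNIV. G (e i) x *\<^sub>R f (e i)) = f x"
proof -
  have "f x = f (\<Sum>i\<in>UNIV. G (e i) x *\<^sub>R e i)"
    by (simp add: orthonormal_expand[OF assms(1,2)])
  then show ?thesis
    by (simp add: linear_sum[OF assms(3)] linear_scale[OF assms(3)])
qed

lemma frame_parseval: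
  assumes "inner_form G" "orthonormal G e"
  shows "(\<Sum>i\<in>UNIV. G (e i) x * G (e i) y) = G x y"
  using frame_expand[OF assms inner_form_linear(2)[OF assms(1), of y], of x] by simp

lemma comps_inner:
  assumes "inner_form G" "orthonormal G e"
  shows "comps G e x \<bullet> comps G e y = G x y"
  by (simp add: inner_vec_def frame_parseval[OF assms])

lemma comps_eq_iff:
  assumes "inner_form G" "orthonormal G e"
  shows "comps G e x = comps G e y \<longleftrightarrow> x = y"
  by (metis assms comps_inner inner_form_eqI)

lemma frame_riesz:
  assumes "inner_form G" "orthonormal G e" "linear f"
  obtains w where "\<And>z. G w z = f z"
proof
  fix z
  note l = inner_form_linear(2)[OF assms(1), of z]
  have "G (\<Sum>i\<in>UNIV. f (e i) *\<^sub>R e i) z = (\<Sum>i\<in>UNIV. G (e i) z *\<^sub>R f (e i))"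
    by (simp add: linear_sum[OF l] linear_scale[OF l] mult.commute)
  then show "G (\<Sum>i\<in>UNIV. f (e i) *\<^sub>R e i) z = f z"
    using frame_expand[OF assms, of z] by simp
qed

text \<open>Expanding one argument in \<open>f\<close>, exchanging the sums and collapsing the other
  argument in \<open>e\<close> shows that a trace does not depend on the frame. This is what
  replaces \<open>some_frame\<close> by a convenient frame.\<close>

lemma frame_sum:
  fixes b :: "real ^ 'n \<Rightarrow> real ^ 'n \<Rightarrow> real"
  assumes "inner_form G" "orthonormal G e" "orthonormal G f" "bilinear b"
  shows "(\<Sum>i\<in>UNIV. b (e i) (e i)) = (\<Sum>i\<in>UNIV. b (f i) (f i))"
proof -
  have l: "linear (b x)" "linear (\<lambda>x. b x y)" for x y
    using assms(4) by (simp_all add: bilinear_def)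
  have "(\<Sum>i\<in>UNIV. b (e i) (e i)) = (\<Sum>i\<in>UNIV. \<Sum>j\<in>UNIV. G (f j) (e i) * b (e i) (f j))"
    using frame_expand[OF assms(1,3) l(1)] by simp
  also have "\<dots> = (\<Sum>j\<in>UNIV. \<Sum>i\<in>UNIV. G (e i) (f j) * b (e i) (f j))"
    by (subst sum.swap) (simp add: inner_form_sym[OF assms(1)])
  also have "\<dots> = (\<Sum>j\<in>UNIV. b (f j) (f j))"
    using frame_expand[OF assms(1,2) l(2)] by simp
  finally show ?thesis .
qed

lemma bilinear_mult: "linear f \<Longrightarrow> linear g \<Longrightarrow> bilinear (\<lambda>x y. f x * (g y :: real))"
  by (simp add: bilinear_def linear_iff algebra_simps)

lemma bilinear_sum_fun: "(\<And>i. i \<in> S \<Longrightarrow> bilinear (b i)) \<Longrightarrow> bilinear (\<lambda>x y. \<Sum>i\<in>S. b i x y)"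
  by (simp add: bilinear_def linear_compose_sum)

lemma orthonormal_some_frame: "orthonormal G e \<Longrightarrow> orthonormal G (some_frame G)"
  unfolding some_frame_def by (rule someI [where P = "orthonormal G"])

lemma form_inner2_frame:
  assumes "inner_form G" "orthonormal G e" "bilinear a" "bilinear b"
  shows "form_inner2 G a b = (\<Sum>i\<in>UNIV. \<Sum>j\<in>UNIV. a (e i) (e j) * b (e i) (e j)) / 2"
proof -
  define f where "f = some_frame G"
  have f: "orthonormal G f"
    unfolding f_def using assms(2) by (rule orthonormal_some_frame)
  have l: "linear (a x)" "linear (\<lambda>x. a x y)" "linear (b x)" "linear (\<lambda>x. b x y)" for x y
    using assms(3,4) by (simp_all add: bilinear_def)
  have "(\<Sum>i\<in>UNIV. \<Sum>j\<in>UNIV. a (f i) (f j) * b (f i) (f j))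
      = (\<Sum>i\<in>UNIV. \<Sum>j\<in>UNIV. a (f i) (e j) * b (f i) (e j))"
    by (intro sum.cong refl frame_sum[OF assms(1) f assms(2)] bilinear_mult l)
  also have "\<dots> = (\<Sum>i\<in>UNIV. \<Sum>j\<in>UNIV. a (e i) (e j) * b (e i) (e j))"
    by (rule frame_sum[OF assms(1) f assms(2)]) (intro bilinear_sum_fun bilinear_mult l)
  finally show ?thesis
    by (simp add: form_inner2_def Let_def f_def)
qed

text \<open>One index at a time is moved from \<open>some_frame\<close> to \<open>e\<close>, each
  time by \<open>frame_sum\<close>.\<close>

lemma form_inner3_frame:
  assumes "inner_form G" "orthonormal G e" "trilinear a" "trilinear b"
  shows "form_inner3 G a b =
    (\<Sum>i\<in>UNIV. \<Sum>j\<in>UNIV. \<Sum>k\<in>UNIV. a (e i) (e j) (e k) * b (e i) (e j) (e k)) / 6"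
proof -
  define f where "f = some_frame G"
  have f: "orthonormal G f"
    unfolding f_def using assms(2) by (rule orthonormal_some_frame)
  have l: "linear (\<lambda>x. a x y z)" "linear (\<lambda>y. a x y z)" "linear (\<lambda>z. a x y z)"
     "linear (\<lambda>x. b x y z)" "linear (\<lambda>y. b x y z)" "linear (\<lambda>z. b x y z)" for x y z
    using assms(3,4) by (simp_all add: trilinear_def)
  have "(\<Sum>i\<in>UNIV. \<Sum>j\<in>UNIV. \<Sum>k\<in>UNIV. a (f i) (f j) (f k) * b (f i) (f j) (f k))
      = (\<Sum>i\<in>UNIV. \<Sum>j\<in>UNIV. \<Sum>k\<in>UNIV. a (f i) (f j) (e k) * b (f i) (f j) (e k))"
    by (intro sum.cong refl frame_sum[OF assms(1) f assms(2)] bilinear_mult l)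
  also have "\<dots> = (\<Sum>i\<in>UNIV. \<Sum>j\<in>UNIV. \<Sum>k\<in>UNIV. a (f i) (e j) (e k) * b (f i) (e j) (e k))"
    by (intro sum.cong refl frame_sum[OF assms(1) f assms(2)] bilinear_sum_fun bilinear_mult l)
  also have "\<dots> = (\<Sum>i\<in>UNIV. \<Sum>j\<in>UNIV. \<Sum>k\<in>UNIV. a (e i) (e j) (e k) * b (e i) (e j) (e k))"
    by (rule frame_sum[OF assms(1) f assms(2)]) (intro bilinear_sum_fun bilinear_mult l)
  finally show ?thesis
    by (simp add: form_inner3_def Let_def f_def fact_numeral)
qed

text \<open>An orthonormal basis of the range is pulled back. A \<open>SOME\<close> term says
  nothing without existence; this makes \<open>some_frame\<close> of the induced metric an actual
  frame.\<close>

lemma isometry_frame: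
  fixes a :: "real ^ 'n \<Rightarrow> 'b::euclidean_space"
  assumes a: "linear a" "inner_form G" "\<And>x y. a x \<bullet> a y = G x y"
  obtains e where "orthonormal G e"
proof -
  have inj: "inj a"
    by (metis (no_types, lifting) a(2,3) inj_onI inner_form_eqI)
  have "subspace (range a)"
    by (simp add: a(1) linear_subspace_image)
  then obtain B where B: "B \<subseteq> range a" "pairwise orthogonal B" "\<And>x. x \<in> B \<Longrightarrow> norm x = 1"
    "card B = dim (range a)" "independent B"
    using orthonormal_basis_subspace by metis
  have "card B = card (UNIV :: 'n set)"
    using B(4) dim_image_eq[OF a(1), of UNIV] inj by (simp add: inj_on_def)
  moreover have "finite B"
    using B(5) independent_imp_finite by blast
  ultimately obtain g :: "'n \<Rightarrow> 'b" where g: "bij_betw g UNIV B"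
    by (metis finite_same_card_bij finite_class.finite_UNIV)
  have gB: "g i \<in> B" for i
    using g by (auto simp: bij_betw_def)
  then have "\<exists>x. a x = g i" for i
    using B(1) by (metis rangeE subsetD)
  then obtain e where e: "\<And>i. a (e i) = g i"
    by metis
  have "orthonormal G e"
    unfolding orthonormal_def
  proof (intro allI)
    fix i j
    have "g i \<bullet> g j = (if i = j then 1 else 0)"
    proof (cases "i = j")
      case True
      then show ?thesis using B(3)[OF gB] by (simp add: dot_square_norm)
    next
      case False
      then have "g i \<noteq> g j"
        using g by (metis bij_betw_imp_inj_on injD)
      then show ?thesis
        using B(2) gB False by (auto simp: pairwise_def orthogonal_def)
    qed
    then show "G (e i) (e j) = (if i = j then 1 else 0)"
      by (simp add: e flip: a(3))
  qed
  then show ?thesis by (rule that)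
qed

section \<open>The cross product of \<open>real ^ 7\<close>\<close>

lemma UNIV_7: "(UNIV :: 7 set) = {0, 1, 2, 3, 4, 5, 6}"
proof (rule sym, rule card_subset_eq)
  show "card {0, 1, 2, 3, 4, 5, 6 :: 7} = card (UNIV :: 7 set)"
    by simp
qed simp_all

lemma sum_7: "(\<Sum>i\<in>(UNIV :: 7 set). f i) = f 0 + f 1 + f 2 + f 3 + f 4 + f 5 + f 6"
  unfolding UNIV_7 by (simp add: add.assoc)

lemma wrap_7: "(7::7) = 0" "(8::7) = 1" "(9::7) = 2" "(10::7) = 3" "(11::7) = 4" "(12::7) = 5"
  by simp_all

definition phi0 :: "real ^ 7 \<Rightarrow> real ^ 7 \<Rightarrow> real ^ 7 \<Rightarrow> real" where
  "phi0 x y z = (\<Sum>i\<in>UNIV. wedge3 (\<lambda>v. v $ i) (\<lambda>v. v $ (i + 1)) (\<lambda>v. v $ (i + 3)) x y z)"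

definition star_phi0 :: "real ^ 7 \<Rightarrow> real ^ 7 \<Rightarrow> real ^ 7 \<Rightarrow> real ^ 7 \<Rightarrow> real" where
  "star_phi0 x y z w = - (\<Sum>i\<in>UNIV. wedge4 (\<lambda>v. v $ (i + 2)) (\<lambda>v. v $ (i + 4))
     (\<lambda>v. v $ (i + 5)) (\<lambda>v. v $ (i + 6)) x y z w)"

definition cross0 :: "real ^ 7 \<Rightarrow> real ^ 7 \<Rightarrow> real ^ 7" where
  "cross0 x y = (\<chi> k. phi0 x y (axis k 1))"

lemma inner_7: "(x :: real ^ 7) \<bullet> y = (\<Sum>i\<in>UNIV. x $ i * y $ i)"
  by (simp add: inner_vec_def)

lemma phi0_expand: "phi0 x y z = 
   (\<Sum>i\<in>UNIV. (x $ (i + 1) * y $ (i + 3) - y $ (i+1) * x $ (i + 3) 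
  + x $ (i + 2) * y $ (i + 6) - y $ (i+2) * x $ (i + 6) 
  + x $ (i + 4) * y $ (i + 5) - y $ (i+4) * x $ (i + 5)) * z $ i)"
  by (simp add: phi0_def sum_7 wedge3_def wedge2_def wrap_7 algebra_simps)

lemma cross0_nth: "cross0 x y $ i = x $ (i + 1) * y $ (i + 3) - y $ (i+1) * x $ (i + 3) 
  + x $ (i + 2) * y $ (i + 6) - y $ (i+2) * x $ (i + 6) 
  + x $ (i + 4) * y $ (i + 5) - y $ (i+4) * x $ (i + 5)"
  by (simp add: cross0_def phi0_expand axis_def if_distrib cong: if_cong)

lemma cross0_inner: "cross0 x y \<bullet> z = phi0 x y z"
  by (simp add: inner_7 cross0_nth phi0_expand)

text \<open>A polynomial identity in 28 coordinates, checked by normalisation. It ties the sign of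
  the dual form to the product, and most later facts on \<open>star_phi0\<close> use it instead of
  coordinates.\<close>

lemma cross0_inner_cross0:
  "cross0 x y \<bullet> cross0 z w = (x \<bullet> z) * (y \<bullet> w) - (x \<bullet> w) * (y \<bullet> z) - star_phi0 x y z w"
  unfolding inner_7 star_phi0_def sum_7 cross0_nth wedge4_def wedge3_def wedge2_def
  by (simp add: wrap_7, algebra)

lemma bilinear_cross0: "bilinear cross0"
  by (simp add: bilinear_def linear_iff vec_eq_iff cross0_nth algebra_simps)

interpretation cross0: bounded_bilinear cross0
  using bilinear_cross0 by (simp add: bilinear_conv_bounded_bilinear)

lemmas phi0_cross0 = cross0_inner [symmetric]

lemma phi0_linear [simp]:
  "phi0 (x + x') y z = phi0 x y z + phi0 x' y z"
  "phi0 x (y + y') z = phi0 x y z + phi0 x y' z"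
  "phi0 x y (z + z') = phi0 x y z + phi0 x y z'"
  "phi0 (x - x') y z = phi0 x y z - phi0 x' y z"
  "phi0 x (y - y') z = phi0 x y z - phi0 x y' z"
  "phi0 x y (z - z') = phi0 x y z - phi0 x y z'"
  "phi0 (c *\<^sub>R x) y z = c * phi0 x y z"
  "phi0 x (c *\<^sub>R y) z = c * phi0 x y z"
  "phi0 x y (c *\<^sub>R z) = c * phi0 x y z"
  "phi0 (- x) y z = - phi0 x y z"
  "phi0 x (- y) z = - phi0 x y z"
  "phi0 x y (- z) = - phi0 x y z"
  by (simp_all add: phi0_cross0 cross0.add_left cross0.add_right cross0.diff_left cross0.diff_right
      cross0.scaleR_left cross0.scaleR_right cross0.minus_left cross0.minus_right inner_simps)

lemma phi0_swap: "phi0 y x z = - phi0 x y z" "phi0 x z y = - phi0 x y z"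
  by (simp_all add: phi0_def sum_7 wedge3_def wedge2_def algebra_simps)

lemma phi0_cyc: "phi0 y z x = phi0 x y z"
  by (metis phi0_swap minus_minus)

lemma phi0_swap3: "phi0 z y x = - phi0 x y z"
  by (metis phi0_swap minus_minus)

lemma phi0_same [simp]: "phi0 x x y = 0" "phi0 x y x = 0" "phi0 y x x = 0"
  using phi0_swap(1)[of x x y] phi0_swap(2)[of y x x] phi0_cyc [of x y x] by auto

lemma star_phi0_swap:
  "star_phi0 y x z w = - star_phi0 x y z w"
  "star_phi0 x z y w = - star_phi0 x y z w"
  "star_phi0 x y w z = - star_phi0 x y z w"
  by (simp_all add: star_phi0_def sum_7 wedge4_def wedge3_def wedge2_def algebra_simps)

lemma star_phi0_cross0:
  "star_phi0 x y z w = (x \<bullet> z) * (y \<bullet> w) - (x \<bullet> w) * (y \<bullet> z) - cross0 x y \<bullet> cross0 z w"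
  by (simp add: cross0_inner_cross0)

lemma star_phi0_linear [simp]:
  "star_phi0 (x + x') y z w = star_phi0 x y z w + star_phi0 x' y z w"
  "star_phi0 (c *\<^sub>R x) y z w = c * star_phi0 x y z w"
  by (simp_all add: star_phi0_cross0 cross0.add_left cross0.scaleR_left inner_simps algebra_simps)

lemma star_phi0_same [simp]: "star_phi0 x x z w = 0" "star_phi0 x y x w = 0"
  "star_phi0 x y z x = 0" "star_phi0 x y y w = 0" "star_phi0 x y z y = 0"
proof -
  show *: "star_phi0 x x z w = 0" for x z w
    using star_phi0_swap(1)[of x x z w] by auto
  show **: "star_phi0 x y x w = 0" for y w
    using *[of x y w] star_phi0_swap(2)[of x y x w] by simp
  show "star_phi0 x y z x = 0"
    using **[of y z] star_phi0_swap(3)[of x y z x] by simp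
  show ***: "star_phi0 x y y w = 0" for w
    using star_phi0_swap(2)[of x y y w] by simp
  show "star_phi0 x y z y = 0"
    using ***[of z] star_phi0_swap(3)[of x y z y] by simp
qed

lemma cross0_same [simp]: "cross0 x x = 0"
  by (simp add: vec_eq_iff cross0_nth)

lemma cross0_swap: "cross0 y x = - cross0 x y"
  by (simp add: vec_eq_iff cross0_nth)

lemma inner_cross0: "x \<bullet> cross0 y z = phi0 x y z"
  by (metis cross0_inner inner_commute phi0_cyc)

lemma cross0_cross0: "cross0 x (cross0 x y) = (x \<bullet> y) *\<^sub>R x - (x \<bullet> x) *\<^sub>R y"
proof (rule vector_eq_rdot [THEN iffD1, rule_format])
  fix z
  have "cross0 x (cross0 x y) \<bullet> z = - (cross0 x z \<bullet> cross0 x y)"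
    by (metis cross0_inner phi0_swap(2))
  also have "\<dots> = ((x \<bullet> y) *\<^sub>R x - (x \<bullet> x) *\<^sub>R y) \<bullet> z"
    by (simp add: cross0_inner_cross0 inner_simps inner_commute)
  finally show "cross0 x (cross0 x y) \<bullet> z = ((x \<bullet> y) *\<^sub>R x - (x \<bullet> x) *\<^sub>R y) \<bullet> z" .
qed

text \<open>For skew \<open>A\<close>, the entry \<open>i\<close> is half the sum over j, k of
  \<phi>(e_i, e_j, e_k) times the matrix entry (j, k) of \<open>A\<close>: the equivariant
  projection of so(7) to \<real>^7 with kernel g_2.\<close>

definition torsion_vec :: "(real ^ 7 \<Rightarrow> real ^ 7) \<Rightarrow> real ^ 7" where
  "torsion_vec A = (\<chi> i. A (axis (i + 3) 1) $ (i + 1) + A (axis (i + 6) 1) $ (i + 2)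
     + A (axis (i + 5) 1) $ (i + 4))"

text \<open>The derivation is zero on g_2, so it factors through the projection
  \<open>torsion_vec\<close>; equivariance suggests a contraction of the dual four-form. The exact
  multiple, 1, and the signs are verified in coordinates.\<close>

lemma phi0_derivation:
  assumes "linear A" and skew: "\<And>x y. A x \<bullet> y = - (x \<bullet> A y)"
  shows "phi0 (A x) y z + phi0 x (A y) z + phi0 x y (A z) = star_phi0 (torsion_vec A) x y z"
proof -
  define a where "a i j = A (axis j 1) $ i" for i j
  have A: "A p $ i = (\<Sum>j\<in>UNIV. a i j * p $ j)" for p i
  proof -
    have "A p = A (\<Sum>j\<in>UNIV. p $ j *\<^sub>R axis j 1)"
      by (simp add: basis_expansion flip: scalar_mult_eq_scaleR)
    also have "\<dots> = (\<Sum>j\<in>UNIV. p $ j *\<^sub>R A (axis j 1))"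
      by (simp add: linear_sum [OF \<open>linear A\<close>] linear_scale [OF \<open>linear A\<close>] o_def)
    finally show ?thesis
      by (simp add: a_def mult.commute)
  qed
  have a: "a j i = - a i j" for i j
    using skew [of "axis i 1" "axis j 1"] by (simp add: a_def inner_axis inner_axis')
  have a0: "a i i = 0" for i
    using a [of i i] by simp
  \<comment> \<open>With the diagonal zero, the 21 entries above it are the free variables of the
    polynomial identity; these rewrites make skewness visible to \<open>algebra\<close>.\<close>
  have a': "a 1 0 = - a 0 1" "a 2 0 = - a 0 2" "a 3 0 = - a 0 3" "a 4 0 = - a 0 4"
    "a 5 0 = - a 0 5" "a 6 0 = - a 0 6" "a 2 1 = - a 1 2" "a 3 1 = - a 1 3" "a 4 1 = - a 1 4"
    "a 5 1 = - a 1 5" "a 6 1 = - a 1 6" "a 3 2 = - a 2 3" "a 4 2 = - a 2 4" "a 5 2 = - a 2 5"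
    "a 6 2 = - a 2 6" "a 4 3 = - a 3 4" "a 5 3 = - a 3 5" "a 6 3 = - a 3 6" "a 5 4 = - a 4 5"
    "a 6 4 = - a 4 6" "a 6 5 = - a 5 6"
    by (rule a)+
  have t: "torsion_vec A $ i = a (i + 1) (i + 3) + a (i + 2) (i + 6) + a (i + 4) (i + 5)" for i
    by (simp add: torsion_vec_def a_def)
  show ?thesis
    unfolding phi0_expand star_phi0_def sum_7 wedge4_def wedge3_def wedge2_def t A
    by (simp add: wrap_7 a0 a', algebra)
qed

lemma sum_axis: "(\<Sum>i\<in>UNIV. (x \<bullet> axis i 1) * (y \<bullet> axis i 1)) = x \<bullet> (y :: real ^ 'n)"
  by (simp add: inner_axis) (simp add: inner_vec_def)

lemma sum_axis_linear:
  assumes "linear f"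
  shows "(\<Sum>i\<in>UNIV. (y \<bullet> axis i 1) * f (axis i 1)) = f (y :: real ^ 'n)"
proof -
  have "f y = f (\<Sum>j\<in>UNIV. y $ j *\<^sub>R axis j 1)"
    by (simp add: basis_expansion flip: scalar_mult_eq_scaleR)
  also have "\<dots> = (\<Sum>i\<in>UNIV. (y \<bullet> axis i 1) * f (axis i 1))"
    by (simp add: linear_sum [OF assms] linear_scale [OF assms] inner_axis)
  finally show ?thesis ..
qed

lemma sum_cross0_axis: "(\<Sum>i\<in>UNIV. cross0 u (axis i 1) \<bullet> cross0 v (axis i 1)) = 6 * (u \<bullet> v)"
proof -
  have "(\<Sum>i\<in>UNIV. cross0 u (axis i 1) \<bullet> cross0 v (axis i 1))
      = (\<Sum>i\<in>(UNIV::7 set). u \<bullet> v - (u \<bullet> axis i 1) * (v \<bullet> axis i 1))"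
    by (simp add: cross0_inner_cross0 inner_axis_axis inner_commute)
  then show ?thesis
    by (simp add: sum_subtractf sum_axis)
qed

text \<open>Dividing by 3! leaves 4 times the inner product, which cancels the factor 1/4 in
  \<open>rbar\<close>. The number arises as 2 * 6 + 2 * 6 in the outermost sum.\<close>

lemma star_phi0_norm:
  "(\<Sum>i\<in>UNIV. \<Sum>j\<in>UNIV. \<Sum>k\<in>UNIV. star_phi0 y (axis i 1) (axis j 1) (axis k 1) *
      star_phi0 z (axis i 1) (axis j 1) (axis k 1)) = 24 * (y \<bullet> z)"
proof -
  have l: "linear (\<lambda>x. a \<bullet> cross0 q x)" for a q
    by (simp add: linear_iff cross0.add_right cross0.scaleR_right inner_simps)
  have e: "j \<bullet> cross0 q y = - (y \<bullet> cross0 q j)" for j q y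
    by (metis inner_cross0 phi0_swap3)
  \<comment> \<open>\<open>V y (cross0 y j) j k\<close> is the vector representing the last slot of
    \<open>star_phi0 y j k\<close>, so Parseval removes the innermost sum. The product is a free
    parameter \<open>q\<close> to keep it from being expanded.\<close>
  define V where "V y q j k = (y \<bullet> k) *\<^sub>R j - (j \<bullet> k) *\<^sub>R y - cross0 q k" for y q j k
  have V: "star_phi0 y j k w = V y (cross0 y j) j k \<bullet> w" for y j k w
    by (simp add: star_phi0_cross0 V_def inner_simps cross0_inner inner_cross0 phi0_cyc)
  have VV: "V y p j k \<bullet> V z q j k = (j \<bullet> j) * ((y \<bullet> k) * (z \<bullet> k)) - (j \<bullet> z) * ((y \<bullet> k) * (j \<bullet> k))
      - (y \<bullet> k) * (j \<bullet> cross0 q k) - (y \<bullet> j) * ((j \<bullet> k) * (z \<bullet> k)) + (y \<bullet> z) * ((j \<bullet> k) * (j \<bullet> k))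
      + (j \<bullet> k) * (y \<bullet> cross0 q k) - (z \<bullet> k) * (j \<bullet> cross0 p k) + (j \<bullet> k) * (z \<bullet> cross0 p k)
      + cross0 p k \<bullet> cross0 q k" for y z p q j k
    by (simp add: V_def inner_simps algebra_simps inner_commute)
  have "(\<Sum>k\<in>UNIV. \<Sum>l\<in>UNIV. star_phi0 y j (axis k 1) (axis l 1) * star_phi0 z j (axis k 1) (axis l 1))
     = 2 * ((j \<bullet> j) * (y \<bullet> z) - (y \<bullet> j) * (z \<bullet> j)) + 2 * (cross0 y j \<bullet> cross0 z j)" for j
  proof -
    have "(\<Sum>k\<in>UNIV. \<Sum>l\<in>UNIV. star_phi0 y j (axis k 1) (axis l 1) * star_phi0 z j (axis k 1) (axis l 1))
       = (\<Sum>k\<in>UNIV. V y (cross0 y j) j (axis k 1) \<bullet> V z (cross0 z j) j (axis k 1))"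
      by (simp add: V sum_axis)
    also have "\<dots> = 2 * ((j \<bullet> j) * (y \<bullet> z) - (y \<bullet> j) * (z \<bullet> j)) 
       + 2 * (y \<bullet> cross0 (cross0 z j) j) + 2 * (z \<bullet> cross0 (cross0 y j) j)
       + 6 * (cross0 y j \<bullet> cross0 z j)"
      unfolding VV sum.distrib sum_subtractf sum_distrib_left [symmetric] sum_axis sum_cross0_axis
        sum_axis_linear [OF l]
      by (simp add: e[of j _ y] e[of j _ z] inner_commute[of z j] algebra_simps)
    also have "y \<bullet> cross0 (cross0 z j) j = - (cross0 y j \<bullet> cross0 z j)"
      by (metis cross0_inner inner_cross0 phi0_swap(2))
    also have "z \<bullet> cross0 (cross0 y j) j = - (cross0 y j \<bullet> cross0 z j)"
      by (metis cross0_inner inner_commute inner_cross0 phi0_swap(2))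
    finally show ?thesis by simp
  qed
  then have "?thesis \<longleftrightarrow> (\<Sum>i\<in>(UNIV :: 7 set). 2 * ((y \<bullet> z) - (y \<bullet> axis i 1) * (z \<bullet> axis i 1))
      + 2 * (cross0 y (axis i 1) \<bullet> cross0 z (axis i 1))) = 24 * (y \<bullet> z)"
    by (simp add: inner_axis_axis)
  then show ?thesis
    unfolding sum.distrib sum_distrib_left [symmetric] sum_subtractf sum_axis sum_cross0_axis
    by simp
qed

section \<open>Restriction of the forms to the hyperplane orthogonal to a unit vector\<close>

lemma star_phi0_normal:
  assumes "n \<bullet> n = 1" "n \<bullet> y = 0" "n \<bullet> z = 0" "n \<bullet> w = 0"
  shows "star_phi0 n y z w = - phi0 (cross0 n y) z w"
  using assms by (simp add: star_phi0_cross0 cross0_inner inner_cross0 inner_commute)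

text \<open>Up to sign the left-hand side is the restriction of \<open>star_phi0 n\<close>, hence
  alternating. It expresses that \<psi> is the real part of a form of type (3,0).\<close>

lemma phi0_cross0_slide:
  assumes n: "n \<bullet> n = 1" and y: "n \<bullet> y = 0" "n \<bullet> z = 0" "n \<bullet> w = 0"
  shows "phi0 (cross0 n y) z w = phi0 y (cross0 n z) w"
  using star_phi0_normal[OF n y] star_phi0_normal[OF n y(2,1,3)] 
    star_phi0_swap(2)[of n y z w] phi0_swap(1)[of "cross0 n z" y w] by simp

lemma cross0_square: "n \<bullet> n = 1 \<Longrightarrow> n \<bullet> y = 0 \<Longrightarrow> cross0 n (cross0 n y) = - y"
  by (simp add: cross0_cross0)

lemma cross0_skew: "cross0 n x \<bullet> y = - (x \<bullet> cross0 n y)"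
  by (metis cross0_inner inner_cross0 phi0_swap(1))

text \<open>Conjugate linearity of the product on the hyperplane, up to a normal component. Testing
  against the tangential part of a vector, \<open>cross0 n\<close> is slid through the slots of
  \<open>phi0\<close>.\<close>

lemma cross0_slide:
  assumes n: "n \<bullet> n = 1" and x: "n \<bullet> x = 0" "n \<bullet> y = 0"
  shows "cross0 (cross0 n x) y = - cross0 n (cross0 x y) + (n \<bullet> cross0 (cross0 n x) y) *\<^sub>R n"
proof (rule vector_eq_rdot [THEN iffD1, rule_format])
  fix k
  define t where "t = k - (n \<bullet> k) *\<^sub>R n"
  have t: "n \<bullet> t = 0" "k = t + (n \<bullet> k) *\<^sub>R n"
    using n by (simp_all add: t_def inner_simps)
  have "phi0 (cross0 n x) y t = phi0 x y (cross0 n t)"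
    using phi0_cross0_slide[OF n x t(1)] phi0_cross0_slide[OF n x(2) t(1) x(1)]
      phi0_cyc[of x "cross0 n y" t] phi0_cyc[of x y "cross0 n t"]
      phi0_cyc[of y "cross0 n t" x] phi0_cyc[of "cross0 n y" t x] by simp
  also have "cross0 n t = cross0 n k"
    by (simp add: t_def cross0.diff_right cross0.scaleR_right)
  also have "phi0 x y (cross0 n k) = - (cross0 n (cross0 x y) \<bullet> k)"
    by (metis cross0_inner cross0_skew minus_minus)
  finally show "cross0 (cross0 n x) y \<bullet> k
      = (- cross0 n (cross0 x y) + (n \<bullet> cross0 (cross0 n x) y) *\<^sub>R n) \<bullet> k"
    by (subst t(2)) (simp add: inner_simps cross0_inner inner_cross0 phi0_cyc flip: t_def)
qed

text \<open>The right-hand side is minus half the square of the two-form \<open>phi0 n\<close>. The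
  difference \<open>Q\<close> of both sides is skew in its middle slots and changes sign when
  \<open>cross0 n\<close> passes from the first slot to the third, while sliding it through the
  second slot gives no sign; both can hold only for \<open>Q = 0\<close>.\<close>

lemma star_phi0_tangent:
  assumes n: "n \<bullet> n = 1" and x: "n \<bullet> x = 0" and y: "n \<bullet> y = 0" and z: "n \<bullet> z = 0" and w: "n \<bullet> w = 0"
  shows "star_phi0 x y z w = - (phi0 n x y * phi0 n z w - phi0 n x z * phi0 n y w
    + phi0 n x w * phi0 n y z)"
proof -
  define J where "J = cross0 n"
  define c where "c x y z w = cross0 x y \<bullet> cross0 z w - phi0 n x y * phi0 n z w" for x y z w
  define b where "b x y z w = (x \<bullet> z) * (y \<bullet> w) - (x \<bullet> w) * (y \<bullet> z)
     - phi0 n x z * phi0 n y w + phi0 n x w * phi0 n y z" for x y z w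
  define Q where "Q x y z w = c x y z w - b x y z w" for x y z w
  have Q: "Q x y z w = - star_phi0 x y z w - phi0 n x y * phi0 n z w + phi0 n x z * phi0 n y w
    - phi0 n x w * phi0 n y z" for x y z w
    by (simp add: Q_def b_def c_def cross0_inner_cross0)
  have Jn [simp]: "n \<bullet> J v = 0" for v
    by (simp add: J_def inner_cross0)
  have JJ: "J (J v) = - v" if "n \<bullet> v = 0" for v
    using cross0_square[OF n that] by (simp add: J_def)
  have om: "phi0 n u v = J u \<bullet> v" for u v
    by (simp add: J_def cross0_inner)
  have Js: "J u \<bullet> v = - (u \<bullet> J v)" for u v
    by (simp add: J_def cross0_skew)
  have c1: "c (J x) y z w = cross0 x y \<bullet> J (cross0 z w)" if "n \<bullet> x = 0" "n \<bullet> y = 0" for x y z w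
  proof -
    have "cross0 (J x) y \<bullet> cross0 z w
        = (- J (cross0 x y) + (n \<bullet> cross0 (cross0 n x) y) *\<^sub>R n) \<bullet> cross0 z w"
      using cross0_slide[OF n that] by (simp add: J_def)
    then show ?thesis
      by (simp add: c_def inner_simps Js) (simp add: inner_cross0 J_def)
  qed
  have c2: "c x y (J z) w = - c (J x) y z w" if "n \<bullet> x = 0" "n \<bullet> y = 0" "n \<bullet> z = 0" "n \<bullet> w = 0" for x y z w
  proof -
    have "c x y (J z) w = c (J z) w x y"
      by (simp add: c_def inner_commute)
    also have "\<dots> = - c (J x) y z w"
      using that Js[of "cross0 x y" "cross0 z w"] by (simp add: c1 inner_commute)
    finally show ?thesis .
  qed
  have b2: "b x y (J z) w = - b (J x) y z w" if "n \<bullet> x = 0" "n \<bullet> z = 0" for x y z w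
    using that by (simp add: b_def om Js JJ inner_simps)
  have Q2: "Q x y (J z) w = - Q (J x) y z w" if "n \<bullet> x = 0" "n \<bullet> y = 0" "n \<bullet> z = 0" "n \<bullet> w = 0" for x y z w
    using that by (simp add: Q_def c2 b2)
  have c3: "c (J x) y z w = c x (J y) z w" if "n \<bullet> x = 0" "n \<bullet> y = 0" for x y z w
  proof -
    have "c x (J y) z w = - c (J y) x z w"
      by (simp add: c_def cross0_swap[of x] phi0_swap(2)[of n x])
    also have "\<dots> = c (J x) y z w"
      using that by (simp add: c1 cross0_swap[of x])
    finally show ?thesis ..
  qed
  have b3: "b (J x) y z w = b x (J y) z w" if "n \<bullet> x = 0" "n \<bullet> y = 0" for x y z w
    using that by (simp add: b_def om Js JJ inner_simps algebra_simps)
  have Q3: "Q (J x) y z w = Q x (J y) z w" if "n \<bullet> x = 0" "n \<bullet> y = 0" for x y z w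
    using that by (simp add: Q_def c3 b3)
  have Qs: "Q x z y w = - Q x y z w" for x y z w
    by (simp add: Q star_phi0_swap(2)[of x z] phi0_swap(2)[of n z y])
  \<comment> \<open>Exchange slots two and three, slide \<open>J\<close> from the first slot to the
    second, exchange back. Comparison with \<open>Q2\<close> gives zero.\<close>
  have "Q (J x) y z w = Q x y (J z) w"
    using Q3[OF x z, of y w] Qs[of "J x" y z w] Qs[of x y "J z" w] by simp
  then have "Q (J x) y z w = 0" if "n \<bullet> x = 0" for x
    using Q2[OF that y z w] Q3[OF that z, of y w] Qs[of "J x" y z w] Qs[of x y "J z" w] by simp
  from this[of "J x"] have "Q (- x) y z w = 0"
    using JJ[OF x] by simp
  then have "Q x y z w = 0"
    using star_phi0_linear(2)[of "-1" x y z w] by (simp add: Q)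
  then show ?thesis
    by (simp add: Q)
qed

section \<open>The linear algebra of \<open>SU(3)\<close>-structures\<close>

text \<open>A complex volume form enters only through its real part \<open>psi\<close>, by two
  properties: \<open>J\<close> slides between slots, and one contracted index gives
  \<open>contraction\<close>. As an operator on skew forms b, the right-hand side is four times the
  projection to those with b(J _, J _) = - b.\<close>

locale su3 =
  fixes h :: "real ^ 6 \<Rightarrow> real ^ 6 \<Rightarrow> real" and J :: "real ^ 6 \<Rightarrow> real ^ 6"
    and psi :: "real ^ 6 \<Rightarrow> real ^ 6 \<Rightarrow> real ^ 6 \<Rightarrow> real" and e :: "6 \<Rightarrow> real ^ 6"
  assumes h: "inner_form h" and e: "orthonormal h e"
    and J: "linear J" and JJ [simp]: "J (J x) = - x" and hJ: "h (J x) y = - h x (J y)"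
    and psi: "trilinear psi" "alternating3 psi" and psiJ: "psi (J x) y z = psi x (J y) z"
    and contraction: "(\<Sum>k\<in>UNIV. psi x y (e k) * psi z w (e k)) = h x z * h y w - h x w * h y z
      - h x (J z) * h y (J w) + h x (J w) * h y (J z)"
begin

lemma h_sym: "h x y = h y x"
  by (rule inner_form_sym [OF h])

lemma linear_h: "linear (h x)" "linear (\<lambda>x. h x y)"
  using inner_form_linear [OF h] .

lemma h_simps [simp]:
  "h (x + x') y = h x y + h x' y" "h x (y + y') = h x y + h x y'"
  "h (x - x') y = h x y - h x' y" "h x (y - y') = h x y - h x y'"
  "h (c *\<^sub>R x) y = c * h x y" "h x (c *\<^sub>R y) = c * h x y"
  "h (- x) y = - h x y" "h x (- y) = - h x y" "h 0 y = 0" "h x 0 = 0"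
  by (simp_all add: linear_h [THEN linear_add] linear_h [THEN linear_diff]
      linear_h [THEN linear_scale] linear_h [THEN linear_neg] linear_h [THEN linear_0])

lemma J_simps [simp]:
  "J (x + y) = J x + J y" "J (x - y) = J x - J y" "J (c *\<^sub>R x) = c *\<^sub>R J x" "J (- x) = - J x" "J 0 = 0"
  using J by (simp_all add: linear_add linear_diff linear_scale linear_neg linear_0)

lemma hJJ [simp]: "h (J x) (J y) = h x y"
  by (simp add: hJ)

lemma hJ_self [simp]: "h x (J x) = 0" "h (J x) x = 0"
  using hJ [of x x] h_sym [of x "J x"] by simp_all

lemma linear_psi:
  "linear (\<lambda>x. psi x y z)" "linear (\<lambda>y. psi x y z)" "linear (\<lambda>z. psi x y z)"
  using psi(1) by (simp_all add: trilinear_def)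

lemma bilinear_psi: "bilinear (psi x)"
  using linear_psi by (simp add: bilinear_def)

lemma psi_simps [simp]:
  "psi (x + x') y z = psi x y z + psi x' y z" "psi x (y + y') z = psi x y z + psi x y' z"
  "psi x y (z + z') = psi x y z + psi x y z'"
  "psi (x - x') y z = psi x y z - psi x' y z" "psi x (y - y') z = psi x y z - psi x y' z"
  "psi x y (z - z') = psi x y z - psi x y z'"
  "psi (c *\<^sub>R x) y z = c * psi x y z" "psi x (c *\<^sub>R y) z = c * psi x y z"
  "psi x y (c *\<^sub>R z) = c * psi x y z"
  "psi (- x) y z = - psi x y z" "psi x (- y) z = - psi x y z" "psi x y (- z) = - psi x y z"
  "psi 0 y z = 0" "psi x 0 z = 0" "psi x y 0 = 0"
  by (simp_all add: linear_psi [THEN linear_add] linear_psi [THEN linear_diff]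
      linear_psi [THEN linear_scale] linear_psi [THEN linear_neg] linear_psi [THEN linear_0])

lemma psi_swap: "psi y x z = - psi x y z" "psi x z y = - psi x y z"
  using psi(2) unfolding alternating3_def by (metis minus_minus)+

lemma psi_cyc: "psi y z x = psi x y z"
  by (metis psi_swap minus_minus)

lemma psiJ2: "psi x y (J z) = psi (J x) y z" "psi x (J y) z = psi (J x) y z"
  by (metis psiJ psi_cyc)+

lemma h_frame_sum: "linear f \<Longrightarrow> (\<Sum>i\<in>UNIV. h (e i) x * f (e i)) = f x"
  using frame_expand [OF h e, of f x] by simp

lemma h_frame_sum2:
  assumes "bilinear b"
  shows "(\<Sum>j\<in>UNIV. \<Sum>k\<in>UNIV. h (e j) y * h (e k) z * b (e j) (e k)) = b y z"
proof -
  have l: "linear (b x)" "linear (\<lambda>x. b x y)" for x y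
    using assms by (simp_all add: bilinear_def)
  show ?thesis
    by (simp add: h_frame_sum [OF l(1)] h_frame_sum [OF l(2)] mult.assoc flip: sum_distrib_left)
qed

lemma h_frame_self [simp]: "h (e i) (e i) = 1"
  using e by (simp add: orthonormal_def)

lemma parseval: "(\<Sum>i\<in>UNIV. h x (e i) * h (e i) y) = h x y"
  using frame_parseval [OF h e, of x y] by (simp add: h_sym)

lemma contraction2: "(\<Sum>j\<in>UNIV. \<Sum>k\<in>UNIV. psi x (e j) (e k) * psi z (e j) (e k)) = 4 * h x z"
proof -
  have *: "h x (J (e j)) = - h (J x) (e j)" for j
    by (simp add: hJ)
  have "(\<Sum>j\<in>UNIV. h x (J (e j)) * h (e j) (J z)) = - h x z"
    using parseval [of "J x" "J z"] by (simp add: * sum_negf)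
  then show ?thesis
    by (simp add: contraction sum.distrib sum_subtractf parseval)
qed

lemma psi_inj:
  assumes "\<And>y z. psi v y z = psi w y z"
  shows "v = w"
proof (rule inner_form_eqI [OF h])
  fix z
  show "h v z = h w z"
    using contraction2 [of v z] contraction2 [of w z] assms by simp
qed

text \<open>\<open>T\<close> is obtained by contracting \<open>b\<close> with \<open>psi\<close>.
  Contracting once more applies the projection in \<open>contraction\<close>, which acts on
  \<open>b\<close> as the factor 4; hence 1/4 in the witness.\<close>

lemma two_form_rep:
  assumes b: "bilinear b" "\<And>y z. b y z = - b z y" "\<And>y z. b (J y) (J z) = - b y z"
  obtains T where "\<And>y z. b y z = psi T y z"
proof
  fix y z
  define c where "c m = (\<Sum>j\<in>UNIV. \<Sum>k\<in>UNIV. psi (e m) (e j) (e k) * b (e j) (e k))" for m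
  have "psi (\<Sum>m\<in>UNIV. c m *\<^sub>R e m) y z = (\<Sum>m\<in>UNIV. c m * psi (e m) y z)"
    by (simp add: linear_sum [OF linear_psi(1)])
  also have "\<dots> = (\<Sum>m\<in>UNIV. \<Sum>j\<in>UNIV. \<Sum>k\<in>UNIV. b (e j) (e k) * (psi y z (e m) * psi (e j) (e k) (e m)))"
    by (simp add: c_def sum_distrib_right sum_distrib_left psi_cyc mult_ac)
  also have "\<dots> = (\<Sum>j\<in>UNIV. \<Sum>k\<in>UNIV. b (e j) (e k) * (\<Sum>m\<in>UNIV. psi y z (e m) * psi (e j) (e k) (e m)))"
    by (subst sum.swap, rule sum.cong [OF refl], subst sum.swap) (simp add: sum_distrib_left)
  also have "\<dots> = (\<Sum>j\<in>UNIV. \<Sum>k\<in>UNIV. h (e j) y * h (e k) z * b (e j) (e k)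
      - h (e j) z * h (e k) y * b (e j) (e k) - h (e j) (J y) * h (e k) (J z) * b (e j) (e k)
      + h (e j) (J z) * h (e k) (J y) * b (e j) (e k))"
    unfolding contraction
    by (intro sum.cong refl) (simp add: hJ [of y] hJ [of z] h_sym [of _ y] h_sym [of _ z] h_sym [of _ "J y"] h_sym [of _ "J z"] algebra_simps)
  also have "\<dots> = b y z - b z y - b (J y) (J z) + b (J z) (J y)"
    by (simp add: sum.distrib sum_subtractf h_frame_sum2 [OF b(1)])
  also have "\<dots> = 4 * b y z"
    using b(2) [of z y] b(3) [of z y] by (simp add: b(3))
  finally show "b y z = psi ((1 / 4) *\<^sub>R (\<Sum>m\<in>UNIV. c m *\<^sub>R e m)) y z"
    by simp
qed

section \<open>Gray-Hervella tensors as endomorphisms; totally skew and cyclic ones\<close>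

definition alpha :: "(real ^ 6 \<Rightarrow> real ^ 6) \<Rightarrow> real ^ 6 \<Rightarrow> real ^ 6 \<Rightarrow> real ^ 6 \<Rightarrow> real" where
  "alpha R x y z = psi (R x) y z"

definition tr :: "(real ^ 6 \<Rightarrow> real ^ 6) \<Rightarrow> real" where
  "tr R = (\<Sum>i\<in>UNIV. h (R (e i)) (e i))"

lemma gray_hervella_alpha:
  assumes "linear R"
  shows "gray_hervella J (alpha R)"
proof -
  have "linear (\<lambda>x. psi (R x) y z)" for y z
    using linear_compose [OF assms linear_psi(1)] by (simp add: o_def)
  moreover have "psi v y z = - psi v z y" for v y z
    by (rule psi_swap)
  moreover have "psi v y z = - psi v (J y) (J z)" for v y z
    by (simp add: psiJ2)
  ultimately show ?thesis
    using linear_psi unfolding gray_hervella_def trilinear_def alpha_def by blast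
qed

lemma gray_hervella_rep:
  assumes "gray_hervella J a"
  obtains R where "linear R" "a = alpha R"
proof -
  have l: "linear (\<lambda>x. a x y z)" "linear (\<lambda>y. a x y z)" "linear (\<lambda>z. a x y z)" for x y z
    using assms unfolding gray_hervella_def trilinear_def by blast+
  have "\<exists>T. \<forall>y z. a x y z = psi T y z" for x
  proof -
    have "bilinear (a x)"
      using l by (simp add: bilinear_def)
    moreover have "a x y z = - a x z y" for y z
      using assms unfolding gray_hervella_def by blast
    moreover have "a x (J y) (J z) = - a x y z" for y z
      using assms unfolding gray_hervella_def by (metis minus_minus)
    ultimately show ?thesis
      using two_form_rep by blast
  qed
  then obtain R where R: "\<And>x y z. a x y z = psi (R x) y z"
    by metis
  have "linear R"
  proof
    show "R (x + y) = R x + R y" for x y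
      by (rule psi_inj) (simp add: linear_add [OF l(1)] flip: R)
    show "R (c *\<^sub>R x) = c *\<^sub>R R x" for c x
      by (rule psi_inj) (simp add: linear_scale [OF l(1)] flip: R)
  qed
  moreover have "a = alpha R"
    by (simp add: fun_eq_iff alpha_def R)
  ultimately show ?thesis by (rule that)
qed

text \<open>The factor 1/2 of \<open>r_map\<close>, the 1/2! of the form inner product and the 4 of
  \<open>contraction2\<close> cancel, so \<open>r_map\<close> recovers the endomorphism
  exactly.\<close>

lemma r_map_alpha: "r_map h psi (alpha R) x y = h (R x) y"
proof -
  have "bilinear (alpha R x)"
    using linear_psi by (simp add: bilinear_def alpha_def)
  then show ?thesis
    by (simp add: r_map_def form_inner2_frame [OF h e _ bilinear_psi]) (simp add: alpha_def contraction2)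
qed

text \<open>Skewness moves \<open>x\<close> into a slot where \<open>J\<close> can slide, so
  \<open>R\<close> commutes with \<open>J\<close>. Contracting with \<open>psi w\<close> over the
  two other slots then gives 6 R = c + d J, where c is the trace of \<open>R\<close> and d its
  pairing with \<open>J\<close>. So the totally skew tensors form a plane.\<close>

lemma alternating_alpha:
  assumes "linear R" "alternating3 (alpha R)"
  obtains l m where "\<And>x. R x = l *\<^sub>R x + m *\<^sub>R J x"
proof -
  have alt: "psi (R x) y z = - psi (R y) x z" for x y z
    using assms(2) unfolding alternating3_def alpha_def by blast
  have comm: "R (J x) = J (R x)" for x
  proof (rule psi_inj)
    fix y z
    have "psi (R (J x)) y z = - psi (R y) (J x) z"
      by (rule alt)
    also have "\<dots> = - psi (R y) x (J z)"
      by (simp add: psiJ2)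
    also have "\<dots> = psi (J (R x)) y z"
      using alt [of x y "J z"] by (simp add: psiJ2)
    finally show "psi (R (J x)) y z = psi (J (R x)) y z" .
  qed
  define c where "c = (\<Sum>j\<in>UNIV. h (R (e j)) (e j))"
  define d where "d = (\<Sum>j\<in>UNIV. h (R (e j)) (J (e j)))"
  have l: "linear (\<lambda>y. h (R y) w)" for w
    using linear_compose [OF assms(1) linear_h(2)] by (simp add: o_def)
  have "4 * h (R x) w = - h (R x) w + c * h x w - h (R x) w + d * h (J x) w" for x w
  proof -
    have "4 * h (R x) w = (\<Sum>j\<in>UNIV. \<Sum>k\<in>UNIV. psi (R x) (e j) (e k) * psi w (e j) (e k))"
      by (simp add: contraction2)
    also have "\<dots> = - (\<Sum>j\<in>UNIV. h (R (e j)) w * h x (e j) - h (R (e j)) (e j) * h x w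
         - h (R (e j)) (J w) * h x (J (e j)) + h (R (e j)) (J (e j)) * h x (J w))"
      unfolding contraction [symmetric] sum_negf [symmetric] alt [of x] by simp
    also have "\<dots> = - h (R x) w + c * h x w + (\<Sum>j\<in>UNIV. h (R (e j)) (J w) * h x (J (e j))) - d * h x (J w)"
      using h_frame_sum [OF l, of x w]
      by (simp add: sum.distrib sum_subtractf c_def d_def sum_distrib_left h_sym [of x "e _"] mult.commute)
    also have "(\<Sum>j\<in>UNIV. h (R (e j)) (J w) * h x (J (e j))) = - h (R (J x)) (J w)"
    proof -
      have "h x (J (e j)) = - h (e j) (J x)" for j
        by (metis hJ h_sym)
      then show ?thesis
        using h_frame_sum [OF l, of "J x" "J w"] by (simp add: sum_negf mult.commute)
    qed
    finally show ?thesis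
      by (simp add: comm hJ)
  qed
  then have "h (R x) w = h ((c / 6) *\<^sub>R x + (d / 6) *\<^sub>R J x) w" for x w
    by (simp add: field_simps)
  then show ?thesis
    by (intro that inner_form_eqI [OF h])
qed

lemma tr_J:
  assumes "linear R"
  shows "tr R = (\<Sum>i\<in>UNIV. h (R (J (e i))) (J (e i)))"
proof -
  have "orthonormal h (\<lambda>i. J (e i))"
    using e by (simp add: orthonormal_def)
  moreover have "bilinear (\<lambda>x y. h (R x) y)"
    using linear_h linear_compose [OF assms linear_h(2)] by (simp add: bilinear_def o_def)
  ultimately show ?thesis
    unfolding tr_def using frame_sum [OF h e] by blast
qed

lemma tr_anticommute:
  assumes "linear R" "\<And>x. R (J x) = - J (R x)"
  shows "tr R = 0"
  using tr_J [OF assms(1)] by (simp add: assms(2) sum_negf tr_def)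

text \<open>As \<open>psi\<close> is cyclic, the three terms contribute equally, 4 times the trace
  each.\<close>

lemma alpha_cyclic_contraction:
  "(\<Sum>i\<in>UNIV. \<Sum>j\<in>UNIV. \<Sum>k\<in>UNIV. (alpha R (e i) (e j) (e k) + alpha R (e j) (e k) (e i)
      + alpha R (e k) (e i) (e j)) * psi (e i) (e j) (e k)) = 12 * tr R"
proof -
  define f where "f i j k = alpha R (e i) (e j) (e k) * psi (e i) (e j) (e k)" for i j k
  have f: "(\<Sum>i\<in>UNIV. \<Sum>j\<in>UNIV. \<Sum>k\<in>UNIV. f i j k) = 4 * tr R"
    by (simp add: f_def alpha_def contraction2 tr_def sum_distrib_left)
  have f1: "(\<Sum>i\<in>UNIV. \<Sum>j\<in>UNIV. \<Sum>k\<in>UNIV. f j k i) = (\<Sum>i\<in>UNIV. \<Sum>j\<in>UNIV. \<Sum>k\<in>UNIV. f i j k)"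
    by (subst sum.swap, rule sum.cong [OF refl], subst sum.swap) simp
  have f2: "(\<Sum>i\<in>UNIV. \<Sum>j\<in>UNIV. \<Sum>k\<in>UNIV. f k i j) = (\<Sum>i\<in>UNIV. \<Sum>j\<in>UNIV. \<Sum>k\<in>UNIV. f i j k)"
    by (subst (2) sum.swap, subst sum.swap) simp
  have "(alpha R (e i) (e j) (e k) + alpha R (e j) (e k) (e i)
      + alpha R (e k) (e i) (e j)) * psi (e i) (e j) (e k) = f i j k + f j k i + f k i j" for i j k
    by (simp add: f_def psi_cyc [of "e i" "e j" "e k"] psi_cyc [of "e k" "e i" "e j", symmetric] algebra_simps)
  then have "?thesis \<longleftrightarrow> (\<Sum>i\<in>UNIV. \<Sum>j\<in>UNIV. \<Sum>k\<in>UNIV. f i j k)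
      + (\<Sum>i\<in>UNIV. \<Sum>j\<in>UNIV. \<Sum>k\<in>UNIV. f j k i) + (\<Sum>i\<in>UNIV. \<Sum>j\<in>UNIV. \<Sum>k\<in>UNIV. f k i j) = 12 * tr R"
    by (simp add: sum.distrib)
  then show ?thesis
    using f f1 f2 by linarith
qed

lemma tr_identity [simp]: "tr (\<lambda>x. l *\<^sub>R x + m *\<^sub>R J x) = 6 * l" "tr (\<lambda>x. l *\<^sub>R x) = 6 * l"
  by (simp_all add: tr_def)

lemma tr_cong: "(\<And>x. R x = R' x) \<Longrightarrow> tr R = tr R'"
  by (simp add: tr_def)

text \<open>Putting \<open>J x\<close> for \<open>x\<close> in the cyclic identity shows that the
  commutator \<open>D\<close> of \<open>R\<close> and \<open>J\<close> yields a totally skew tensor.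
  So \<open>D\<close> is a combination of the identity and \<open>J\<close> and commutes with
  \<open>J\<close>; but a commutator with \<open>J\<close> anticommutes with it, hence
  \<open>D = 0\<close>. The traces follow by contracting with \<open>psi\<close>.\<close>

lemma cyclic_alpha:
  assumes R: "linear R" and cyc: "\<And>x y z. alpha R x y z + alpha R y z x + alpha R z x y = 0"
  shows "R (J x) = J (R x)" "tr R = 0" "tr (\<lambda>x. J (R x)) = 0"
proof -
  have R_simps: "R (- x) = - R x" "R (x + y) = R x + R y" "R (c *\<^sub>R x) = c *\<^sub>R R x" for x y c
    by (simp_all add: R linear_neg linear_add linear_scale)
  define D where "D x = R (J x) - J (R x)" for x
  define c where "c x y z = psi (J (R x)) y z + psi (J (R y)) z x + psi (J (R z)) x y" for x y z
  have c: "alpha D x y z = - c x y z" for x y z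
    using cyc [of "J x" y z] by (simp add: alpha_def D_def c_def psiJ2)
  have "linear D"
    by (rule linearI) (simp_all add: D_def R_simps algebra_simps)
  moreover have "alternating3 (alpha D)"
    unfolding alternating3_def c
  proof (intro allI conjI)
    fix x y z
    show "- c x y z = - (- c y x z)" "- c x y z = - (- c x z y)"
      using psi_swap(2) [of "J (R x)" y z] psi_swap(2) [of "J (R y)" z x] psi_swap(2) [of "J (R z)" x y]
      by (simp_all add: c_def)
  qed
  ultimately obtain l m where lm: "\<And>x. D x = l *\<^sub>R x + m *\<^sub>R J x"
    using alternating_alpha by blast
  have D0: "D x = 0" for x
  proof -
    have "D (J x) = J (D x)"
      by (simp add: lm)
    moreover have "D (J x) = - J (D x)"
      by (simp add: D_def R_simps)
    ultimately have "J (D x) + J (D x) = 0"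
      by simp
    then have "J (D x) = 0"
      by (simp flip: scaleR_2)
    then have "J (J (D x)) = 0"
      by simp
    then show ?thesis
      by (simp del: JJ add: JJ)
  qed
  then show "R (J x) = J (R x)" for x
    by (simp add: D_def)
  show "tr R = 0"
    using alpha_cyclic_contraction [of R] by (simp add: cyc)
  have "c x y z = 0" for x y z
    using c [of x y z] by (simp add: alpha_def D0)
  then show "tr (\<lambda>x. J (R x)) = 0"
    using alpha_cyclic_contraction [of "\<lambda>x. J (R x)"] by (simp add: c_def alpha_def)
qed

text \<open>The cyclic sum is itself a Gray-Hervella tensor, and totally skew, so it comes from some
  \<open>l *\<^sub>R x + m *\<^sub>R J x\<close>. The two traces of \<open>R\<close> are multiples
  of \<open>l\<close> and \<open>m\<close>.\<close>

lemma alpha_cyclicI: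
  assumes R: "linear R" and comm: "\<And>x. R (J x) = J (R x)" and tr: "tr R = 0" "tr (\<lambda>x. J (R x)) = 0"
  shows "alpha R x y z + alpha R y z x + alpha R z x y = 0"
proof -
  define c where "c x y z = alpha R x y z + alpha R y z x + alpha R z x y" for x y z
  have l: "linear (alpha R x y)" "linear (\<lambda>y. alpha R x y z)" "linear (\<lambda>x. alpha R x y z)" for x y z
    using gray_hervella_alpha [OF R] unfolding gray_hervella_def trilinear_def by blast+
  have "trilinear c"
    unfolding trilinear_def c_def by (intro conjI allI linear_compose_add l)
  moreover have c_swap: "c x y z = - c x z y" for x y z
    using psi_swap(2) [of "R x" y z] psi_swap(2) [of "R y" x z] psi_swap(2) [of "R z" x y]
    by (simp add: c_def alpha_def)
  moreover have "c x y z = - c x (J y) (J z)" for x y z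
    by (simp add: c_def alpha_def comm psiJ2)
  ultimately have "gray_hervella J c"
    unfolding gray_hervella_def by blast
  then obtain Q where Q: "linear Q" "c = alpha Q"
    using gray_hervella_rep by blast
  have c_cyc: "c y z x = c x y z" for x y z
    by (simp add: c_def)
  have "alternating3 c"
    unfolding alternating3_def
  proof (intro allI conjI)
    fix x y z
    show "c x y z = - c x z y"
      by (rule c_swap)
    show "c x y z = - c y x z"
      using c_swap [of y x z] c_cyc [of x y z] c_cyc [of y z x] c_cyc [of y x z] c_cyc [of z y x] by simp
  qed
  then obtain l m where lm: "\<And>x. Q x = l *\<^sub>R x + m *\<^sub>R J x"
    using alternating_alpha Q by blast
  have "12 * tr Q = 3 * (\<Sum>i\<in>UNIV. \<Sum>j\<in>UNIV. \<Sum>k\<in>UNIV. c (e i) (e j) (e k) * psi (e i) (e j) (e k))"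
    unfolding alpha_cyclic_contraction [symmetric] Q(2) [symmetric]
    by (simp add: sum_distrib_left c_cyc [of "e i" "e j" "e k" for i j k]
        c_cyc [of "e k" "e i" "e j" for i j k, symmetric] mult.assoc)
  also have "\<dots> = 0"
    unfolding c_def alpha_cyclic_contraction tr by simp
  finally have l: "l = 0"
    using tr_identity(1) [of l m] tr_cong [OF lm] by simp
  have cJ: "alpha (\<lambda>x. J (Q x)) x y z = psi (J (R x)) y z + psi (J (R y)) z x + psi (J (R z)) x y" for x y z
    using fun_cong [OF fun_cong [OF fun_cong [OF Q(2), of x], of "J y"], of z]
    by (simp add: alpha_def c_def psiJ2 comm)
  have "12 * tr (\<lambda>x. J (Q x)) = 3 * (\<Sum>i\<in>UNIV. \<Sum>j\<in>UNIV. \<Sum>k\<in>UNIV. (psi (J (R (e i))) (e j) (e k) 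
      + psi (J (R (e j))) (e k) (e i) + psi (J (R (e k))) (e i) (e j)) * psi (e i) (e j) (e k))"
    unfolding alpha_cyclic_contraction [symmetric] cJ
    unfolding sum_distrib_left
  proof (intro sum.cong refl)
    fix i j k
    show "(psi (J (R (e i))) (e j) (e k) + psi (J (R (e j))) (e k) (e i) + psi (J (R (e k))) (e i) (e j)
        + (psi (J (R (e j))) (e k) (e i) + psi (J (R (e k))) (e i) (e j) + psi (J (R (e i))) (e j) (e k))
        + (psi (J (R (e k))) (e i) (e j) + psi (J (R (e i))) (e j) (e k) + psi (J (R (e j))) (e k) (e i)))
        * psi (e i) (e j) (e k) = 3 * ((psi (J (R (e i))) (e j) (e k) + psi (J (R (e j))) (e k) (e i)
        + psi (J (R (e k))) (e i) (e j)) * psi (e i) (e j) (e k))"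
      by (simp only: algebra_simps)
  qed
  also have "\<dots> = 0"
    unfolding alpha_cyclic_contraction [of "\<lambda>x. J (R x)", unfolded alpha_def] tr by simp
  finally have "m = 0"
    by (simp add: lm l tr_def)
  then have "c x y z = 0"
    using Q(2) l lm by (simp add: alpha_def)
  then show ?thesis
    by (simp add: c_def)
qed

section \<open>The divergence and the classes \<open>W3\<close> and \<open>W4\<close>\<close>

definition div_alpha :: "(real ^ 6 \<Rightarrow> real ^ 6) \<Rightarrow> real ^ 6 \<Rightarrow> real" where
  "div_alpha R z = (\<Sum>i\<in>UNIV. alpha R (e i) (e i) z)"

text \<open>The right-hand side is four times the bilinear form of the part of \<open>R\<close> that
  is skew and anticommutes with \<open>J\<close>. So the divergence determines the
  \<open>W4\<close>-component.\<close>

lemma div_alpha_contraction: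
  assumes R: "linear R"
  shows "(\<Sum>k\<in>UNIV. div_alpha R (e k) * psi u w (e k))
    = h (R w) u - h (R u) w - h (R (J w)) (J u) + h (R (J u)) (J w)"
proof -
  have l: "linear (\<lambda>x. h (R x) v)" for v
    using linear_compose [OF R linear_h(2)] by (simp add: o_def)
  have "(\<Sum>k\<in>UNIV. div_alpha R (e k) * psi u w (e k))
      = (\<Sum>i\<in>UNIV. \<Sum>k\<in>UNIV. psi (R (e i)) (e i) (e k) * psi u w (e k))"
    unfolding div_alpha_def alpha_def sum_distrib_right by (rule sum.swap)
  also have "\<dots> = (\<Sum>i\<in>UNIV. h (e i) w * h (R (e i)) u - h (e i) u * h (R (e i)) w
      - h (e i) (J w) * h (R (e i)) (J u) + h (e i) (J u) * h (R (e i)) (J w))"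
    unfolding contraction by (simp add: h_sym mult.commute)
  also have "\<dots> = h (R w) u - h (R u) w - h (R (J w)) (J u) + h (R (J u)) (J w)"
    by (simp add: sum.distrib sum_subtractf h_frame_sum [OF l])
  finally show ?thesis .
qed

lemma div_alpha_symmetric:
  assumes R: "linear R" and sym: "\<And>x y. h (R x) y = h (R y) x"
  shows "div_alpha R z = 0"
proof -
  have *: "psi (R x) y z = (\<Sum>j\<in>UNIV. h (e j) (R x) * psi (e j) y z)" for x y
    using h_frame_sum [OF linear_psi(1)] by simp
  have "div_alpha R z = (\<Sum>i\<in>UNIV. \<Sum>j\<in>UNIV. h (e j) (R (e i)) * psi (e j) (e i) z)"
    by (simp add: div_alpha_def alpha_def *)
  also have "\<dots> = (\<Sum>j\<in>UNIV. \<Sum>i\<in>UNIV. h (e i) (R (e j)) * - psi (e i) (e j) z)"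
  proof (subst sum.swap, intro sum.cong refl)
    fix i j
    show "h (e j) (R (e i)) * psi (e j) (e i) z = h (e i) (R (e j)) * - psi (e i) (e j) z"
      using sym [of "e i" "e j"] h_sym [of "e i" "R (e j)"] h_sym [of "e j" "R (e i)"]
        psi_swap(1) [of "e i" "e j" z] by simp
  qed
  also have "\<dots> = - div_alpha R z"
    by (simp add: div_alpha_def alpha_def * sum_negf)
  finally show ?thesis by simp
qed

text \<open>Both directions exchange \<open>t\<close> and \<open>R\<close> through the vector
  \<open>T\<close> dual to \<open>t\<close>: contracting the \<open>W4\<close> formula with
  \<open>psi\<close> gives \<open>h (R x) w = psi w x T\<close>; conversely a skew anticommuting
  \<open>R\<close> is a two-form to which \<open>two_form_rep\<close> applies, and
  \<open>contraction\<close> turns \<open>psi (R x)\<close> into the \<open>W4\<close>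
  formula.\<close>

lemma W4_alpha_iff:
  assumes R: "linear R"
  shows "(\<exists>t. linear t \<and> (\<forall>x y z. alpha R x y z =
           h x y * t z - h x z * t y - h x (J y) * t (J z) + h x (J z) * t (J y))) \<longleftrightarrow>
    (\<forall>x. R (J x) = - J (R x)) \<and> (\<forall>x y. h (R x) y = - h (R y) x)"
  (is "?L \<longleftrightarrow> ?A \<and> ?S")
proof
  assume ?L
  then obtain t where t: "linear t" and a: "\<And>x y z. alpha R x y z =
           h x y * t z - h x z * t y - h x (J y) * t (J z) + h x (J z) * t (J y)"
    by blast
  obtain T where T: "\<And>z. h T z = t z"
    using frame_riesz [OF h e t] by blast
  have hJ': "h x (J y) = - h y (J x)" for x y
    by (metis hJ h_sym)
  have "h (R x) w = psi w x T" for x w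
  proof -
    have "4 * h (R x) w = (\<Sum>j\<in>UNIV. \<Sum>k\<in>UNIV. alpha R x (e j) (e k) * psi w (e j) (e k))"
      by (simp add: alpha_def contraction2)
    also have "\<dots> = (\<Sum>j\<in>UNIV. \<Sum>k\<in>UNIV. h (e j) x * h (e k) T * psi w (e j) (e k)
        - h (e j) T * h (e k) x * psi w (e j) (e k)
        - h (e j) (J x) * h (e k) (J T) * psi w (e j) (e k)
        + h (e j) (J T) * h (e k) (J x) * psi w (e j) (e k))"
      by (simp add: a h_sym [of x "e _"] h_sym [of T "e _"] hJ' [of x "e _"] hJ' [of T "e _"]
          algebra_simps flip: T)
    also have "\<dots> = psi w x T - psi w T x - psi w (J x) (J T) + psi w (J T) (J x)"
      by (simp add: sum.distrib sum_subtractf h_frame_sum2 [OF bilinear_psi])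
    also have "\<dots> = 4 * psi w x T"
      by (simp add: psiJ2 psi_swap(2) [of w T x])
    finally show ?thesis by simp
  qed
  note R_psi = this
  show "?A \<and> ?S"
  proof (intro conjI allI)
    show "R (J x) = - J (R x)" for x
      by (rule inner_form_eqI [OF h]) (simp add: R_psi hJ psiJ2)
    show "h (R x) y = - h (R y) x" for x y
      by (simp add: R_psi psi_swap(1) [of x y])
  qed
next
  assume "?A \<and> ?S"
  then have A: "\<And>x. R (J x) = - J (R x)" and S: "\<And>x y. h (R x) y = - h (R y) x"
    by blast+
  have b: "bilinear (\<lambda>w x. h (R x) w)"
    using linear_h linear_compose [OF R linear_h(2)] by (simp add: bilinear_def o_def)
  obtain T where T: "\<And>w x. h (R x) w = psi T w x"
    using two_form_rep [OF b S] A by (metis hJJ h_simps(7))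
  have "alpha R x y z = h x y * h T z - h x z * h T y - h x (J y) * h T (J z) + h x (J z) * h T (J y)" for x y z
  proof -
    have "psi (R x) y z = (\<Sum>m\<in>UNIV. h (e m) (R x) * psi (e m) y z)"
      using h_frame_sum [OF linear_psi(1)] by simp
    also have "\<dots> = (\<Sum>m\<in>UNIV. psi x T (e m) * psi y z (e m))"
    proof (rule sum.cong [OF refl])
      fix m
      have "h (e m) (R x) = psi T (e m) x"
        by (metis T h_sym)
      then show "h (e m) (R x) * psi (e m) y z = psi x T (e m) * psi y z (e m)"
        using psi_cyc [of T "e m" x] psi_cyc [of y z "e m"] by simp
    qed
    finally show ?thesis
      by (simp add: alpha_def contraction)
  qed
  then show ?L
    using linear_h(1) by blast
qed

section \<open>Members of the torsion modules in terms of endomorphisms\<close>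

lemma signed_r_map_alpha:
  "signed_bilinear s (r_map h psi (alpha R)) \<longleftrightarrow>
    (\<forall>x y. h (R x) y = (case s of Plus \<Rightarrow> h (R y) x | Minus \<Rightarrow> - h (R y) x))"
  unfolding signed_bilinear_def r_map_alpha by (cases s) auto

lemma some_frame_sum:
  fixes b :: "real ^ 6 \<Rightarrow> real ^ 6 \<Rightarrow> real"
  assumes "bilinear b"
  shows "(\<Sum>i\<in>UNIV. b (some_frame h i) (some_frame h i)) = (\<Sum>i\<in>UNIV. b (e i) (e i))"
  using frame_sum [OF h orthonormal_some_frame [OF e] e assms] .

lemma div_alpha_some_frame:
  assumes "linear R"
  shows "(\<Sum>i\<in>UNIV. alpha R (some_frame h i) (some_frame h i) z) = div_alpha R z"
proof -
  have "bilinear (\<lambda>x y. alpha R x y z)"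
    using gray_hervella_alpha [OF assms] unfolding gray_hervella_def trilinear_def bilinear_def by blast
  from some_frame_sum [OF this] show ?thesis
    by (simp add: div_alpha_def)
qed

lemma torsion_moduleE:
  assumes "a \<in> torsion_module h J psi k"
  obtains R where "linear R" "a = alpha R"
  using assms gray_hervella_rep unfolding torsion_module_def by blast

lemma W1_Plus_rep:
  assumes "a \<in> torsion_module h J psi (W1 Plus)"
  obtains l where "a = alpha (\<lambda>x. l *\<^sub>R x)"
proof -
  obtain R where R: "linear R" "a = alpha R"
    using assms by (rule torsion_moduleE)
  have a: "alternating3 (alpha R)" and "signed_bilinear Plus (r_map h psi (alpha R))"
    using assms unfolding R torsion_module_def by simp_all
  then have sym: "h (R x) y = h (R y) x" for x y
    unfolding signed_r_map_alpha torsion_sign.case by blast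
  obtain l m where lm: "\<And>x. R x = l *\<^sub>R x + m *\<^sub>R J x"
    using alternating_alpha [OF R(1) a] by blast
  have "m = 0"
    using sym [of "e i" "J (e i)" for i] by (simp add: lm hJ)
  then have "R = (\<lambda>x. l *\<^sub>R x)"
    by (simp add: lm fun_eq_iff)
  then show ?thesis
    using that R(2) by blast
qed

lemma W1_Minus_rep:
  assumes "a \<in> torsion_module h J psi (W1 Minus)"
  obtains m where "a = alpha (\<lambda>x. m *\<^sub>R J x)"
proof -
  obtain R where R: "linear R" "a = alpha R"
    using assms by (rule torsion_moduleE)
  have a: "alternating3 (alpha R)" and "signed_bilinear Minus (r_map h psi (alpha R))"
    using assms unfolding R torsion_module_def by simp_all
  then have sym: "h (R x) y = - h (R y) x" for x y
    unfolding signed_r_map_alpha torsion_sign.case by blast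
  obtain l m where lm: "\<And>x. R x = l *\<^sub>R x + m *\<^sub>R J x"
    using alternating_alpha [OF R(1) a] by blast
  have "l = 0"
    using sym [of "e i" "e i" for i] by (simp add: lm hJ)
  then have "R = (\<lambda>x. m *\<^sub>R J x)"
    by (simp add: lm fun_eq_iff)
  then show ?thesis
    using that R(2) by blast
qed

lemma W2_rep:
  assumes "a \<in> torsion_module h J psi (W2 s)"
  obtains R where "linear R" "a = alpha R" "\<And>x. R (J x) = J (R x)" "tr R = 0" "tr (\<lambda>x. J (R x)) = 0"
    "\<And>x y. h (R x) y = (case s of Plus \<Rightarrow> h (R y) x | Minus \<Rightarrow> - h (R y) x)"
proof -
  obtain R where R: "linear R" "a = alpha R"
    using assms by (rule torsion_moduleE)
  have "alpha R x y z + alpha R y z x + alpha R z x y = 0" for x y z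
    using assms unfolding R torsion_module_def by auto
  moreover have "\<And>x y. h (R x) y = (case s of Plus \<Rightarrow> h (R y) x | Minus \<Rightarrow> - h (R y) x)"
    using assms unfolding R torsion_module_def by (auto simp: signed_r_map_alpha)
  ultimately show ?thesis
    using that R cyclic_alpha [OF R(1)] by blast
qed

text \<open>Invariance under \<open>J\<close> in the first two slots is anticommutation of
  \<open>R\<close> with \<open>J\<close>. For such \<open>R\<close>, the divergence contracted with
  \<open>psi\<close> is twice the skew part of \<open>R\<close>, up to sign, so being trace-free
  means being symmetric.\<close>

lemma W3_alpha_iff:
  assumes R: "linear R"
  shows "alpha R \<in> torsion_module h J psi W3 \<longleftrightarrow>
    (\<forall>x. R (J x) = - J (R x)) \<and> (\<forall>x y. h (R x) y = h (R y) x)" (is "_ \<longleftrightarrow> ?A \<and> ?S")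
proof -
  have neg: "R (- x) = - R x" for x
    using R by (rule linear_neg)
  have A: "(\<forall>x y z. alpha R (J x) (J y) z = alpha R x y z) \<longleftrightarrow> ?A"
  proof
    assume *: "\<forall>x y z. alpha R (J x) (J y) z = alpha R x y z"
    have "J (R (J x)) = R x" for x
      by (rule psi_inj) (use * in \<open>simp add: alpha_def psiJ2\<close>)
    from this [of "J x" for x] show ?A
      by (metis JJ neg)
  next
    assume ?A
    then show "\<forall>x y z. alpha R (J x) (J y) z = alpha R x y z"
      by (simp add: alpha_def psiJ2)
  qed
  have S: "(\<forall>z. div_alpha R z = 0) \<longleftrightarrow> ?S" if ?A
  proof
    assume *: "\<forall>z. div_alpha R z = 0"
    show ?S
    proof (intro allI)
      fix w u
      show "h (R w) u = h (R u) w"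
        using div_alpha_contraction [OF R, of u w] * that by simp
    qed
  next
    assume ?S
    then show "\<forall>z. div_alpha R z = 0"
      using div_alpha_symmetric [OF R] by blast
  qed
  show ?thesis
    unfolding torsion_module_def
    using gray_hervella_alpha [OF R] A S by (auto simp: div_alpha_some_frame [OF R])
qed

lemma W3_rep:
  assumes "a \<in> torsion_module h J psi W3"
  obtains R where "linear R" "a = alpha R" "\<And>x. R (J x) = - J (R x)" "\<And>x y. h (R x) y = h (R y) x"
proof -
  obtain R where R: "linear R" "a = alpha R"
    using assms by (rule torsion_moduleE)
  then show ?thesis
    using that assms W3_alpha_iff [OF R(1)] by blast
qed

lemma W4_rep:
  assumes "a \<in> torsion_module h J psi W4"
  obtains R where "linear R" "a = alpha R" "\<And>x. R (J x) = - J (R x)" "\<And>x y. h (R x) y = - h (R y) x"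
proof -
  obtain R where R: "linear R" "a = alpha R"
    using assms by (rule torsion_moduleE)
  then show ?thesis
    using that assms W4_alpha_iff [OF R(1)] unfolding torsion_module_def torsion_class.case mem_Collect_eq
    by blast
qed

lemma W1_alpha: "alpha (\<lambda>x. l *\<^sub>R x) \<in> torsion_module h J psi (W1 Plus)"
proof -
  have "linear (\<lambda>x :: real ^ 6. l *\<^sub>R x)"
    by (rule linear_scale_self)
  then have "gray_hervella J (alpha (\<lambda>x. l *\<^sub>R x))"
    by (rule gray_hervella_alpha)
  moreover have "alternating3 (alpha (\<lambda>x. l *\<^sub>R x))"
    using psi_swap unfolding alternating3_def alpha_def by (metis mult_minus_right minus_minus psi_simps(7))
  moreover have "signed_bilinear Plus (r_map h psi (alpha (\<lambda>x. l *\<^sub>R x)))"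
    unfolding signed_r_map_alpha by (simp add: h_sym)
  ultimately show ?thesis
    by (simp add: torsion_module_def)
qed

lemma W2_alpha:
  assumes "linear R" "\<And>x. R (J x) = J (R x)" "tr R = 0" "\<And>x y. h (R x) y = h (R y) x"
  shows "alpha R \<in> torsion_module h J psi (W2 Plus)"
proof -
  \<comment> \<open>For a symmetric \<open>R\<close> commuting with \<open>J\<close> the composition
    of \<open>J\<close> and \<open>R\<close> is skew, so the second trace condition for cyclicity is
    automatic.\<close>
  have "tr (\<lambda>x. J (R x)) = - tr (\<lambda>x. J (R x))"
    unfolding tr_def sum_negf [symmetric]
  proof (intro sum.cong refl)
    fix i
    have "h (J (R (e i))) (e i) = - h (R (e i)) (J (e i))"
      by (rule hJ)
    also have "\<dots> = - h (R (J (e i))) (e i)"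
      using assms(4) by simp
    finally show "h (J (R (e i))) (e i) = - h (J (R (e i))) (e i)"
      by (simp add: assms(2))
  qed
  then have "tr (\<lambda>x. J (R x)) = 0"
    by simp
  then have "\<forall>x y z. alpha R x y z + alpha R y z x + alpha R z x y = 0"
    using alpha_cyclicI assms by blast
  moreover have "signed_bilinear Plus (r_map h psi (alpha R))"
    unfolding signed_r_map_alpha using assms(4) by simp
  ultimately show ?thesis
    using gray_hervella_alpha [OF assms(1)] by (simp add: torsion_module_def)
qed

lemma zero_torsion_module:
  assumes "k \<in> gh_classes"
  shows "(\<lambda>x y z. 0) \<in> torsion_module h J psi k"
proof -
  have "linear (\<lambda>x. 0 :: real ^ 6)" "linear (\<lambda>x :: real ^ 6. 0 :: real)"
    by (simp_all add: linear_iff)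
  then have 1: "gray_hervella J (\<lambda>x y z. 0)"
    by (simp add: gray_hervella_def trilinear_def)
  moreover have "r_map h psi (\<lambda>x y z. 0) = (\<lambda>x y. 0)"
    by (simp add: r_map_def form_inner2_def fun_eq_iff)
  moreover have "\<exists>t :: real ^ 6 \<Rightarrow> real. linear t \<and> (\<forall>x y z. (0 :: real) =
      h x y * t z - h x z * t y - h x (J y) * t (J z) + h x (J z) * t (J y))"
    using \<open>linear (\<lambda>x :: real ^ 6. 0 :: real)\<close> by (intro exI [of _ "\<lambda>x. 0"]) simp
  ultimately show ?thesis
    using assms unfolding gh_classes_def torsion_module_def
    by (auto simp: alternating3_def signed_bilinear_def split: torsion_sign.splits)
qed

end

section \<open>Types of torsion\<close>

text \<open>The part of \<open>of_type\<close> that concerns \<nabla>\<omega>, at one point and with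
  \<open>psi\<close> free, so that the conditions for \<open>psi\<close> and for
  \<open>psi (J _)\<close> can be compared.\<close>

definition has_torsion_type :: "(real ^ 6 \<Rightarrow> real ^ 6 \<Rightarrow> real) \<Rightarrow> (real ^ 6 \<Rightarrow> real ^ 6) \<Rightarrow>
    (real ^ 6 \<Rightarrow> real ^ 6 \<Rightarrow> real ^ 6 \<Rightarrow> real) \<Rightarrow>
    (real ^ 6 \<Rightarrow> real ^ 6 \<Rightarrow> real ^ 6 \<Rightarrow> real) \<Rightarrow> torsion_class set \<Rightarrow> bool" where
  "has_torsion_type G J psi \<alpha> U \<longleftrightarrow>
     (\<exists>a. (\<forall>k\<in>gh_classes. a k \<in> torsion_module G J psi k) \<and>
          (\<forall>x y z. \<alpha> x y z = (\<Sum>k\<in>gh_classes. a k x y z)) \<and>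
          (\<forall>k\<in>gh_classes - U. \<forall>x y z. a k x y z = 0))"

lemma sum_gh_classes:
  "(\<Sum>k\<in>gh_classes. f k) = f (W1 Plus) + f (W1 Minus) + f (W2 Plus) + f (W2 Minus) + f W3 + f W4"
  by (simp add: gh_classes_def add.assoc)

context su3
begin

lemma adjoint_exists:
  assumes R: "linear R"
  obtains A where "linear A" "\<And>x y. h (A x) y = h x (R y)"
proof -
  have "\<exists>w. \<forall>y. h w y = h x (R y)" for x
  proof -
    have "linear (\<lambda>y. h x (R y))"
      using linear_compose [OF R linear_h(1)] by (simp add: o_def)
    then show ?thesis
      using frame_riesz [OF h e] by blast
  qed
  then obtain A where A: "\<And>x y. h (A x) y = h x (R y)"
    by metis
  have "linear A"
    by (rule linearI; rule inner_form_eqI [OF h]) (simp_all add: A)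
  then show ?thesis
    using A by (rule that)
qed

lemma tr_add: "tr (\<lambda>x. R x + R' x) = tr R + tr R'"
  by (simp add: tr_def sum.distrib)

lemma alpha_eq_0_iff: "(\<forall>x y z. alpha R x y z = 0) \<longleftrightarrow> (\<forall>x. R x = 0)"
  using psi_inj [of "R x" 0 for x] by (auto simp: alpha_def)

text \<open>Assumption \<open>sym\<close> says that the part of \<open>R\<close> commuting with
  \<open>J\<close> is symmetric. The given components are rewritten as endomorphisms that add up to
  \<open>R\<close>; the trace, the commuting part and the symmetric anticommuting part of
  \<open>R\<close> then isolate the components of class \<open>W1 Plus\<close>,
  \<open>W2 Plus\<close> and \<open>W3\<close>.\<close>

lemma torsion_typeD:
  assumes type: "has_torsion_type h J psi (alpha R) U"
    and sym: "\<And>x y. h (R x) y + h (R (J x)) (J y) = h (R y) x + h (R (J y)) (J x)"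
  shows "W1 Plus \<in> U \<or> tr R = 0"
    and "W2 Plus \<in> U \<or> (\<forall>x y. h (R x) y + h (R (J x)) (J y) = tr R / 3 * h x y)"
    and "W3 \<in> U \<or> (\<forall>x y. h (R x) y + h (R y) x = h (R (J x)) (J y) + h (R (J y)) (J x))"
proof -
  obtain a where a: "\<forall>k\<in>gh_classes. a k \<in> torsion_module h J psi k"
    and sum: "\<And>x y z. alpha R x y z = (\<Sum>k\<in>gh_classes. a k x y z)"
    and zero: "\<And>k x y z. k \<in> gh_classes \<Longrightarrow> k \<notin> U \<Longrightarrow> a k x y z = 0"
    using type unfolding has_torsion_type_def by blast
  have mem: "a (W1 s) \<in> torsion_module h J psi (W1 s)" "a (W2 s) \<in> torsion_module h J psi (W2 s)"
    "a W3 \<in> torsion_module h J psi W3" "a W4 \<in> torsion_module h J psi W4" for s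
    using a by (cases s; simp add: gh_classes_def)+
  obtain l where l: "a (W1 Plus) = alpha (\<lambda>x. l *\<^sub>R x)"
    using W1_Plus_rep mem(1) by blast
  obtain m where m: "a (W1 Minus) = alpha (\<lambda>x. m *\<^sub>R J x)"
    using W1_Minus_rep mem(1) by blast
  obtain P where P: "a (W2 Plus) = alpha P" "\<And>x. P (J x) = J (P x)" "tr P = 0"
      "\<And>x y. h (P x) y = h (P y) x"
    using W2_rep [OF mem(2) [of Plus]] by (metis torsion_sign.case(1))
  obtain Q where Q: "a (W2 Minus) = alpha Q" "\<And>x. Q (J x) = J (Q x)" "tr Q = 0"
      "\<And>x y. h (Q x) y = - h (Q y) x"
    using W2_rep [OF mem(2) [of Minus]] by (metis torsion_sign.case(2))
  obtain S where S: "linear S" "a W3 = alpha S" "\<And>x. S (J x) = - J (S x)" "\<And>x y. h (S x) y = h (S y) x"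
    using W3_rep [OF mem(3)] by blast
  obtain T where T: "linear T" "a W4 = alpha T" "\<And>x. T (J x) = - J (T x)" "\<And>x y. h (T x) y = - h (T y) x"
    using W4_rep [OF mem(4)] by blast
  have R: "R x = l *\<^sub>R x + m *\<^sub>R J x + P x + Q x + S x + T x" for x
  proof (rule psi_inj)
    fix y z
    show "psi (R x) y z = psi (l *\<^sub>R x + m *\<^sub>R J x + P x + Q x + S x + T x) y z"
      using sum [of x y z] by (simp add: sum_gh_classes l m P(1) Q(1) S(2) T(2) alpha_def)
  qed
  have "tr (\<lambda>x. m *\<^sub>R J x) = 0"
    by (simp add: tr_def)
  then have tr: "tr R = 6 * l"
    unfolding R [abs_def] tr_add by (simp add: P Q tr_anticommute S T)
  show "W1 Plus \<in> U \<or> tr R = 0"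
  proof (cases "W1 Plus \<in> U")
    case False
    then have "\<forall>x y z. alpha (\<lambda>x. l *\<^sub>R x) x y z = 0"
      using zero [of "W1 Plus"] by (simp add: gh_classes_def l)
    then have "l *\<^sub>R e 0 = 0"
      using alpha_eq_0_iff by blast
    then have "h (l *\<^sub>R e 0) (e 0) = 0"
      by (simp only: h_simps)
    then show ?thesis
      by (simp add: tr)
  qed simp
  have C: "h (R x) y + h (R (J x)) (J y) = 2 * l * h x y + 2 * m * h (J x) y + 2 * h (P x) y + 2 * h (Q x) y" for x y
    by (simp add: R P(2) Q(2) S(3) T(3) hJ)
  \<comment> \<open>The skew commuting part of \<open>R\<close> is \<open>Q\<close> plus
    \<open>m\<close> times \<open>J\<close>. By \<open>sym\<close> this sum vanishes, and only the
    sum occurs in \<open>C\<close>.\<close>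
  have Q0: "h (Q x) y = - (m * h (J x) y)" for x y
    using sym [of x y] unfolding C using P(4) [of x y] Q(4) [of x y] h_sym [of x y] hJ [of x y] h_sym [of x "J y"]
    by simp
  show "W2 Plus \<in> U \<or> (\<forall>x y. h (R x) y + h (R (J x)) (J y) = tr R / 3 * h x y)"
  proof (cases "W2 Plus \<in> U")
    case False
    then have "\<forall>x y z. alpha P x y z = 0"
      using zero [of "W2 Plus"] by (simp add: gh_classes_def P(1))
    then have "P x = 0" for x
      using alpha_eq_0_iff by blast
    then show ?thesis
      unfolding C tr Q0 by simp
  qed simp
  show "W3 \<in> U \<or> (\<forall>x y. h (R x) y + h (R y) x = h (R (J x)) (J y) + h (R (J y)) (J x))"
  proof (cases "W3 \<in> U")
    case False
    then have "\<forall>x y z. alpha S x y z = 0"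
      using zero [of W3] by (simp add: gh_classes_def S(2))
    then have S0: "S x = 0" for x
      using alpha_eq_0_iff by blast
    have "h (R x) y + h (R y) x = h (R (J x)) (J y) + h (R (J y)) (J x)" for x y
      using T(4) [of x y] by (simp add: R P(2) Q(2) T(3) S0 hJ)
    then show ?thesis by blast
  qed simp
qed

lemma torsion_typeI:
  assumes R: "linear R"
    and sym: "\<And>x y. h (R x) y + h (R (J x)) (J y) = h (R y) x + h (R (J y)) (J x)"
    and "W1 Plus \<in> U \<or> tr R = 0"
    and "W2 Plus \<in> U \<or> (\<forall>x y. h (R x) y + h (R (J x)) (J y) = tr R / 3 * h x y)"
    and "W3 \<in> U \<or> (\<forall>x y. h (R x) y + h (R y) x = h (R (J x)) (J y) + h (R (J y)) (J x))"
    and "W4 \<in> U \<or> (\<forall>x y. h (R x) y - h (R y) x = h (R (J x)) (J y) - h (R (J y)) (J x))"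
  shows "has_torsion_type h J psi (alpha R) U"
proof -
  obtain A where A: "linear A" "\<And>x y. h (A x) y = h x (R y)"
    using adjoint_exists [OF R] by blast
  have A': "h (A x) y = h (R y) x" for x y
    by (metis A(2) h_sym)
  have lin: "linear (\<lambda>x. R (J x))" "linear (\<lambda>x. A (J x))" 
    using linear_compose [OF J R] linear_compose [OF J A(1)] by (simp_all add: o_def)
  define t where "t = tr R / 6"
  \<comment> \<open>Averaging over conjugation with \<open>J\<close> gives the commuting part
    \<open>R - J R J\<close> and the anticommuting part \<open>R + J R J\<close>, up to 1/2. From
    the first the trace is removed; the second is split by the adjoint \<open>A\<close> into its
    symmetric and skew halves \<open>S\<close> and \<open>T\<close>.\<close>
  define P where "P x = (1 / 2) *\<^sub>R (R x - J (R (J x))) - t *\<^sub>R x" for x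
  define S where "S x = (1 / 4) *\<^sub>R (R x + J (R (J x)) + A x + J (A (J x)))" for x
  define T where "T x = (1 / 4) *\<^sub>R (R x + J (R (J x)) - A x - J (A (J x)))" for x
  have neg: "R (- x) = - R x" "A (- x) = - A x" for x
    using R A(1) by (simp_all add: linear_neg)
  have P: "h (P x) y = (h (R x) y + h (R (J x)) (J y)) / 2 - t * h x y" for x y
    by (simp add: P_def hJ)
  have S: "h (S x) y = (h (R x) y + h (R y) x - h (R (J x)) (J y) - h (R (J y)) (J x)) / 4" for x y
    by (simp add: S_def hJ A')
  have T: "h (T x) y = (h (R x) y - h (R y) x - h (R (J x)) (J y) + h (R (J y)) (J x)) / 4" for x y
    by (simp add: T_def hJ A')
  have zero: "(\<forall>x y z. alpha B x y z = 0) \<longleftrightarrow> (\<forall>x y. h (B x) y = 0)" for B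
    unfolding alpha_eq_0_iff using inner_form_eqI [OF h, of _ 0] by auto
  have linear: "linear P" "linear S" "linear T"
    by (rule linearI; simp add: P_def S_def T_def linear_add [OF R] linear_add [OF A(1)]
      linear_scale [OF R] linear_scale [OF A(1)] algebra_simps)+
  have memP: "alpha P \<in> torsion_module h J psi (W2 Plus)"
  proof (rule W2_alpha [OF linear(1)])
    show "P (J x) = J (P x)" for x
      by (simp add: P_def neg algebra_simps)
    show "h (P x) y = h (P y) x" for x y
      using sym [of x y] h_sym [of x y] by (simp add: P)
    have "tr P = tr R / 2 + (\<Sum>i\<in>UNIV. h (R (J (e i))) (J (e i))) / 2 - 6 * t"
      by (simp add: tr_def P sum.distrib sum_subtractf sum_divide_distrib add_divide_distrib)
    then show "tr P = 0"
      by (simp add: t_def flip: tr_J [OF R])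
  qed
  have memS: "alpha S \<in> torsion_module h J psi W3"
    unfolding W3_alpha_iff [OF linear(2)]
    by (intro conjI allI) (simp add: S_def neg algebra_simps, simp add: S)
  have "(\<forall>x. T (J x) = - J (T x)) \<and> (\<forall>x y. h (T x) y = - h (T y) x)"
    by (intro conjI allI) (simp add: T_def neg algebra_simps, simp add: T field_simps)
  then have memT: "alpha T \<in> torsion_module h J psi W4"
    using W4_alpha_iff [OF linear(3)] gray_hervella_alpha [OF linear(3)]
    unfolding torsion_module_def torsion_class.case mem_Collect_eq by blast
  define a where "a k = (case k of W1 Plus \<Rightarrow> alpha (\<lambda>x. t *\<^sub>R x) | W2 Plus \<Rightarrow> alpha P | W3 \<Rightarrow> alpha S
     | W4 \<Rightarrow> alpha T | _ \<Rightarrow> (\<lambda>x y z. 0))" for k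
  have a: "a (W1 Plus) = alpha (\<lambda>x. t *\<^sub>R x)" "a (W2 Plus) = alpha P" "a W3 = alpha S" "a W4 = alpha T"
    "a (W1 Minus) = (\<lambda>x y z. 0)" "a (W2 Minus) = (\<lambda>x y z. 0)"
    by (simp_all add: a_def)
  have mem: "\<forall>k\<in>gh_classes. a k \<in> torsion_module h J psi k"
    using memP memS memT W1_alpha [of t] zero_torsion_module
    by (auto simp: gh_classes_def a)
  have sum: "\<forall>x y z. alpha R x y z = (\<Sum>k\<in>gh_classes. a k x y z)"
  proof (intro allI)
    fix x y z
    have "R x = t *\<^sub>R x + P x + S x + T x"
      by (rule inner_form_eqI [OF h]) (simp add: P S T field_simps)
    then have "psi (R x) y z = psi (t *\<^sub>R x + P x + S x + T x) y z"
      by simp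
    then show "alpha R x y z = (\<Sum>k\<in>gh_classes. a k x y z)"
      by (simp add: sum_gh_classes a alpha_def)
  qed
  have "\<forall>x y z. a k x y z = 0" if k: "k \<in> gh_classes - U" for k
  proof -
    consider "k = W1 Plus" "tr R = 0"
      | "k = W2 Plus" "\<forall>x y. h (R x) y + h (R (J x)) (J y) = tr R / 3 * h x y"
      | "k = W3" "\<forall>x y. h (R x) y + h (R y) x = h (R (J x)) (J y) + h (R (J y)) (J x)"
      | "k = W4" "\<forall>x y. h (R x) y - h (R y) x = h (R (J x)) (J y) - h (R (J y)) (J x)"
      | "k = W1 Minus" | "k = W2 Minus"
      using k assms(3-6) unfolding gh_classes_def by blast
    then show ?thesis
    proof cases
      case 1
      then show ?thesis by (simp add: a t_def alpha_def)
    next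
      case 2
      have "h (P x) y = 0" for x y
        using 2(2) [rule_format, of x y] by (simp add: P t_def)
      then show ?thesis unfolding 2(1) a zero by blast
    next
      case 3
      have "h (S x) y = 0" for x y
        using 3(2) [rule_format, of x y] by (simp add: S)
      then show ?thesis unfolding 3(1) a zero by blast
    next
      case 4
      have "h (T x) y = 0" for x y
        using 4(2) [rule_format, of x y] by (simp add: T)
      then show ?thesis unfolding 4(1) a zero by blast
    qed (simp_all add: a)
  qed
  then show ?thesis
    unfolding has_torsion_type_def using mem sum by blast
qed

text \<open>Provides the \<open>W4\<close> premise of \<open>torsion_typeI\<close> when the
  divergence vanishes. On the hypersurface this happens when \<open>rbar_tn\<close> is zero.\<close>

lemma W4_condition:
  assumes R: "linear R" and div: "\<And>z. div_alpha R z = 0"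
    and sym: "\<And>x y. h (R x) y + h (R (J x)) (J y) = h (R y) x + h (R (J y)) (J x)"
  shows "h (R x) y - h (R y) x = h (R (J x)) (J y) - h (R (J y)) (J x)"
  using div_alpha_contraction [OF R, of y x] div by simp

text \<open>For \<open>X = \<xi>\<^sub>x\<close> and \<open>q = R x\<close>: the intrinsic torsion acts on \<open>\<psi>\<close> through the one-form dual to \<open>R x\<close>.\<close>

lemma torsion_action:
  assumes X: "\<And>v y. h v (X y) = 1 / 2 * psi q (J v) y"
  shows "psi (X y) z w + psi y (X z) w + psi y z (X w)
    = - (h q y * h z (J w) - h q z * h y (J w) + h q w * h y (J z))"
proof -
  have *: "psi (X y) z w = 1 / 2 * (h y z * h (J q) w - h y w * h (J q) z - h y (J z) * h q w + h y (J w) * h q z)" for y z w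
  proof -
    have "psi (X y) z w = (\<Sum>k\<in>UNIV. h (e k) (X y) * psi (e k) z w)"
      using h_frame_sum [OF linear_psi(1)] by simp
    also have "\<dots> = (\<Sum>k\<in>UNIV. 1 / 2 * (psi y (J q) (e k) * psi z w (e k)))"
    proof (rule sum.cong [OF refl])
      fix k
      have "psi q (J (e k)) y = psi y (J q) (e k)"
        by (metis psiJ2(2) psi_cyc)
      then show "h (e k) (X y) * psi (e k) z w = 1 / 2 * (psi y (J q) (e k) * psi z w (e k))"
        using psi_cyc [of z w "e k"] by (simp add: X)
    qed
    also have "\<dots> = 1 / 2 * (h y z * h (J q) w - h y w * h (J q) z - h y (J z) * h q w + h y (J w) * h q z)"
      unfolding sum_distrib_left [symmetric] contraction by simp
    finally show ?thesis .
  qed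
  have hJ': "h x (J y) = - h y (J x)" for x y
    by (metis hJ h_sym)
  show ?thesis
    using * [of y z w] * [of z w y] * [of w y z] psi_cyc [of "X z" w y] psi_cyc [of y z "X w"]
    unfolding h_sym [of z y] h_sym [of w y] h_sym [of w z] hJ' [of w y] hJ' [of w z] hJ' [of z y]
    by (simp add: algebra_simps)
qed

text \<open>The form belonging to \<open>psi (J _)\<close> is \<open>h (R x) (J y)\<close>. If
  \<open>R\<close> commutes with \<open>J\<close>, inserting the skew map \<open>J\<close> turns
  symmetric forms into skew ones and conversely.\<close>

lemma signed_r_map_rotate:
  assumes R: "\<And>x. R (J x) = J (R x)" and s: "s' \<noteq> s"
  shows "signed_bilinear s' (r_map h (\<lambda>x. psi (J x)) (alpha R)) \<longleftrightarrow>
    signed_bilinear s (r_map h psi (alpha R))"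
proof -
  have r: "r_map h (\<lambda>x. psi (J x)) (alpha R) x y = h (R x) (J y)" for x y
    using r_map_alpha [of R x "J y"] by (simp add: r_map_def)
  have hJ': "h (R (J x)) y = - h (R x) (J y)" for x y
    by (simp add: R hJ)
  have "(\<forall>x y. h (R x) (J y) = - c * h (R y) (J x)) \<longleftrightarrow> (\<forall>x y. h (R x) y = c * h (R y) x)" for c
  proof (intro iffI allI)
    fix x y
    assume "\<forall>x y. h (R x) (J y) = - c * h (R y) (J x)"
    from this [rule_format, of x "J y"] show "h (R x) y = c * h (R y) x"
      by (simp add: hJ')
  next
    fix x y
    assume "\<forall>x y. h (R x) y = c * h (R y) x"
    from this [rule_format, of x "J y"] show "h (R x) (J y) = - c * h (R y) (J x)"
      by (simp add: hJ')
  qed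
  from this [of 1] this [of "- 1"] show ?thesis
    using s by (cases s; cases s'; simp add: signed_bilinear_def r r_map_alpha)
qed

end

section \<open>Exchange of the two signs\<close>

definition flip_class :: "torsion_class \<Rightarrow> torsion_class" where
  "flip_class k = (case k of W1 s \<Rightarrow> W1 (if s = Plus then Minus else Plus)
     | W2 s \<Rightarrow> W2 (if s = Plus then Minus else Plus) | _ \<Rightarrow> k)"

lemma flip_class_simps [simp]:
  "flip_class (W1 Plus) = W1 Minus" "flip_class (W1 Minus) = W1 Plus"
  "flip_class (W2 Plus) = W2 Minus" "flip_class (W2 Minus) = W2 Plus"
  "flip_class W3 = W3" "flip_class W4 = W4" "flip_class W5 = W5"
  by (simp_all add: flip_class_def)

lemma flip_class_flip_class [simp]: "flip_class (flip_class k) = k"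
  by (cases k) (metis flip_class_simps torsion_sign.exhaust)+

lemma flip_class_in [simp]: "flip_class k \<in> flip_class ` U \<longleftrightarrow> k \<in> U"
  by (metis (no_types, lifting) flip_class_flip_class image_iff)

lemma flip_class_gh [simp]: "flip_class k \<in> gh_classes \<longleftrightarrow> k \<in> gh_classes"
proof -
  have "flip_class ` gh_classes = gh_classes"
    by (auto simp: gh_classes_def)
  then show ?thesis
    using flip_class_in [of k gh_classes] by simp
qed

lemma sum_flip_class: "(\<Sum>k\<in>gh_classes. f (flip_class k)) = (\<Sum>k\<in>gh_classes. f k)"
  by (rule sum.reindex_bij_witness [of _ flip_class flip_class]) simp_all

context su3
begin

text \<open>Members of the first two classes have an endomorphism commuting with \<open>J\<close>,
  so \<open>signed_r_map_rotate\<close> applies to them. The definitions of \<open>W3\<close> and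
  \<open>W4\<close> do not contain \<open>psi\<close>.\<close>

lemma torsion_module_flip:
  assumes "k \<in> gh_classes"
  shows "torsion_module h J (\<lambda>x. psi (J x)) (flip_class k) = torsion_module h J psi k"
proof -
  have s: "(a \<in> torsion_module h J (\<lambda>x. psi (J x)) (W1 s') \<longleftrightarrow> a \<in> torsion_module h J psi (W1 s)) \<and>
      (a \<in> torsion_module h J (\<lambda>x. psi (J x)) (W2 s') \<longleftrightarrow> a \<in> torsion_module h J psi (W2 s))"
    if s: "s' \<noteq> s" for a s' s
  proof (cases "gray_hervella J a")
    case True
    then obtain R where R: "linear R" "a = alpha R"
      using gray_hervella_rep by blast
    have "R (J x) = J (R x)" if alt: "alternating3 a" for x
      using alternating_alpha [OF R(1) alt [unfolded R]] by (metis J_simps(1,3) JJ)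
    then have 1: "signed_bilinear s' (r_map h (\<lambda>x. psi (J x)) a) \<longleftrightarrow> signed_bilinear s (r_map h psi a)"
      if "alternating3 a"
      using signed_r_map_rotate [OF _ s, of R] that R(2) by blast
    have "R (J x) = J (R x)" if "\<forall>x y z. a x y z + a y z x + a z x y = 0" for x
      using cyclic_alpha(1) [OF R(1)] that [unfolded R] by blast
    then have 2: "signed_bilinear s' (r_map h (\<lambda>x. psi (J x)) a) \<longleftrightarrow> signed_bilinear s (r_map h psi a)"
      if "\<forall>x y z. a x y z + a y z x + a z x y = 0"
      using signed_r_map_rotate [OF _ s, of R] that R(2) by blast
    show "(a \<in> torsion_module h J (\<lambda>x. psi (J x)) (W1 s') \<longleftrightarrow> a \<in> torsion_module h J psi (W1 s)) \<and>
      (a \<in> torsion_module h J (\<lambda>x. psi (J x)) (W2 s') \<longleftrightarrow> a \<in> torsion_module h J psi (W2 s))"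
      using 1 2 unfolding torsion_module_def torsion_class.case mem_Collect_eq by blast
  qed (simp_all add: torsion_module_def)
  have "torsion_module h J (\<lambda>x. psi (J x)) W3 = torsion_module h J psi W3"
    "torsion_module h J (\<lambda>x. psi (J x)) W4 = torsion_module h J psi W4"
    by (simp_all add: torsion_module_def)
  then show ?thesis
    using assms s [of Plus Minus] s [of Minus Plus] by (auto simp: gh_classes_def)
qed

lemma has_torsion_type_flip:
  "has_torsion_type h J (\<lambda>x. psi (J x)) \<alpha> U \<longleftrightarrow> has_torsion_type h J psi \<alpha> (flip_class ` U)"
proof
  assume "has_torsion_type h J (\<lambda>x. psi (J x)) \<alpha> U"
  then obtain a where a: "\<forall>k\<in>gh_classes. a k \<in> torsion_module h J (\<lambda>x. psi (J x)) k"
    "\<forall>x y z. \<alpha> x y z = (\<Sum>k\<in>gh_classes. a k x y z)" "\<forall>k\<in>gh_classes - U. \<forall>x y z. a k x y z = 0"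
    unfolding has_torsion_type_def by blast
  show "has_torsion_type h J psi \<alpha> (flip_class ` U)"
    unfolding has_torsion_type_def
  proof (intro exI [of _ "\<lambda>k. a (flip_class k)"] conjI ballI)
    fix k assume k: "k \<in> gh_classes"
    show "a (flip_class k) \<in> torsion_module h J psi k"
      using a(1) k torsion_module_flip [OF k] by fastforce
  next
    show "\<forall>x y z. \<alpha> x y z = (\<Sum>k\<in>gh_classes. a (flip_class k) x y z)"
      using a(2) sum_flip_class [of "\<lambda>k. a k x y z" for x y z] by simp
  next
    fix k assume "k \<in> gh_classes - flip_class ` U"
    then show "\<forall>x y z. a (flip_class k) x y z = 0"
      using a(3) by (metis Diff_iff flip_class_flip_class flip_class_gh imageI)
  qed
next
  assume "has_torsion_type h J psi \<alpha> (flip_class ` U)"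
  then obtain a where a: "\<forall>k\<in>gh_classes. a k \<in> torsion_module h J psi k"
    "\<forall>x y z. \<alpha> x y z = (\<Sum>k\<in>gh_classes. a k x y z)" "\<forall>k\<in>gh_classes - flip_class ` U. \<forall>x y z. a k x y z = 0"
    unfolding has_torsion_type_def by blast
  show "has_torsion_type h J (\<lambda>x. psi (J x)) \<alpha> U"
    unfolding has_torsion_type_def
  proof (intro exI [of _ "\<lambda>k. a (flip_class k)"] conjI ballI)
    fix k assume k: "k \<in> gh_classes"
    show "a (flip_class k) \<in> torsion_module h J (\<lambda>x. psi (J x)) k"
      using a(1) k torsion_module_flip [of "flip_class k"] by simp
  next
    show "\<forall>x y z. \<alpha> x y z = (\<Sum>k\<in>gh_classes. a (flip_class k) x y z)"
      using a(2) sum_flip_class [of "\<lambda>k. a k x y z" for x y z] by simp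
  next
    fix k assume "k \<in> gh_classes - U"
    then show "\<forall>x y z. a (flip_class k) x y z = 0"
      using a(3) by simp
  qed
qed

end

section \<open>Calculus in charts\<close>

lemma smooth_on_differentiable: "smooth_on S f \<Longrightarrow> x \<in> S \<Longrightarrow> f differentiable (at x)"
  unfolding smooth_on_def using Ck_on.simps(2) [of 0 S f] by blast

lemma smooth_on_ddir: "smooth_on S f \<Longrightarrow> smooth_on S (\<lambda>x. ddir f x v)"
  unfolding smooth_on_def using Ck_on.simps(2) by blast

lemma smooth_on_continuous: "smooth_on S f \<Longrightarrow> continuous_on S f"
  unfolding smooth_on_def using Ck_on.simps(1) by blast

lemma smooth_on_has_derivative:
  "smooth_on S f \<Longrightarrow> x \<in> S \<Longrightarrow> (f has_derivative ddir f x) (at x)"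
  using smooth_on_differentiable frechet_derivative_works by blast

lemma ddir_eq: "(f has_derivative f') (at u) \<Longrightarrow> ddir f u x = f' x"
  using frechet_derivative_at by metis

lemma ddir_cong_open:
  assumes "open S" "u \<in> S" "\<And>v. v \<in> S \<Longrightarrow> f v = g v"
  shows "ddir f u = ddir g u"
proof -
  have "(f has_derivative f') (at u) \<longleftrightarrow> (g has_derivative f') (at u)" for f'
    using has_derivative_transform_within_open [OF _ assms(1,2)] assms(3) by metis
  then show ?thesis
    unfolding frechet_derivative_def by simp
qed

lemma has_derivative_cong_open:
  assumes "(f has_derivative f') (at u)" "open S" "u \<in> S" "\<And>v. v \<in> S \<Longrightarrow> f v = g v"
  shows "(g has_derivative f') (at u)"
  using has_derivative_transform_within_open assms by metis

section \<open>Symmetry of second derivatives\<close>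

lemma DERIV_along_line:
  fixes f :: "'a::real_normed_vector \<Rightarrow> real"
  assumes "f differentiable (at (p + s *\<^sub>R x))"
  shows "((\<lambda>s. f (p + s *\<^sub>R x)) has_real_derivative ddir f (p + s *\<^sub>R x) x) (at s)"
proof -
  have f: "(f has_derivative ddir f (p + s *\<^sub>R x)) (at (p + s *\<^sub>R x))"
    using assms frechet_derivative_works by blast
  have "((\<lambda>s. p + s *\<^sub>R x) has_derivative (\<lambda>r. r *\<^sub>R x)) (at s)"
    by (auto intro!: derivative_eq_intros)
  from has_derivative_compose [OF this f]
  have "((\<lambda>s. f (p + s *\<^sub>R x)) has_derivative (\<lambda>r. ddir f (p + s *\<^sub>R x) (r *\<^sub>R x))) (at s)" .
  moreover have "ddir f (p + s *\<^sub>R x) (r *\<^sub>R x) = ddir f (p + s *\<^sub>R x) x * r" for r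
    using linear_scale [OF linear_frechet_derivative [OF assms], of r x] by simp
  ultimately show ?thesis
    by (simp add: has_field_derivative_def)
qed

text \<open>Two applications of the mean value theorem: first in direction \<open>x\<close> to the
  increment in direction \<open>y\<close>, then in direction \<open>y\<close> to the derivative in
  direction \<open>x\<close>.\<close>

lemma second_difference:
  fixes f :: "'a::real_normed_vector \<Rightarrow> real"
  assumes f: "smooth_on S f" and t: "t > 0"
    and S: "\<And>a b. 0 \<le> a \<Longrightarrow> a \<le> t \<Longrightarrow> 0 \<le> b \<Longrightarrow> b \<le> t \<Longrightarrow> u + a *\<^sub>R x + b *\<^sub>R y \<in> S"
  obtains a b where "0 \<le> a" "a \<le> t" "0 \<le> b" "b \<le> t"
    "f (u + t *\<^sub>R x + t *\<^sub>R y) - f (u + t *\<^sub>R x) - f (u + t *\<^sub>R y) + f u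
      = t * t * ddir (\<lambda>v. ddir f v x) (u + a *\<^sub>R x + b *\<^sub>R y) y"
proof -
  have "\<exists>z>0. z < t \<and> (f ((u + t *\<^sub>R y) + t *\<^sub>R x) - f (u + t *\<^sub>R x)) - (f ((u + t *\<^sub>R y) + 0 *\<^sub>R x) - f (u + 0 *\<^sub>R x))
      = (t - 0) * (ddir f ((u + t *\<^sub>R y) + z *\<^sub>R x) x - ddir f (u + z *\<^sub>R x) x)"
  proof (rule MVT2 [OF t])
    fix s assume s: "0 \<le> s" "s \<le> t"
    have "f differentiable (at ((u + t *\<^sub>R y) + s *\<^sub>R x))"
      using S [OF s, of t] t smooth_on_differentiable [OF f] by (simp add: add_ac)
    moreover have "f differentiable (at (u + s *\<^sub>R x))"
      using S [OF s, of 0] t smooth_on_differentiable [OF f] by simp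
    ultimately show "((\<lambda>s. f (u + t *\<^sub>R y + s *\<^sub>R x) - f (u + s *\<^sub>R x)) has_real_derivative
        ddir f (u + t *\<^sub>R y + s *\<^sub>R x) x - ddir f (u + s *\<^sub>R x) x) (at s)"
      by (intro DERIV_diff DERIV_along_line)
  qed
  then obtain a where a: "0 < a" "a < t"
    "f (u + t *\<^sub>R x + t *\<^sub>R y) - f (u + t *\<^sub>R x) - f (u + t *\<^sub>R y) + f u
      = t * (ddir f ((u + a *\<^sub>R x) + t *\<^sub>R y) x - ddir f (u + a *\<^sub>R x) x)"
    by (auto simp: add_ac)
  have "\<exists>z>0. z < t \<and> ddir f ((u + a *\<^sub>R x) + t *\<^sub>R y) x - ddir f ((u + a *\<^sub>R x) + 0 *\<^sub>R y) x
      = (t - 0) * ddir (\<lambda>v. ddir f v x) ((u + a *\<^sub>R x) + z *\<^sub>R y) y"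
  proof (rule MVT2 [OF t])
    fix s assume s: "0 \<le> s" "s \<le> t"
    have "(\<lambda>v. ddir f v x) differentiable (at ((u + a *\<^sub>R x) + s *\<^sub>R y))"
      using S [of a, OF _ _ s] a smooth_on_differentiable [OF smooth_on_ddir [OF f]] by simp
    then show "((\<lambda>s. ddir f (u + a *\<^sub>R x + s *\<^sub>R y) x) has_real_derivative
        ddir (\<lambda>v. ddir f v x) (u + a *\<^sub>R x + s *\<^sub>R y) y) (at s)"
      using DERIV_along_line [of "\<lambda>v. ddir f v x"] by blast
  qed
  then obtain b where b: "0 < b" "b < t" "ddir f ((u + a *\<^sub>R x) + t *\<^sub>R y) x - ddir f (u + a *\<^sub>R x) x
      = t * ddir (\<lambda>v. ddir f v x) ((u + a *\<^sub>R x) + b *\<^sub>R y) y"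
    by auto
  show ?thesis
    by (rule that [of a b]) (use a b in auto)
qed

text \<open>The second difference is symmetric in \<open>x\<close> and \<open>y\<close>, and it
  equals t^2 times either mixed derivative at a nearby point; continuity concludes. The vector
  version makes the second fundamental form symmetric and the induced connection
  torsion-free.\<close>

lemma ddir_commute_real:
  fixes f :: "'a::real_normed_vector \<Rightarrow> real"
  assumes S: "open S" "u \<in> S" and f: "smooth_on S f"
  shows "ddir (\<lambda>v. ddir f v x) u y = ddir (\<lambda>v. ddir f v y) u x"
proof -
  define g where "g x y v = ddir (\<lambda>v. ddir f v x) v y" for x y v
  have cont: "isCont (g x y) u" for x y
    unfolding g_def using smooth_on_continuous [OF smooth_on_ddir [OF smooth_on_ddir [OF f]]] S
    by (simp add: continuous_on_eq_continuous_at)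
  have "\<bar>g x y u - g y x u\<bar> < 2 * r" if r: "r > 0" for r
  proof -
    obtain d1 where d1: "d1 > 0" "\<And>v. dist v u < d1 \<Longrightarrow> dist (g x y v) (g x y u) < r"
      using cont [of x y] r unfolding continuous_at_eps_delta by blast
    obtain d2 where d2: "d2 > 0" "\<And>v. dist v u < d2 \<Longrightarrow> dist (g y x v) (g y x u) < r"
      using cont [of y x] r unfolding continuous_at_eps_delta by blast
    obtain d3 where d3: "d3 > 0" "\<And>v. dist v u < d3 \<Longrightarrow> v \<in> S"
      using S unfolding open_dist by blast
    define d where "d = min d1 (min d2 d3)"
    have d: "d > 0"
      using d1 d2 d3 by (simp add: d_def)
    \<comment> \<open>Small enough that the whole parallelogram with sides
      \<open>t *\<^sub>R x\<close> and \<open>t *\<^sub>R y\<close> stays within distance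
      \<open>d\<close> of \<open>u\<close>; the added 1 avoids division by zero.\<close>
    define t where "t = d / (2 * (1 + norm x + norm y))"
    have n: "1 + norm x + norm y > 0"
      using norm_ge_zero [of x] norm_ge_zero [of y] by linarith
    have t: "t > 0"
      using d n by (simp add: t_def)
    have near: "dist (u + a *\<^sub>R x + b *\<^sub>R y) u < d" if "0 \<le> a" "a \<le> t" "0 \<le> b" "b \<le> t" for a b
    proof -
      have "dist (u + a *\<^sub>R x + b *\<^sub>R y) u = norm (a *\<^sub>R x + b *\<^sub>R y)"
        by (simp add: dist_norm)
      also have "\<dots> \<le> a * norm x + b * norm y"
        using norm_triangle_ineq [of "a *\<^sub>R x" "b *\<^sub>R y"] that by simp
      also have "\<dots> \<le> t * norm x + t * norm y"
        using that by (intro add_mono mult_right_mono) auto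
      also have "\<dots> = t * (norm x + norm y)"
        by (simp add: algebra_simps)
      also have "\<dots> < t * (2 * (1 + norm x + norm y))"
        using n by (intro mult_strict_left_mono [OF _ t]) (smt (verit) norm_ge_zero)
      also have "\<dots> = d"
        using n by (simp add: t_def)
      finally show ?thesis .
    qed
    have S1: "u + a *\<^sub>R x + b *\<^sub>R y \<in> S" if "0 \<le> a" "a \<le> t" "0 \<le> b" "b \<le> t" for a b
      using d3(2) near [OF that] by (simp add: d_def)
    have S2: "u + a *\<^sub>R y + b *\<^sub>R x \<in> S" if "0 \<le> a" "a \<le> t" "0 \<le> b" "b \<le> t" for a b
      using S1 [OF that(3,4,1,2)] by (simp add: add_ac)
    obtain a b where ab: "0 \<le> a" "a \<le> t" "0 \<le> b" "b \<le> t"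
      "f (u + t *\<^sub>R x + t *\<^sub>R y) - f (u + t *\<^sub>R x) - f (u + t *\<^sub>R y) + f u
        = t * t * g x y (u + a *\<^sub>R x + b *\<^sub>R y)"
      unfolding g_def using second_difference [OF f t S1] by blast
    obtain a' b' where ab': "0 \<le> a'" "a' \<le> t" "0 \<le> b'" "b' \<le> t"
      "f (u + t *\<^sub>R y + t *\<^sub>R x) - f (u + t *\<^sub>R y) - f (u + t *\<^sub>R x) + f u
        = t * t * g y x (u + a' *\<^sub>R y + b' *\<^sub>R x)"
      unfolding g_def using second_difference [OF f t S2] by blast
    have swap: "u + a' *\<^sub>R y + b' *\<^sub>R x = u + b' *\<^sub>R x + a' *\<^sub>R y" "u + t *\<^sub>R y + t *\<^sub>R x = u + t *\<^sub>R x + t *\<^sub>R y"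
      by simp_all
    have "t * t * g x y (u + a *\<^sub>R x + b *\<^sub>R y) = t * t * g y x (u + b' *\<^sub>R x + a' *\<^sub>R y)"
      using ab(5) ab'(5) [unfolded swap] by linarith
    with t have "g x y (u + a *\<^sub>R x + b *\<^sub>R y) = g y x (u + b' *\<^sub>R x + a' *\<^sub>R y)"
      by simp
    moreover have "dist (g x y (u + a *\<^sub>R x + b *\<^sub>R y)) (g x y u) < r"
      using near [OF ab(1-4)] d1(2) by (simp add: d_def)
    moreover have "dist (g y x (u + b' *\<^sub>R x + a' *\<^sub>R y)) (g y x u) < r"
      using near [OF ab'(3,4,1,2)] d2(2) by (simp add: d_def)
    ultimately show ?thesis
      by (simp add: dist_real_def)
  qed
  from this [of "\<bar>g x y u - g y x u\<bar> / 2"] have "g x y u = g y x u"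
    by fastforce
  then show ?thesis
    by (simp add: g_def)
qed

lemma ddir_bounded_linear:
  assumes "bounded_linear L" "f differentiable (at v)"
  shows "ddir (\<lambda>v. L (f v)) v x = L (ddir f v x)"
  by (rule ddir_eq, rule bounded_linear.has_derivative [OF assms(1)])
    (use assms(2) frechet_derivative_works in blast)

lemma Ck_on_cong:
  assumes "open S"
  shows "Ck_on k S g \<Longrightarrow> (\<And>x. x \<in> S \<Longrightarrow> g x = g' x) \<Longrightarrow> Ck_on k S g'"
proof (induction k arbitrary: g g')
  case 0
  then show ?case by (metis Ck_on.simps(1) continuous_on_cong)
next
  case (Suc k)
  have eq: "ddir g x = ddir g' x" if "x \<in> S" for x
    using ddir_cong_open [OF assms that] Suc.prems(2) by blast
  have "g' differentiable (at x)" if "x \<in> S" for x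
    using Suc.prems that unfolding differentiable_def Ck_on.simps
    using has_derivative_cong_open [OF _ assms that] by metis
  moreover have "Ck_on k S (\<lambda>x. ddir g' x v)" for v
    using Suc.IH [of "\<lambda>x. ddir g x v"] Suc.prems eq by simp
  ultimately show ?case by simp
qed

lemma Ck_on_bounded_linear:
  assumes L: "bounded_linear L"
  shows "open S \<Longrightarrow> Ck_on k S f \<Longrightarrow> Ck_on k S (\<lambda>x. L (f x))"
proof (induction k arbitrary: f)
  case 0
  then show ?case
    using bounded_linear.continuous_on [OF L] by simp
next
  case (Suc k)
  have d: "f differentiable (at x)" if "x \<in> S" for x
    using Suc that by simp
  have "(\<lambda>x. L (f x)) differentiable (at x)" if "x \<in> S" for x
    using d [OF that] bounded_linear.has_derivative [OF L] unfolding differentiable_def by blast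
  moreover have "Ck_on k S (\<lambda>x. ddir (\<lambda>x. L (f x)) x v)" for v
  proof (rule Ck_on_cong [OF Suc.prems(1)])
    show "Ck_on k S (\<lambda>x. L (ddir f x v))"
      using Suc by simp
  qed (simp add: ddir_bounded_linear [OF L d])
  ultimately show ?case by simp
qed

lemma ddir_commute:
  fixes f :: "'a::real_normed_vector \<Rightarrow> real ^ 'n"
  assumes S: "open S" "u \<in> S" and f: "smooth_on S f"
  shows "ddir (\<lambda>v. ddir f v x) u y = ddir (\<lambda>v. ddir f v y) u x"
proof (rule vec_eq_iff [THEN iffD2, rule_format])
  fix i
  define g where "g v = f v $ i" for v
  have L: "bounded_linear (\<lambda>v :: real ^ 'n. v $ i)"
    by (rule bounded_linear_vec_nth)
  have g: "smooth_on S g"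
    using f Ck_on_bounded_linear [OF L S(1)] unfolding smooth_on_def g_def by blast
  have 1: "ddir g v x = ddir f v x $ i" if "v \<in> S" for v x
    unfolding g_def using ddir_bounded_linear [OF L smooth_on_differentiable [OF f that]] .
  have 2: "ddir (\<lambda>v. ddir g v x) u y = ddir (\<lambda>v. ddir f v x) u y $ i" for x y
    using ddir_bounded_linear [OF L smooth_on_differentiable [OF smooth_on_ddir [OF f] S(2)]]
      ddir_cong_open [OF S, of "\<lambda>v. ddir g v x" "\<lambda>v. ddir f v x $ i"] 1 by simp
  show "ddir (\<lambda>v. ddir f v x) u y $ i = ddir (\<lambda>v. ddir f v y) u x $ i"
    using ddir_commute_real [OF S g] by (simp add: 2)
qed

section \<open>Product rules for fields of multilinear forms\<close>

lemma bilinear_expand: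
  fixes x :: "real ^ 'n" and y :: "real ^ 'm"
  assumes "bilinear b"
  shows "b x y = (\<Sum>i\<in>UNIV. \<Sum>j\<in>UNIV. (x $ i * y $ j) *\<^sub>R b (axis i 1) (axis j 1))"
proof -
  have "b x y = b (\<Sum>i\<in>UNIV. x $ i *\<^sub>R axis i 1) (\<Sum>j\<in>UNIV. y $ j *\<^sub>R axis j 1)"
    by (simp add: basis_expansion flip: scalar_mult_eq_scaleR)
  also have "\<dots> = (\<Sum>(i, j)\<in>UNIV. b (x $ i *\<^sub>R axis i 1) (y $ j *\<^sub>R axis j 1))"
    by (subst bilinear_sum [OF assms]) (simp_all add: UNIV_Times_UNIV)
  also have "\<dots> = (\<Sum>i\<in>UNIV. \<Sum>j\<in>UNIV. b (x $ i *\<^sub>R axis i 1) (y $ j *\<^sub>R axis j 1))"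
    by (simp add: sum.cartesian_product UNIV_Times_UNIV)
  finally show ?thesis
    by (simp add: bilinear_lmul [OF assms] bilinear_rmul [OF assms] mult.commute)
qed

text \<open>Differentiability of the field is known only for its values at fixed vectors, so the
  product rule goes through the components in the standard basis.\<close>

lemma has_derivative_bilinear_field:
  fixes G :: "'v::real_normed_vector \<Rightarrow> real ^ 'n \<Rightarrow> real ^ 'm \<Rightarrow> real"
  assumes S: "open S" "p \<in> S" and bil: "\<And>v. v \<in> S \<Longrightarrow> bilinear (G v)"
    and G: "\<And>x y. (\<lambda>v. G v x y) differentiable (at p)"
    and X: "(X has_derivative X') (at p)" and Y: "(Y has_derivative Y') (at p)"
  shows "((\<lambda>v. G v (X v) (Y v)) has_derivative
    (\<lambda>w. ddir (\<lambda>v. G v (X p) (Y p)) p w + G p (X' w) (Y p) + G p (X p) (Y' w))) (at p)"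
proof -
  define g' where "g' i j = ddir (\<lambda>v. G v (axis i 1) (axis j 1)) p" for i j
  have g': "((\<lambda>v. G v (axis i 1) (axis j 1)) has_derivative g' i j) (at p)" for i j
    unfolding g'_def using G frechet_derivative_works by blast
  have nth: "((\<lambda>v. Z v $ i) has_derivative (\<lambda>w. Z' w $ i)) (at p)"
    if "(Z has_derivative Z') (at p)" for Z :: "'v \<Rightarrow> real ^ 'k" and Z' i
    using bounded_linear.has_derivative [OF bounded_linear_vec_nth that] .
  have D: "((\<lambda>v. G v (X v) (Y v)) has_derivative
      (\<lambda>w. \<Sum>i\<in>UNIV. \<Sum>j\<in>UNIV. (X p $ i * Y p $ j) * g' i j w
        + (X p $ i * Y' w $ j + X' w $ i * Y p $ j) * G p (axis i 1) (axis j 1))) (at p)"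
    if X: "(X has_derivative X') (at p)" and Y: "(Y has_derivative Y') (at p)" for X Y X' Y'
  proof (rule has_derivative_cong_open [OF _ S])
    show "((\<lambda>v. \<Sum>i\<in>UNIV. \<Sum>j\<in>UNIV. (X v $ i * Y v $ j) * G v (axis i 1) (axis j 1)) has_derivative
        (\<lambda>w. \<Sum>i\<in>UNIV. \<Sum>j\<in>UNIV. (X p $ i * Y p $ j) * g' i j w
          + (X p $ i * Y' w $ j + X' w $ i * Y p $ j) * G p (axis i 1) (axis j 1))) (at p)"
      by (intro has_derivative_sum has_derivative_mult nth X Y g')
    show "(\<Sum>i\<in>UNIV. \<Sum>j\<in>UNIV. (X v $ i * Y v $ j) * G v (axis i 1) (axis j 1)) = G v (X v) (Y v)"
      if "v \<in> S" for v
      using bilinear_expand [OF bil [OF that], of "X v" "Y v"] by simp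
  qed
  \<comment> \<open>The component formula applied to constant arguments identifies its first sum
    with the derivative of the form alone.\<close>
  have c: "ddir (\<lambda>v. G v (X p) (Y p)) p w = (\<Sum>i\<in>UNIV. \<Sum>j\<in>UNIV. (X p $ i * Y p $ j) * g' i j w)" for w
    using ddir_eq [OF D [OF has_derivative_const has_derivative_const, of "X p" "Y p"]] by simp
  show ?thesis
    by (rule has_derivative_eq_rhs [OF D [OF X Y]])
      (simp add: c bilinear_expand [OF bil [OF S(2)], of "X p"] bilinear_expand [OF bil [OF S(2)], of "X' _"]
        sum.distrib algebra_simps)
qed

lemma has_derivative_phi0:
  assumes "(X has_derivative X') (at p)" "(Y has_derivative Y') (at p)" "(Z has_derivative Z') (at p)"
  shows "((\<lambda>v. phi0 (X v) (Y v) (Z v)) has_derivative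
    (\<lambda>w. phi0 (X' w) (Y p) (Z p) + phi0 (X p) (Y' w) (Z p) + phi0 (X p) (Y p) (Z' w))) (at p)"
  unfolding phi0_cross0
  by (rule has_derivative_eq_rhs [OF has_derivative_inner [OF cross0.FDERIV [OF assms(1,2)] assms(3)]])
    (simp add: inner_simps algebra_simps)

section \<open>The Levi-Civita connection at a point of a chart\<close>

definition is_levi_civita :: "(real ^ 'n \<Rightarrow> real ^ 'n \<Rightarrow> real ^ 'n \<Rightarrow> real) \<Rightarrow> real ^ 'n \<Rightarrow>
    (real ^ 'n \<Rightarrow> real ^ 'n \<Rightarrow> real ^ 'n) \<Rightarrow> bool" where
  "is_levi_civita G u \<Gamma> \<longleftrightarrow> bilinear \<Gamma> \<and> (\<forall>x y. \<Gamma> x y = \<Gamma> y x) \<and>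
     (\<forall>x y z. ddir (\<lambda>v. G v y z) u x = G u (\<Gamma> x y) z + G u y (\<Gamma> x z))"

text \<open>The difference of two candidates is symmetric in its arguments and skew for the metric.
  A trilinear form symmetric in one pair of slots and skew in an overlapping pair is zero.\<close>

lemma levi_civita_eq:
  assumes G: "inner_form (metric R c u)" and \<Gamma>: "is_levi_civita (metric R c) u \<Gamma>"
  shows "levi_civita R c u = \<Gamma>"
proof -
  have "\<Gamma>' = \<Gamma>" if \<Gamma>': "is_levi_civita (metric R c) u \<Gamma>'" for \<Gamma>'
  proof (intro ext)
    fix x y
    define D where "D x y = \<Gamma>' x y - \<Gamma> x y" for x y
    define g where "g = metric R c u"
    have g: "inner_form g" using G by (simp add: g_def)
    have D_sym: "D x y = D y x" for x y
      using \<Gamma> \<Gamma>' by (simp add: D_def is_levi_civita_def)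
    have D_skew: "g (D x y) z = - g (D x z) y" for x y z
    proof -
      have "g (\<Gamma>' x y) z + g y (\<Gamma>' x z) = g (\<Gamma> x y) z + g y (\<Gamma> x z)"
        using \<Gamma> \<Gamma>' unfolding is_levi_civita_def g_def by metis
      then show ?thesis
        by (simp add: D_def bilinear_lsub [OF inner_form_bilinear [OF g]] inner_form_sym [OF g, of y])
    qed
    have "g (D x y) z = - g (D x y) z" for z
      using D_skew [of x y z] D_skew [of z x y] D_skew [of y z x] D_sym [of x z] D_sym [of y z] D_sym [of x y]
      by simp
    then have "D x y = 0"
      using inner_form_eqI [OF g, of "D x y" 0] by (simp add: bilinear_lzero [OF inner_form_bilinear [OF g]])
    then show "\<Gamma>' x y = \<Gamma> x y"
      by (simp add: D_def)
  qed
  then show ?thesis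
    using \<Gamma> unfolding levi_civita_def is_levi_civita_def by (intro the_equality) blast+
qed

lemma levi_civita_exists:
  fixes G :: "real ^ 'n \<Rightarrow> real ^ 'n \<Rightarrow> real ^ 'n \<Rightarrow> real"
  assumes S: "open S" "u \<in> S" and G: "\<And>v. v \<in> S \<Longrightarrow> inner_form (G v)"
    and diff: "\<And>x y. (\<lambda>v. G v x y) differentiable (at u)" and e: "orthonormal (G u) e"
  obtains \<Gamma> where "is_levi_civita G u \<Gamma>"
proof -
  define d where "d x y z = ddir (\<lambda>v. G v y z) u x" for x y z
  note g = G [OF S(2)]
  have works: "((\<lambda>v. G v y z) has_derivative ddir (\<lambda>v. G v y z) u) (at u)" for y z
    using diff frechet_derivative_works by blast
  have d1: "linear (\<lambda>x. d x y z)" for y z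
    unfolding d_def using linear_frechet_derivative [OF diff] .
  have d_sym: "d x y z = d x z y" for x y z
    unfolding d_def using ddir_cong_open [OF S, of "\<lambda>v. G v y z" "\<lambda>v. G v z y"] inner_form_sym [OF G] by simp
  have d3: "linear (\<lambda>z. d x y z)" for x y
  proof (rule linearI)
    fix a b r
    have "ddir (\<lambda>v. G v y (a + b)) u = ddir (\<lambda>v. G v y a + G v y b) u"
      by (rule ddir_cong_open [OF S]) (simp add: bilinear_radd [OF inner_form_bilinear [OF G]])
    then show "d x y (a + b) = d x y a + d x y b"
      unfolding d_def using ddir_eq [OF has_derivative_add [OF works works]] by simp
    have "ddir (\<lambda>v. G v y (r *\<^sub>R a)) u = ddir (\<lambda>v. r * G v y a) u"
      by (rule ddir_cong_open [OF S]) (simp add: bilinear_rmul [OF inner_form_bilinear [OF G]])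
    then show "d x y (r *\<^sub>R a) = r *\<^sub>R d x y a"
      unfolding d_def using ddir_eq [OF has_derivative_mult_right [OF works]] by simp
  qed
  have d2: "linear (\<lambda>y. d x y z)" for x z
    using d3 [of x z] by (simp add: d_sym [of _ z])
  \<comment> \<open>Koszul's formula for constant vector fields, whose brackets vanish.\<close>
  define K where "K x y z = (d x y z + d y x z - d z x y) / 2" for x y z
  have K: "linear (\<lambda>z. K x y z)" "linear (\<lambda>y. K x y z)" "linear (\<lambda>x. K x y z)" for x y z
    using d1 d2 d3 unfolding K_def linear_iff by (simp_all add: field_simps)
  have "\<exists>w. \<forall>z. G u w z = K x y z" for x y
    using frame_riesz [OF g e K(1)] by blast
  then obtain \<Gamma> where \<Gamma>: "\<And>x y z. G u (\<Gamma> x y) z = K x y z"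
    by metis
  note [simp] = bilinear_ladd [OF inner_form_bilinear [OF g]] bilinear_lmul [OF inner_form_bilinear [OF g]]
  have "bilinear \<Gamma>"
    unfolding bilinear_def
    by (intro conjI allI linearI; rule inner_form_eqI [OF g])
      (simp_all add: \<Gamma> K [THEN linear_add] K [THEN linear_scale])
  moreover have "\<Gamma> x y = \<Gamma> y x" for x y
    by (rule inner_form_eqI [OF g]) (simp add: \<Gamma> K_def d_sym)
  moreover have "ddir (\<lambda>v. G v y z) u x = G u (\<Gamma> x y) z + G u y (\<Gamma> x z)" for x y z
  proof -
    have "G u (\<Gamma> x y) z + G u y (\<Gamma> x z) = d x y z"
      unfolding inner_form_sym [OF g, of y] \<Gamma> K_def
      using d_sym [of x y z] d_sym [of y x z] d_sym [of z x y] by (simp add: field_simps)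
    then show ?thesis by (simp add: d_def)
  qed
  ultimately show ?thesis
    using that unfolding is_levi_civita_def by blast
qed

section \<open>Differentiability of solutions of linear systems\<close>

lemma differentiable_det:
  fixes B :: "'v::real_normed_vector \<Rightarrow> real ^ 'n ^ 'n"
  assumes "\<And>i j. (\<lambda>v. B v $ i $ j) differentiable (at u)"
  shows "(\<lambda>v. det (B v)) differentiable (at u)"
proof -
  obtain B' where B': "\<And>i j. ((\<lambda>v. B v $ i $ j) has_derivative B' i j) (at u)"
    using assms unfolding differentiable_def by metis
  have "(\<lambda>v. \<Prod>i\<in>UNIV. B v $ i $ p i) differentiable (at u)" for p
    unfolding differentiable_def by (rule exI, rule has_derivative_prod, rule B')
  then show ?thesis
    unfolding det_def by (intro differentiable_sum differentiable_mult differentiable_const) auto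
qed

text \<open>By Cramer's rule.\<close>

lemma differentiable_solution:
  fixes B :: "'v::real_normed_vector \<Rightarrow> real ^ 'n ^ 'n" and q x :: "'v \<Rightarrow> real ^ 'n"
  assumes B: "\<And>i j. (\<lambda>v. B v $ i $ j) differentiable (at u)"
    and q: "\<And>i. (\<lambda>v. q v $ i) differentiable (at u)"
    and V: "open V" "u \<in> V" and sol: "\<And>v. v \<in> V \<Longrightarrow> B v *v x v = q v" and det: "det (B u) \<noteq> 0"
  shows "x differentiable (at u)"
proof -
  define D where "D k v = det (\<chi> i j. if j = k then q v $ i else B v $ i $ j)" for k v
  have "isCont (\<lambda>v. det (B v)) u"
    using differentiable_imp_continuous_within [OF differentiable_det [OF B]] .
  then have "\<forall>\<^sub>F v in nhds u. det (B v) \<noteq> 0"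
    using det tendsto_imp_eventually_ne unfolding isCont_def eventually_nhds_conv_at by blast
  then obtain W where W: "open W" "u \<in> W" "\<And>v. v \<in> W \<Longrightarrow> det (B v) \<noteq> 0"
    unfolding eventually_nhds by blast
  have "(\<lambda>v. D k v) differentiable (at u)" for k
    unfolding D_def
  proof (rule differentiable_det)
    show "(\<lambda>v. (\<chi> i j. if j = k then q v $ i else B v $ i $ j) $ i $ j) differentiable (at u)" for i j
      by (cases "j = k") (simp_all add: B q)
  qed
  then obtain D' where D': "\<And>k. (D k has_derivative D' k) (at u)"
    unfolding differentiable_def by metis
  obtain d' where d': "((\<lambda>v. det (B v)) has_derivative d') (at u)"
    using differentiable_det [OF B] unfolding differentiable_def by metis
  have "((\<lambda>v. \<Sum>k\<in>UNIV. (D k v / det (B v)) *\<^sub>R axis k 1) has_derivative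
      (\<lambda>w. \<Sum>k\<in>UNIV. ((D' k w * det (B u) - D k u * d' w) / (det (B u) * det (B u))) *\<^sub>R (axis k 1 :: real ^ 'n))) (at u)"
    by (intro has_derivative_sum has_derivative_scaleR_left has_derivative_divide' D' d' det)
  then have "(x has_derivative
      (\<lambda>w. \<Sum>k\<in>UNIV. ((D' k w * det (B u) - D k u * d' w) / (det (B u) * det (B u))) *\<^sub>R (axis k 1 :: real ^ 'n))) (at u)"
  proof (rule has_derivative_cong_open [where S = "V \<inter> W"])
    fix v assume v: "v \<in> V \<inter> W"
    then have "x v = (\<chi> k. D k v / det (B v))"
      using cramer [of "B v" "x v" "q v"] sol W(3) by (auto simp: D_def)
    then show "(\<Sum>k\<in>UNIV. (D k v / det (B v)) *\<^sub>R axis k 1) = x v"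
      using basis_expansion [of "x v"] by (simp add: scalar_mult_eq_scaleR)
  qed (use V W in auto)
  then show ?thesis
    unfolding differentiable_def by blast
qed

section \<open>Cayley frames\<close>

lemma riemannian_inner_form:
  "riemannian_manifold R \<Longrightarrow> c \<in> charts R \<Longrightarrow> u \<in> coord_dom c \<Longrightarrow> inner_form (metric R c u)"
  unfolding riemannian_manifold_def inner_form_def by blast

lemma cayley_frame_phi:
  assumes "cayley_frame G f e"
  shows "f x y z = phi0 (comps G e x) (comps G e y) (comps G e z)"
  using assms unfolding cayley_frame_def phi0_def by (simp add: wedge3_def wedge2_def)

lemma cayley_frame_cross:
  assumes G: "inner_form G" and e: "cayley_frame G f e"
  shows "(\<forall>z. G w z = f x y z) \<longleftrightarrow> comps G e w = cross0 (comps G e x) (comps G e y)"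
proof -
  have o: "orthonormal G e"
    using e by (simp add: cayley_frame_def)
  have "(\<forall>z. G w z = f x y z) \<longleftrightarrow>
      (\<forall>z. comps G e w \<bullet> comps G e z = cross0 (comps G e x) (comps G e y) \<bullet> comps G e z)"
    by (simp add: comps_inner [OF G o] cross0_inner cayley_frame_phi [OF e])
  also have "\<dots> \<longleftrightarrow> (\<forall>q. comps G e w \<bullet> q = cross0 (comps G e x) (comps G e y) \<bullet> q)"
    using comps_surj [OF G o] by metis
  finally show ?thesis
    by (simp add: vector_eq_rdot)
qed

lemma cross_comps:
  assumes G: "inner_form (metric N c u)" and e: "cayley_frame (metric N c u) (phi N c u) e"
  shows "comps (metric N c u) e (cross N c u x y)
    = cross0 (comps (metric N c u) e x) (comps (metric N c u) e y)"
proof -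
  have o: "orthonormal (metric N c u) e"
    using e by (simp add: cayley_frame_def)
  obtain w where w: "comps (metric N c u) e w = cross0 (comps (metric N c u) e x) (comps (metric N c u) e y)"
    using comps_surj [OF G o] by blast
  have "cross N c u x y = w"
    unfolding cross_def cayley_frame_cross [OF G e]
    using w by (intro the_equality) (simp_all add: comps_eq_iff [OF G o] flip: w)
  with w show ?thesis by simp
qed

text \<open>Independence of the chosen Cayley frame: \<open>star_phi0\<close> is expressed by inner
  products and cross products, and both are intrinsic by \<open>comps_inner\<close> and
  \<open>cross_comps\<close>.\<close>

lemma star_phi_comps:
  assumes G: "inner_form (metric N c u)" and e: "cayley_frame (metric N c u) (phi N c u) e"
  shows "star_phi N c u x y z w = star_phi0 (comps (metric N c u) e x) (comps (metric N c u) e y)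
    (comps (metric N c u) e z) (comps (metric N c u) e w)"
proof -
  define G where "G = metric N c u"
  define e' where "e' = (SOME e. cayley_frame G (phi N c u) e)"
  have e': "cayley_frame G (phi N c u) e'"
    unfolding e'_def by (rule someI [where P = "cayley_frame G (phi N c u)"]) (use e in \<open>simp add: G_def\<close>)
  have o: "orthonormal G e" "orthonormal G e'"
    using e e' by (simp_all add: cayley_frame_def G_def)
  note G = assms(1) [folded G_def] and e = assms(2) [folded G_def]
  have cc: "cross0 (comps G e x) (comps G e y) \<bullet> cross0 (comps G e z) (comps G e w)
      = cross0 (comps G e' x) (comps G e' y) \<bullet> cross0 (comps G e' z) (comps G e' w)" for x y z w
  proof -
    have "comps G f (cross N c u x y) = cross0 (comps G f x) (comps G f y)"
      if "cayley_frame G (phi N c u) f" for f x y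
      using cross_comps G that unfolding G_def by blast
    then show ?thesis
      using comps_inner [OF G o(1)] comps_inner [OF G o(2)] e e' by metis
  qed
  have "star_phi N c u x y z w = star_phi0 (comps G e' x) (comps G e' y) (comps G e' z) (comps G e' w)"
    by (simp add: star_phi_def star_phi0_def Let_def wedge4_def wedge3_def wedge2_def flip: G_def e'_def)
  also have "\<dots> = star_phi0 (comps G e x) (comps G e y) (comps G e z) (comps G e w)"
    by (simp add: star_phi0_cross0 cc comps_inner [OF G o(1)] comps_inner [OF G o(2)])
  finally show ?thesis
    by (simp add: G_def)
qed

lemma trilinear_phi0_comps:
  assumes "linear f"
  shows "trilinear (\<lambda>x y z. star_phi0 q (f x) (f y) (f z))"
proof -
  have l: "linear (\<lambda>x. star_phi0 q x y z)" "linear (\<lambda>y. star_phi0 q x y z)" "linear (\<lambda>z. star_phi0 q x y z)" for x y z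
    by (simp_all add: linear_iff star_phi0_cross0 cross0.add_left cross0.add_right cross0.scaleR_left cross0.scaleR_right inner_simps algebra_simps)
  show ?thesis
    unfolding trilinear_def using l [THEN linear_compose [OF assms]] by (simp add: o_def)
qed

text \<open>\<open>A w\<close> is the skew matrix of connection forms.\<close>

lemma cayley_structure_equation:
  fixes N :: "'b g2_mfd"
  assumes N: "riemannian_manifold N" and d: "d \<in> charts N"
    and W: "open W" "p \<in> W" "W \<subseteq> coord_dom d"
    and e: "\<And>i. smooth_on W (\<lambda>v. e v i)"
    and cayley: "\<And>v. v \<in> W \<Longrightarrow> cayley_frame (metric N d v) (phi N d v) (e v)"
  obtains A where "is_levi_civita (metric N d) p (levi_civita N d p)"
    "\<And>w. linear (A w)" "\<And>w q r. A w q \<bullet> r = - (q \<bullet> A w r)"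
    "\<And>Y. ((\<lambda>v. comps (metric N d v) (e v) Y) has_derivative
      (\<lambda>w. A w (comps (metric N d p) (e p) Y) + comps (metric N d p) (e p) (levi_civita N d p w Y))) (at p)"
proof -
  define G where "G = metric N d"
  have G: "inner_form (G v)" if "v \<in> W" for v
    unfolding G_def using riemannian_inner_form [OF N d] that W(3) by blast
  have o: "orthonormal (G v) (e v)" if "v \<in> W" for v
    using cayley [OF that] by (simp add: cayley_frame_def G_def)
  have diff: "(\<lambda>v. G v x y) differentiable (at p)" for x y
    using N d W unfolding riemannian_manifold_def G_def by (meson smooth_on_differentiable subsetD)
  note Gp = G [OF W(2)] and op = o [OF W(2)]
  obtain \<Gamma> where \<Gamma>: "is_levi_civita G p \<Gamma>"
    using levi_civita_exists [OF W(1,2) G diff op] .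
  have lc: "levi_civita N d p = \<Gamma>"
    using levi_civita_eq [of N d p \<Gamma>] Gp \<Gamma> by (simp add: G_def)
  define e' where "e' i = ddir (\<lambda>v. e v i) p" for i
  have e': "((\<lambda>v. e v i) has_derivative e' i) (at p)" for i
    unfolding e'_def using smooth_on_has_derivative [OF e W(2)] .
  \<comment> \<open>The covariant derivative of the frame vector \<open>e i\<close> in direction
    \<open>w\<close>; \<open>A w\<close> collects its components. Differentiating orthonormality
    makes the matrix skew.\<close>
  define n where "n w i = e' i w + \<Gamma> w (e p i)" for w i
  define A where "A w q = (\<chi> i. \<Sum>j\<in>UNIV. G p (n w i) (e p j) * q $ j)" for w q
  have bil: "bilinear (G p)"
    using inner_form_bilinear [OF Gp] .
  have der: "((\<lambda>v. G v (X v) (Y v)) has_derivative (\<lambda>w. G p (X' w + \<Gamma> w (X p)) (Y p)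
      + G p (X p) (Y' w + \<Gamma> w (Y p)))) (at p)"
    if "(X has_derivative X') (at p)" "(Y has_derivative Y') (at p)" for X Y X' Y'
    by (rule has_derivative_eq_rhs [OF has_derivative_bilinear_field [OF W(1,2) inner_form_bilinear [OF G] diff that]])
      (use \<Gamma> in \<open>simp_all add: is_levi_civita_def fun_eq_iff bilinear_ladd [OF bil] bilinear_radd [OF bil]\<close>)
  have skew: "G p (n w i) (e p j) + G p (e p i) (n w j) = 0" for w i j
  proof -
    have "((\<lambda>v. G v (e v i) (e v j)) has_derivative
        (\<lambda>w. G p (n w i) (e p j) + G p (e p i) (n w j))) (at p)"
      unfolding n_def by (rule der [OF e' e'])
    moreover have "((\<lambda>v. G v (e v i) (e v j)) has_derivative (\<lambda>w. 0)) (at p)"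
      by (rule has_derivative_cong_open [OF has_derivative_const W(1,2)])
        (use o in \<open>simp add: orthonormal_def\<close>)
    ultimately have "(\<lambda>w. G p (n w i) (e p j) + G p (e p i) (n w j)) = (\<lambda>w. 0)"
      by (rule has_derivative_unique)
    then show ?thesis
      by (rule fun_cong)
  qed
  have A1: "linear (A w)" for w
    by (simp add: linear_iff A_def vec_eq_iff sum.distrib sum_distrib_left algebra_simps)
  have A2: "A w q \<bullet> r = - (q \<bullet> A w r)" for w q r
  proof -
    have "A w q \<bullet> r = (\<Sum>i\<in>UNIV. \<Sum>j\<in>UNIV. G p (n w i) (e p j) * q $ j * r $ i)"
      by (simp add: A_def inner_vec_def sum_distrib_right)
    also have "\<dots> = (\<Sum>j\<in>UNIV. \<Sum>i\<in>UNIV. - (q $ j * (G p (n w j) (e p i) * r $ i)))"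
    proof (subst sum.swap, intro sum.cong refl)
      fix i j
      have "G p (n w i) (e p j) = - G p (n w j) (e p i)"
        using skew [of w i j] inner_form_sym [OF Gp, of "e p i" "n w j"] by simp
      then show "G p (n w i) (e p j) * q $ j * r $ i = - (q $ j * (G p (n w j) (e p i) * r $ i))"
        by simp
    qed
    also have "\<dots> = - (q \<bullet> A w r)"
      by (simp add: A_def inner_vec_def sum_distrib_left sum_negf)
    finally show ?thesis .
  qed
  have A3: "((\<lambda>v. comps (G v) (e v) Y) has_derivative
      (\<lambda>w. A w (comps (G p) (e p) Y) + comps (G p) (e p) (\<Gamma> w Y))) (at p)" for Y
  proof (subst has_derivative_componentwise_within, rule ballI)
    fix k :: "real ^ 7"
    assume "k \<in> Basis"
    then obtain i where k: "k = axis i 1"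
      using axis_inverse by blast
    have "((\<lambda>v. G v (e v i) Y) has_derivative
        (\<lambda>w. G p (n w i) Y + G p (e p i) (0 + \<Gamma> w Y))) (at p)"
      unfolding n_def by (rule der [OF e' has_derivative_const])
    moreover have "G p (n w i) Y + G p (e p i) (0 + \<Gamma> w Y)
        = (A w (comps (G p) (e p) Y) + comps (G p) (e p) (\<Gamma> w Y)) \<bullet> k" for w
      using frame_expand [OF Gp op inner_form_linear(1) [OF Gp, of "n w i"], of Y]
      by (simp add: k inner_axis A_def mult.commute)
    ultimately show "((\<lambda>v. comps (G v) (e v) Y \<bullet> k) has_derivative
        (\<lambda>w. (A w (comps (G p) (e p) Y) + comps (G p) (e p) (\<Gamma> w Y)) \<bullet> k)) (at p)"
      by (simp add: k inner_axis)
  qed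
  show ?thesis
    by (rule that [OF \<Gamma> [folded lc, unfolded G_def] A1 A2 A3 [folded lc, unfolded G_def]])
qed

text \<open>In \<open>nabla3\<close> the connection terms cancel, leaving the derivation of
  \<open>phi0\<close> by \<open>A x\<close>, that is, the dual form contracted with
  \<open>torsion_vec (A x)\<close>. The constants combine to 24 / (4 * 6) = 1.\<close>

lemma rbar_comps:
  fixes N :: "'b g2_mfd"
  assumes N: "riemannian_manifold N" and d: "d \<in> charts N"
    and W: "open W" "p \<in> W" "W \<subseteq> coord_dom d"
    and cayley: "\<And>v. v \<in> W \<Longrightarrow> cayley_frame (metric N d v) (phi N d v) (e v)"
    and A: "\<And>w. linear (A w)" "\<And>w q r. A w q \<bullet> r = - (q \<bullet> A w r)"
    and der: "\<And>Y. ((\<lambda>v. comps (metric N d v) (e v) Y) has_derivative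
      (\<lambda>w. A w (comps (metric N d p) (e p) Y) + comps (metric N d p) (e p) (levi_civita N d p w Y))) (at p)"
  shows "rbar N d p x y = torsion_vec (A x) \<bullet> comps (metric N d p) (e p) y"
proof -
  define G where "G = metric N d p"
  define C where "C = comps G (e p)"
  have G: "inner_form G"
    unfolding G_def using riemannian_inner_form [OF N d] W by blast
  have e: "cayley_frame G (phi N d p) (e p)"
    using cayley [OF W(2)] by (simp add: G_def)
  then have o: "orthonormal G (e p)"
    by (simp add: cayley_frame_def)
  have "nabla3 (levi_civita N d p) (phi N d) p x y z w = star_phi0 (torsion_vec (A x)) (C y) (C z) (C w)" for y z w
  proof -
    have "((\<lambda>v. phi N d v y z w) has_derivative
       (\<lambda>x. phi0 (A x (C y) + C (levi_civita N d p x y)) (C z) (C w)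
          + phi0 (C y) (A x (C z) + C (levi_civita N d p x z)) (C w)
          + phi0 (C y) (C z) (A x (C w) + C (levi_civita N d p x w)))) (at p)"
      by (rule has_derivative_cong_open [OF has_derivative_phi0 [OF der der der, of y z w, folded G_def C_def] W(1,2)])
        (simp add: cayley_frame_phi [OF cayley])
    from ddir_eq [OF this] show ?thesis
      using phi0_derivation [OF A, of x "C y" "C z" "C w"]
      by (simp add: nabla3_def cayley_frame_phi [OF e] flip: C_def)
  qed
  then have 1: "nabla3 (levi_civita N d p) (phi N d) p x = (\<lambda>y z w. star_phi0 (torsion_vec (A x)) (C y) (C z) (C w))"
    by (simp add: fun_eq_iff)
  have 2: "star_phi N d p y = (\<lambda>x z w. star_phi0 (C y) (C x) (C z) (C w))"
    using star_phi_comps [of N d p "e p"] G e by (simp add: fun_eq_iff G_def C_def)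
  have l: "linear C"
    unfolding C_def by (rule linear_comps [OF G])
  have Ce: "C (e p i) = axis i 1" for i
    unfolding C_def by (rule comps_frame [OF o])
  show ?thesis
    unfolding rbar_def 1 2
    by (simp add: form_inner3_frame [OF G o trilinear_phi0_comps [OF l] trilinear_phi0_comps [OF l], folded G_def]
      Ce star_phi0_norm flip: G_def C_def)
qed

section \<open>Ambient charts along an immersion\<close>

lemma chart_inj:
  assumes X: "smooth_manifold X A" and c: "c \<in> A"
  shows "inj_on (snd c) (fst c)" "fst c \<subseteq> topspace X"
proof -
  show t: "fst c \<subseteq> topspace X"
    using X c unfolding smooth_manifold_def by blast
  have "homeomorphic_map (subtopology X (fst c)) (top_of_set (coord_dom c)) (snd c)"
    using X c unfolding smooth_manifold_def by blast
  then have "inj_on (snd c) (topspace (subtopology X (fst c)))"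
    by (rule homeomorphic_imp_injective_map)
  then show "inj_on (snd c) (fst c)"
    using t by (simp add: Int_absorb1)
qed

lemma coord_inv_snd: "smooth_manifold X A \<Longrightarrow> c \<in> A \<Longrightarrow> p \<in> fst c \<Longrightarrow> coord_inv c (snd c p) = p"
  unfolding coord_inv_def by (rule inv_into_f_f [OF chart_inj(1)])

lemma coord_inv_in: "u \<in> coord_dom c \<Longrightarrow> coord_inv c u \<in> fst c"
  unfolding coord_inv_def by (rule inv_into_into)

lemma open_chart_image:
  assumes X: "smooth_manifold X A" and c: "c \<in> A" and U: "openin X U" "U \<subseteq> fst c"
  shows "open (snd c ` U)"
proof -
  have hom: "homeomorphic_map (subtopology X (fst c)) (top_of_set (coord_dom c)) (snd c)"
    and o: "open (coord_dom c)"
    using X c unfolding smooth_manifold_def by blast+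
  have t: "fst c \<subseteq> topspace X"
    by (rule chart_inj [OF X c])
  have "openin (subtopology X (fst c)) U"
    using U by (simp add: openin_subset_topspace_eq openin_subtopology_Int2 subset_openin_subtopology)
  then have "openin (top_of_set (coord_dom c)) (snd c ` U)"
    using homeomorphic_map_openness [OF hom, of U] U t by simp
  then show ?thesis
    using o openin_open_trans by blast
qed

lemma bij_of_isometry:
  assumes "inner_form G" "linear T" "\<And>x y. G' (T x) (T y) = G x y" "bilinear G'"
  shows "surj (T :: real ^ 'n \<Rightarrow> real ^ 'n)"
proof -
  have "T x = 0 \<Longrightarrow> x = 0" for x
  proof (rule ccontr)
    assume "T x = 0" "x \<noteq> 0"
    then show False
      using inner_form_pos [OF assms(1), of x] assms(3) [of x x] bilinear_lzero [OF assms(4)] by simp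
  qed
  then have "inj T"
    using linear_injective_0 [OF assms(2)] by blast
  then show ?thesis
    using linear_injective_imp_surjective [OF assms(2)] by blast
qed

locale immersed =
  fixes M :: "('a, 'b) hypersurf"
  assumes amb: "g2_manifold (amb M)" and hyp: "hypersurface M"
begin

lemma manifold: "smooth_manifold (htop M) (hcharts M)"
  using hyp unfolding hypersurface_def by blast

lemma amb_riemannian: "riemannian_manifold (amb M)"
  using amb unfolding g2_manifold_def by blast

lemma amb_manifold: "smooth_manifold (mtop (amb M)) (charts (amb M))"
  using amb_riemannian unfolding riemannian_manifold_def by blast

lemma open_local_dom:
  assumes c: "c \<in> hcharts M" and d: "d \<in> charts (amb M)"
  shows "open (local_dom M d c)"
proof (rule open_chart_image [OF manifold c])
  have "continuous_map (htop M) (mtop (amb M)) (imm M)"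
    using hyp unfolding hypersurface_def by blast
  moreover have "openin (mtop (amb M)) (fst d)"
    using amb_manifold d unfolding smooth_manifold_def by blast
  ultimately have "openin (htop M) {p \<in> topspace (htop M). imm M p \<in> fst d}"
    by (rule openin_continuous_map_preimage)
  moreover have "openin (htop M) (fst c)"
    using manifold c unfolding smooth_manifold_def by blast
  ultimately have "openin (htop M) (fst c \<inter> {p \<in> topspace (htop M). imm M p \<in> fst d})"
    by blast
  moreover have "fst c \<inter> {p \<in> topspace (htop M). imm M p \<in> fst d} = fst c \<inter> imm M -` fst d"
    using chart_inj(2) [OF manifold c] by blast
  ultimately show "openin (htop M) (fst c \<inter> imm M -` fst d)"
    by simp
qed simp

lemma local_domD:
  assumes "c \<in> hcharts M" "v \<in> local_dom M d c"
  shows "coord_inv c v \<in> fst c" "imm M (coord_inv c v) \<in> fst d" "v \<in> coord_dom c"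
    "local_rep M d c v = snd d (imm M (coord_inv c v))"
proof -
  obtain p where p: "p \<in> fst c" "imm M p \<in> fst d" "v = snd c p"
    using assms(2) by blast
  then show "coord_inv c v \<in> fst c" "imm M (coord_inv c v) \<in> fst d" "v \<in> coord_dom c"
    "local_rep M d c v = snd d (imm M (coord_inv c v))"
    using coord_inv_snd [OF manifold assms(1) p(1)] by (simp_all add: local_rep_def)
qed

lemma amb_chart:
  assumes c: "c \<in> hcharts M" and v: "v \<in> coord_dom c"
  shows "amb_chart M c v \<in> charts (amb M)" "v \<in> local_dom M (amb_chart M c v) c"
proof -
  have p: "coord_inv c v \<in> fst c"
    by (rule coord_inv_in [OF v])
  have "imm M (coord_inv c v) \<in> topspace (mtop (amb M))"
    using hyp p chart_inj(2) [OF manifold c] unfolding hypersurface_def continuous_map_def by blast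
  then have "\<exists>d. d \<in> charts (amb M) \<and> imm M (coord_inv c v) \<in> fst d"
    using amb_manifold unfolding smooth_manifold_def by blast
  then have *: "amb_chart M c v \<in> charts (amb M) \<and> imm M (coord_inv c v) \<in> fst (amb_chart M c v)"
    unfolding amb_chart_def by (rule someI_ex)
  then show "amb_chart M c v \<in> charts (amb M)" by blast
  have "snd c (coord_inv c v) = v"
    using v unfolding coord_inv_def by (rule f_inv_into_f)
  then show "v \<in> local_dom M (amb_chart M c v) c"
    using * p by (metis IntI image_eqI vimageI)
qed

lemma local_rep_smooth:
  assumes "c \<in> hcharts M" "d \<in> charts (amb M)"
  shows "smooth_on (local_dom M d c) (local_rep M d c)"
    "smooth_on (local_dom M d c) (\<lambda>u. nrm M d (coord_inv c u))"
  using hyp assms unfolding hypersurface_def by blast+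

lemma normal_facts:
  assumes "c \<in> hcharts M" "d \<in> charts (amb M)" "v \<in> local_dom M d c"
  shows "inj (ddir (local_rep M d c) v)"
    "metric (amb M) d (local_rep M d c v) (nrm M d (coord_inv c v)) (nrm M d (coord_inv c v)) = 1"
    "metric (amb M) d (local_rep M d c v) (nrm M d (coord_inv c v)) (ddir (local_rep M d c) v x) = 0"
  using hyp assms unfolding hypersurface_def Let_def by blast+

text \<open>The local representations in \<open>d\<close> and \<open>d'\<close> differ by the change
  of coordinates near \<open>v\<close>; the chain rule transports tangent vectors, and the
  transformation law in \<open>hypersurface\<close> the normal.\<close>

lemma transition_local_rep:
  assumes c: "c \<in> hcharts M" and d: "d \<in> charts (amb M)" and d': "d' \<in> charts (amb M)"
    and v: "v \<in> local_dom M d c" "v \<in> local_dom M d' c"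
  defines "p \<equiv> local_rep M d c v"
  defines "T \<equiv> ddir (transition d d') p"
  shows "p \<in> overlap d d'" "p \<in> coord_dom d" "transition d d' p = local_rep M d' c v"
    "ddir (local_rep M d' c) v x = T (ddir (local_rep M d c) v x)"
    "nrm M d' (coord_inv c v) = T (nrm M d (coord_inv c v))" "linear T"
proof -
  note D = local_domD [OF c]
  have rep: "transition d d' (local_rep M d c w) = local_rep M d' c w"
    if "w \<in> local_dom M d c" "w \<in> local_dom M d' c" for w
    using D(2,4) [OF that(1)] D(4) [OF that(2)] coord_inv_snd [OF amb_manifold d] by (simp add: transition_def)
  then show "transition d d' p = local_rep M d' c v"
    using v by (simp add: p_def)
  show "p \<in> coord_dom d"
    unfolding p_def D(4) [OF v(1)] using D(2) [OF v(1)] by blast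
  show p: "p \<in> overlap d d'"
    unfolding p_def D(4) [OF v(1)] using D(2) [OF v(1)] D(2) [OF v(2)] by blast
  have "smooth_on (overlap d d') (transition d d')"
    using amb_manifold d d' unfolding smooth_manifold_def by blast
  from smooth_on_has_derivative [OF this p]
  have T: "(transition d d' has_derivative T) (at p)"
    by (simp add: T_def)
  then show "linear T"
    using has_derivative_linear by blast
  have "((\<lambda>w. transition d d' (local_rep M d c w)) has_derivative (\<lambda>x. T (ddir (local_rep M d c) v x))) (at v)"
    using has_derivative_compose [OF smooth_on_has_derivative [OF local_rep_smooth(1) [OF c d] v(1)] T [unfolded p_def]] .
  then have "(local_rep M d' c has_derivative (\<lambda>x. T (ddir (local_rep M d c) v x))) (at v)"
    by (rule has_derivative_cong_open [where S = "local_dom M d c \<inter> local_dom M d' c"])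
      (use rep v open_local_dom [OF c d] open_local_dom [OF c d'] in auto)
  then show "ddir (local_rep M d' c) v x = T (ddir (local_rep M d c) v x)"
    by (rule ddir_eq)
  have "coord_inv c v \<in> topspace (htop M)" "imm M (coord_inv c v) \<in> fst d \<inter> fst d'"
    using D(1,2) [OF v(1)] D(2) [OF v(2)] chart_inj(2) [OF manifold c] by blast+
  then show "nrm M d' (coord_inv c v) = T (nrm M d (coord_inv c v))"
    using hyp d d' unfolding hypersurface_def T_def p_def D(4) [OF v(1)] by blast
qed

end

text \<open>The range lies in the hyperplane orthogonal to \<open>n\<close>, and both have dimension
  6.\<close>

lemma tangent_surj:
  fixes a :: "real ^ 6 \<Rightarrow> real ^ 7"
  assumes a: "linear a" "inj a" and n: "n \<noteq> 0" "\<And>x. n \<bullet> a x = 0" and q: "n \<bullet> q = 0"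
  obtains y where "a y = q"
proof -
  have "range a = {x. n \<bullet> x = 0}"
  proof (rule subspace_dim_equal)
    show "subspace (range a)"
      by (simp add: a(1) linear_subspace_image)
    show "subspace {x. n \<bullet> x = 0}"
      by (rule subspace_hyperplane)
    show "range a \<subseteq> {x. n \<bullet> x = 0}"
      using n(2) by blast
    have "dim (range a) = 6"
      using dim_image_eq [OF a(1), of UNIV] a(2) by (simp add: inj_on_def)
    then show "dim (range a) \<ge> dim {x. n \<bullet> x = 0}"
      using dim_hyperplane [OF n(1)] by simp
  qed
  moreover have "q \<in> {x. n \<bullet> x = 0}"
    using q by simp
  ultimately obtain y where "q = a y"
    by (metis rangeE)
  then show ?thesis
    using that by simp
qed

context immersed
begin

text \<open>Values of the induced tensors at \<open>v\<close>, read off in any ambient chart \<open>d\<close> and any Cayley frame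
  \<open>e\<close> there, so that they can be differentiated in a fixed chart.\<close>

lemma induced_tensors:
  assumes c: "c \<in> hcharts M" and d: "d \<in> charts (amb M)" and v: "v \<in> local_dom M d c"
    and e: "cayley_frame (metric (amb M) d (local_rep M d c v)) (phi (amb M) d (local_rep M d c v)) e"
  defines "C \<equiv> comps (metric (amb M) d (local_rep M d c v)) e"
  defines "a \<equiv> (\<lambda>x. C (ddir (local_rep M d c) v x))" and "n \<equiv> C (nrm M d (coord_inv c v))"
  shows "linear a" "inj a" "n \<bullet> n = 1" "n \<bullet> a x = 0" "hmetric M c v x y = a x \<bullet> a y"
    "pull_phi M c v x y z = phi0 (a x) (a y) (a z)"
    "pull_n_star M c v x y z = star_phi0 n (a x) (a y) (a z)"
    "a (act_I M c v x) = cross0 n (a x)"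
proof -
  define p where "p = local_rep M d c v"
  define G where "G = metric (amb M) d p"
  define d' where "d' = amb_chart M c v"
  define p' where "p' = local_rep M d' c v"
  define G' where "G' = metric (amb M) d' p'"
  define T where "T = ddir (transition d d') p"
  have v': "v \<in> coord_dom c"
    by (rule local_domD [OF c v])
  have d': "d' \<in> charts (amb M)" "v \<in> local_dom M d' c"
    unfolding d'_def using amb_chart [OF c v'] by blast+
  note tr = transition_local_rep [OF c d d'(1) v d'(2), folded p_def, folded T_def p'_def]
  note e = e [folded p_def, folded G_def]
  have C: "C = comps G e"
    by (simp add: C_def G_def p_def)
  have o: "orthonormal G e"
    using e by (simp add: cayley_frame_def)
  have G: "inner_form G"
    unfolding G_def by (rule riemannian_inner_form [OF amb_riemannian d tr(2)])
  have "p' \<in> coord_dom d'"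
    by (rule transition_local_rep(2) [OF c d'(1) d'(1) d'(2) d'(2), folded p'_def])
  then have G': "inner_form G'"
    unfolding G'_def by (rule riemannian_inner_form [OF amb_riemannian d'(1)])
  have GT: "G' (T x) (T y) = G x y" for x y
    using amb_riemannian d d'(1) tr(1) unfolding riemannian_manifold_def G'_def G_def T_def tr(3) [symmetric] by metis
  have phiT: "phi (amb M) d' p' (T x) (T y) (T z) = phi (amb M) d p x y z" for x y z
    using amb d d'(1) tr(1) unfolding g2_manifold_def T_def tr(3) [symmetric] by metis
  have T: "surj T"
    by (rule bij_of_isometry [OF G tr(6) GT inner_form_bilinear [OF G']])
  \<comment> \<open>The frame is carried by the isometry \<open>T\<close> to the chart that
    \<open>amb_chart\<close> happens to choose; components there agree with components in
    \<open>d\<close>, so the choice disappears.\<close>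
  define C' where "C' = comps G' (\<lambda>i. T (e i))"
  have C'T: "C' (T x) = C x" for x
    by (simp add: C'_def C vec_eq_iff GT)
  have o': "orthonormal G' (\<lambda>i. T (e i))"
    using o by (simp add: orthonormal_def GT)
  have "cayley_frame G' (phi (amb M) d' p') (\<lambda>i. T (e i))"
    unfolding cayley_frame_def
  proof (intro conjI o' allI)
    fix x y z
    obtain x0 y0 z0 where xyz: "x = T x0" "y = T y0" "z = T z0"
      using T by (metis surjD)
    show "phi (amb M) d' p' x y z = (\<Sum>i\<in>UNIV. wedge3 (G' (T (e i))) (G' (T (e (i + 1)))) (G' (T (e (i + 3)))) x y z)"
      using e unfolding cayley_frame_def xyz phiT by (simp add: wedge3_def wedge2_def GT)
  qed
  note e' = this
  have push: "push M c v x = T (ddir (local_rep M d c) v x)" for x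
    unfolding push_def using tr(4) by (simp add: d'_def)
  have C'push: "C' (push M c v x) = a x" for x
    by (simp add: push C'T a_def)
  have C'n: "C' (normal M c v) = n"
    by (simp add: normal_def tr(5) C'T n_def flip: d'_def)
  have der: "linear (ddir (local_rep M d c) v)"
    using has_derivative_linear [OF smooth_on_has_derivative [OF local_rep_smooth(1) [OF c d] v]] .
  then show a_lin: "linear a"
    unfolding a_def C using linear_compose [OF der linear_comps [OF G]] by (simp add: o_def)
  show a_inj: "inj a"
    unfolding a_def C
    using normal_facts(1) [OF c d v] comps_eq_iff [OF G o] by (simp add: inj_def)
  show nn: "n \<bullet> n = 1"
    using normal_facts(2) [OF c d v] by (simp add: n_def C comps_inner [OF G o] flip: p_def G_def)
  show na: "n \<bullet> a x = 0" for x
    using normal_facts(3) [OF c d v] by (simp add: n_def a_def C comps_inner [OF G o] flip: p_def G_def)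
  show "hmetric M c v x y = a x \<bullet> a y"
    by (simp add: induced_def along_def C'_def comps_inner [OF G' o'] flip: C'push d'_def p'_def G'_def)
  show "pull_phi M c v x y z = phi0 (a x) (a y) (a z)"
    by (simp add: pull_phi_def along_def cayley_frame_phi [OF e'] flip: C'push d'_def p'_def C'_def)
  show "pull_n_star M c v x y z = star_phi0 n (a x) (a y) (a z)"
    using star_phi_comps [of "amb M" d' p' "\<lambda>i. T (e i)"] G' e'
    by (simp add: pull_n_star_def along_def flip: C'push C'n d'_def p'_def C'_def G'_def)
  have C'cross: "C' (along M c v (cross (amb M)) (normal M c v) (push M c v x)) = cross0 n (a x)" for x
    using cross_comps [of "amb M" d' p' "\<lambda>i. T (e i)"] G' e'
    by (simp add: along_def flip: C'push C'n d'_def p'_def C'_def G'_def)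
  have act: "push M c v y = along M c v (cross (amb M)) (normal M c v) (push M c v x) \<longleftrightarrow> a y = cross0 n (a x)" for x y
    using comps_eq_iff [OF G' o'] C'cross C'push by (metis C'_def)
  \<comment> \<open>A product with the normal is tangent; this gives existence for the
    \<open>THE\<close> in \<open>act_I\<close>, and injectivity of \<open>a\<close> gives
    uniqueness.\<close>
  have "n \<bullet> cross0 n (a x) = 0" "n \<noteq> 0"
    using nn by (auto simp: inner_cross0)
  then obtain y where y: "a y = cross0 n (a x)"
    using tangent_surj [OF a_lin a_inj _ na] by metis
  have "act_I M c v x = y"
    unfolding act_I_def act using a_inj y by (intro the_equality) (auto simp: inj_def)
  with y show "a (act_I M c v x) = cross0 n (a x)"
    by simp
qed

end

section \<open>Moving frames along the hypersurface\<close>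

text \<open>\<open>a v\<close> and \<open>n v\<close> are the components, in a Cayley frame along the immersion, of the
  differential of the immersion and of the normal; \<open>A\<close> is the ambient connection in that frame,
  \<open>II x y\<close> has the components of \<open>\<nabla>\<^sub>x y\<close> and \<open>b\<close> those of \<open>r(\<phi>)\<close>.\<close>

locale moving_frame =
  fixes M :: "('a, 'b) hypersurf" and c :: "('a, 6) chart" and u :: "real ^ 6" and V :: "(real ^ 6) set"
    and a :: "real ^ 6 \<Rightarrow> real ^ 6 \<Rightarrow> real ^ 7" and n :: "real ^ 6 \<Rightarrow> real ^ 7"
    and A :: "real ^ 6 \<Rightarrow> real ^ 7 \<Rightarrow> real ^ 7" and II :: "real ^ 6 \<Rightarrow> real ^ 6 \<Rightarrow> real ^ 7"
    and N :: "real ^ 6 \<Rightarrow> real ^ 7" and b :: "real ^ 7 \<Rightarrow> real ^ 7 \<Rightarrow> real"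
  assumes V: "open V" "u \<in> V"
    and a_lin: "v \<in> V \<Longrightarrow> linear (a v)" and a_inj: "v \<in> V \<Longrightarrow> inj (a v)"
    and nn: "v \<in> V \<Longrightarrow> n v \<bullet> n v = 1" and na: "v \<in> V \<Longrightarrow> n v \<bullet> a v x = 0"
    and hmetric: "v \<in> V \<Longrightarrow> hmetric M c v x y = a v x \<bullet> a v y"
    and pull_phi: "v \<in> V \<Longrightarrow> pull_phi M c v x y z = phi0 (a v x) (a v y) (a v z)"
    and pull_n_star: "v \<in> V \<Longrightarrow> pull_n_star M c v x y z = star_phi0 (n v) (a v x) (a v y) (a v z)"
    and act_I: "v \<in> V \<Longrightarrow> a v (act_I M c v x) = cross0 (n v) (a v x)"
    and a_der: "((\<lambda>v. a v y) has_derivative (\<lambda>x. A x (a u y) + II x y)) (at u)"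
    and n_der: "(n has_derivative (\<lambda>x. A x (n u) + N x)) (at u)"
    and A_lin: "linear (A x)" and A_skew: "A x p \<bullet> q = - (p \<bullet> A x q)"
    and II: "bilinear II" and II_sym: "II x y = II y x"
    and second_ff: "second_ff M c u x y = II x y \<bullet> n u"
    and b: "bilinear b" and b_skew: "b p q = - b q p" and b_a: "b (a u x) q = torsion_vec (A x) \<bullet> q"
    and b_phi0: "(\<Sum>j\<in>UNIV. \<Sum>k\<in>UNIV. phi0 (axis i 1) (axis j 1) (axis k 1) * b (axis j 1) (axis k 1)) = 0"
    and rbar_tt: "rbar_tt M c u x y = torsion_vec (A x) \<bullet> a u y"
    and rbar_tn: "rbar_tn M c u x = torsion_vec (A x) \<bullet> n u"

lemma (in immersed) moving_frame_exists:
  assumes X2: "type_X2 (amb M)" and c: "c \<in> hcharts M" and u: "u \<in> coord_dom c"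
  obtains V a n A II N b where "moving_frame M c u V a n A II N b"
proof -
  define d where "d = amb_chart M c u"
  define F where "F = local_rep M d c"
  define p where "p = F u"
  define G where "G v = metric (amb M) d v" for v
  have d: "d \<in> charts (amb M)" and u_dom: "u \<in> local_dom M d c"
    unfolding d_def using amb_chart [OF c u] by blast+
  have p: "p \<in> coord_dom d"
    unfolding p_def F_def by (rule transition_local_rep(2) [OF c d d u_dom u_dom])
  obtain W e where W: "open W" "p \<in> W" "W \<subseteq> coord_dom d" and e: "\<And>i. smooth_on W (\<lambda>v. e v i)"
    and cayley: "\<And>v. v \<in> W \<Longrightarrow> cayley_frame (G v) (phi (amb M) d v) (e v)"
    using amb d p unfolding g2_manifold_def G_def by metis
  define C where "C v = comps (G v) (e v)" for v
  define \<Gamma> where "\<Gamma> = levi_civita (amb M) d p"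
  have G: "inner_form (G v)" if "v \<in> W" for v
    unfolding G_def using riemannian_inner_form [OF amb_riemannian d] that W(3) by blast
  have o: "orthonormal (G v) (e v)" if "v \<in> W" for v
    using cayley [OF that] by (simp add: cayley_frame_def)
  obtain A where "is_levi_civita (metric (amb M) d) p (levi_civita (amb M) d p)"
    and A: "\<And>w. linear (A w)" "\<And>w q r. A w q \<bullet> r = - (q \<bullet> A w r)"
    and "\<And>Y. ((\<lambda>v. comps (metric (amb M) d v) (e v) Y) has_derivative
      (\<lambda>w. A w (comps (metric (amb M) d p) (e p) Y)
        + comps (metric (amb M) d p) (e p) (levi_civita (amb M) d p w Y))) (at p)"
    by (rule cayley_structure_equation [OF amb_riemannian d W e cayley [unfolded G_def]];
        (assumption | (rule that; assumption)))
  then have lc: "is_levi_civita (metric (amb M) d) p \<Gamma>"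
    and der: "\<And>Y. ((\<lambda>v. C v Y) has_derivative (\<lambda>w. A w (C p Y) + C p (\<Gamma> w Y))) (at p)"
    by (simp_all add: C_def G_def \<Gamma>_def)
  have rbar: "rbar (amb M) d p x y = torsion_vec (A x) \<bullet> C p y" for x y
    using rbar_comps [OF amb_riemannian d W cayley [unfolded G_def] A der [unfolded C_def G_def \<Gamma>_def]]
    by (simp add: C_def G_def)
  define V where "V = local_dom M d c \<inter> F -` W"
  have smooth: "smooth_on (local_dom M d c) F" "smooth_on (local_dom M d c) (\<lambda>u. nrm M d (coord_inv c u))"
    unfolding F_def using local_rep_smooth [OF c d] .
  have "open V"
    unfolding V_def using open_local_dom [OF c d] W(1) smooth_on_continuous [OF smooth(1)]
    by (intro continuous_open_preimage)
  have "u \<in> V"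
    using u_dom W(2) by (simp add: V_def p_def)
  have V: "v \<in> local_dom M d c" "F v \<in> W" if "v \<in> V" for v
    using that by (auto simp: V_def)
  note F_der = smooth_on_has_derivative [OF smooth(1)]
  have C_lin: "linear (C v)" if "v \<in> W" for v
    unfolding C_def by (rule linear_comps [OF G [OF that]])
  note Cp = C_lin [OF W(2)]
  have bil_\<Gamma>: "bilinear \<Gamma>" and sym_\<Gamma>: "\<Gamma> x y = \<Gamma> y x" for x y
    using lc unfolding is_levi_civita_def by blast+
  \<comment> \<open>The structure equation \<open>der\<close> covers constant vectors only, so a
    varying \<open>Y\<close> is expanded in the standard basis. The result is the connection matrix
    plus the components of the covariant derivative of \<open>Y\<close> along the immersion.\<close>
  have field: "((\<lambda>v. C (F v) (Y v)) has_derivative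
      (\<lambda>x. A (ddir F u x) (C p (Y u)) + C p (\<Gamma> (ddir F u x) (Y u) + Y' x))) (at u)"
    if Y: "(Y has_derivative Y') (at u)" for Y Y'
  proof -
    have ax: "((\<lambda>v. C (F v) (axis k 1)) has_derivative
       (\<lambda>x. A (ddir F u x) (C p (axis k 1)) + C p (\<Gamma> (ddir F u x) (axis k 1)))) (at u)" for k
      using has_derivative_compose [OF F_der [OF u_dom] der [unfolded p_def]] by (simp add: p_def)
    have Yk: "((\<lambda>v. Y v $ k) has_derivative (\<lambda>x. Y' x $ k)) (at u)" for k
      using bounded_linear.has_derivative [OF bounded_linear_vec_nth Y] .
    have ex: "f q = (\<Sum>k\<in>UNIV. q $ k *\<^sub>R f (axis k 1))" if "linear f" for f :: "real ^ 7 \<Rightarrow> real ^ 7" and q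
    proof -
      have "f q = f (\<Sum>k\<in>UNIV. q $ k *\<^sub>R axis k 1)"
        by (simp add: basis_expansion flip: scalar_mult_eq_scaleR)
      then show ?thesis
        by (simp add: linear_sum [OF that] linear_scale [OF that])
    qed
    have "((\<lambda>v. \<Sum>k\<in>UNIV. Y v $ k *\<^sub>R C (F v) (axis k 1)) has_derivative
       (\<lambda>x. \<Sum>k\<in>UNIV. Y u $ k *\<^sub>R (A (ddir F u x) (C p (axis k 1)) + C p (\<Gamma> (ddir F u x) (axis k 1)))
         + Y' x $ k *\<^sub>R C (F u) (axis k 1))) (at u)"
      by (intro has_derivative_sum has_derivative_scaleR Yk ax)
    then have 1: "((\<lambda>v. C (F v) (Y v)) has_derivative
       (\<lambda>x. \<Sum>k\<in>UNIV. Y u $ k *\<^sub>R (A (ddir F u x) (C p (axis k 1)) + C p (\<Gamma> (ddir F u x) (axis k 1)))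
         + Y' x $ k *\<^sub>R C (F u) (axis k 1))) (at u)"
      by (rule has_derivative_cong_open [OF _ \<open>open V\<close> \<open>u \<in> V\<close>]) (simp flip: ex [OF C_lin [OF V(2)]])
    have l: "linear (\<lambda>q. A w (C p q))" "linear (\<lambda>q. C p (\<Gamma> w q))" for w
      using linear_compose [OF Cp A(1)] linear_compose [OF _ Cp, of "\<Gamma> w"] bil_\<Gamma>
      by (simp_all add: o_def bilinear_def)
    show ?thesis
      by (rule has_derivative_eq_rhs [OF 1])
        (simp add: fun_eq_iff linear_add [OF Cp] ex [OF l(1), of _ "Y u"] ex [OF l(2), of _ "Y u"]
          ex [OF Cp, of "Y' _"] scaleR_add_right sum.distrib flip: p_def)
  qed
  define S where "S x y = \<Gamma> (ddir F u x) (ddir F u y) + ddir (\<lambda>v. ddir F v y) u x" for x y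
  define N where "N x = C p (\<Gamma> (ddir F u x) (nrm M d (coord_inv c u)) + ddir (\<lambda>v. nrm M d (coord_inv c v)) u x)" for x
  define E where "E q = (\<Sum>i\<in>UNIV. q $ i *\<^sub>R e p i)" for q
  note Gp = G [OF W(2)] and op = o [OF W(2)]
  have CE: "C p (E q) = q" for q
    unfolding C_def E_def by (rule comps_surj [OF Gp op])
  have EC: "E (C p w) = w" for w
    unfolding C_def E_def using orthonormal_expand [OF Gp op] by simp
  \<comment> \<open>Transported to all of \<real>^7: the sums in the g_2 condition also run over
    directions outside the image of the differential.\<close>
  define b where "b q r = rbar (amb M) d p (E q) (E r)" for q r
  have b: "b q r = torsion_vec (A (E q)) \<bullet> r" for q r
    by (simp add: b_def rbar CE)
  have b_skew: "b q r = - b r q" for q r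
    unfolding b_def using X2 d p unfolding type_X2_def by blast
  have b_lin: "linear (b q)" for q
    unfolding b [abs_def] by (simp add: linear_iff inner_simps)
  have "linear (\<lambda>q. b q r)" for r
    using linear_compose_neg [OF b_lin [of r]] by (simp add: b_skew [of _ r])
  with b_lin have b_bil: "bilinear b"
    by (simp add: bilinear_def)
  have F_lin: "linear (ddir F u)"
    using has_derivative_linear [OF F_der [OF u_dom]] .
  have F2_lin: "linear (ddir (\<lambda>v. ddir F v y) u)" for y
    using has_derivative_linear [OF smooth_on_has_derivative [OF smooth_on_ddir [OF smooth(1)] u_dom]] .
  have S_sym: "S x y = S y x" for x y
    unfolding S_def using sym_\<Gamma> ddir_commute [OF open_local_dom [OF c d] u_dom smooth(1)] by metis
  have S_lin: "linear (\<lambda>x. C p (S x y))" for y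
    unfolding S_def
    by (simp add: linear_iff linear_add [OF Cp] linear_scale [OF Cp] linear_add [OF F_lin] linear_scale [OF F_lin]
      linear_add [OF F2_lin] linear_scale [OF F2_lin] bilinear_ladd [OF bil_\<Gamma>] bilinear_lmul [OF bil_\<Gamma>]
      scaleR_add_right)
  have S_lin2: "linear (\<lambda>y. C p (S x y))" for x
  proof -
    have "(\<lambda>y. C p (S x y)) = (\<lambda>y. C p (S y x))"
      by (rule ext) (rule arg_cong [OF S_sym])
    then show ?thesis
      using S_lin [of x] by simp
  qed
  have push: "push M c u = ddir F u" "normal M c u = nrm M d (coord_inv c u)"
    by (simp_all add: push_def normal_def F_def d_def)
  have along: "along M c u T = T d p" for T :: "('b, 7) chart \<Rightarrow> real ^ 7 \<Rightarrow> 't"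
    by (simp add: along_def p_def F_def d_def)
  define a where "a v x = C (F v) (ddir F v x)" for v x
  define n where "n v = C (F v) (nrm M d (coord_inv c v))" for v
  have tensors: "linear (a v)" "inj (a v)" "n v \<bullet> n v = 1" "n v \<bullet> a v x = 0" "hmetric M c v x y = a v x \<bullet> a v y"
    "pull_phi M c v x y z = phi0 (a v x) (a v y) (a v z)"
    "pull_n_star M c v x y z = star_phi0 (n v) (a v x) (a v y) (a v z)"
    "a v (act_I M c v x) = cross0 (n v) (a v x)" if "v \<in> V" for v x y z
    using induced_tensors [OF c d V(1) [OF that] cayley [OF V(2) [OF that], unfolded G_def F_def]]
    unfolding a_def [abs_def] n_def C_def G_def F_def by blast+
  have "moving_frame M c u V a n (\<lambda>x. A (ddir F u x)) (\<lambda>x y. C p (S x y)) N b"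
  proof (rule moving_frame.intro)
    show "open V" "u \<in> V" by fact+
    show "((\<lambda>v. a v y) has_derivative (\<lambda>x. A (ddir F u x) (a u y) + C p (S x y))) (at u)" for y
      unfolding a_def S_def using field [OF smooth_on_has_derivative [OF smooth_on_ddir [OF smooth(1)] u_dom]]
      by (simp add: p_def)
    show "(n has_derivative (\<lambda>x. A (ddir F u x) (n u) + N x)) (at u)"
      unfolding n_def [abs_def] N_def using field [OF smooth_on_has_derivative [OF smooth(2) u_dom]]
      by (simp add: p_def)
    show "bilinear (\<lambda>x y. C p (S x y))"
      unfolding bilinear_def using S_lin S_lin2 by blast
    show "C p (S x y) = C p (S y x)" for x y
      by (rule arg_cong [OF S_sym])
    show "second_ff M c u x y = C p (S x y) \<bullet> n u" for x y
      unfolding second_ff_def Let_def along push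
      by (simp add: n_def S_def C_def comps_inner [OF Gp op, unfolded G_def] add.commute G_def \<Gamma>_def
          flip: p_def F_def d_def)
    show "b (a u x) q = torsion_vec (A (ddir F u x)) \<bullet> q" for x q
      by (simp add: b a_def EC flip: p_def)
    show "rbar_tt M c u x y = torsion_vec (A (ddir F u x)) \<bullet> a u y" for x y
      unfolding rbar_tt_def along push by (simp add: rbar a_def flip: p_def)
    show "rbar_tn M c u x = torsion_vec (A (ddir F u x)) \<bullet> n u" for x
      unfolding rbar_tn_def along push by (simp add: rbar n_def flip: p_def)
    show "(\<Sum>j\<in>UNIV. \<Sum>k\<in>UNIV. phi0 (axis i 1) (axis j 1) (axis k 1) * b (axis j 1) (axis k 1)) = 0" for i
    proof -
      have Ee: "E (axis j 1) = e p j" for j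
        using EC [of "e p j"] by (simp add: C_def comps_frame [OF op])
      have phi: "phi (amb M) d p (e p i) (e p j) (e p k) = phi0 (axis i 1) (axis j 1) (axis k 1)" for i j k
        by (simp add: cayley_frame_phi [OF cayley [OF W(2)]] comps_frame [OF op])
      have "(\<Sum>j\<in>UNIV. \<Sum>k\<in>UNIV. phi (amb M) d p (e p i) (e p j) (e p k) * rbar (amb M) d p (e p j) (e p k)) = 0"
        using X2 d p cayley [OF W(2)] unfolding type_X2_def G_def by blast
      then show ?thesis
        unfolding b_def Ee phi .
    qed
    show "b q r = - b r q" for q r
      by (rule b_skew)
    show "A (ddir F u x) q \<bullet> r = - (q \<bullet> A (ddir F u x) r)" for x q r
      by (rule A(2))
  qed (simp_all only: tensors A(1) b_bil)
  then show ?thesis by (rule that)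
qed

section \<open>The Gauss and Weingarten formulas\<close>

context moving_frame
begin

abbreviation J where "J \<equiv> act_I M c u"
abbreviation h where "h \<equiv> hmetric M c u"
abbreviation psi where "psi \<equiv> pull_phi M c u"
abbreviation frame where "frame \<equiv> some_frame (hmetric M c u)"
abbreviation B where "B \<equiv> second_ff M c u"

lemmas at_u = a_lin [OF V(2)] a_inj [OF V(2)] nn [OF V(2)] na [OF V(2)]

lemmas h_a = hmetric [OF V(2)]
lemmas psi_a = pull_phi [OF V(2)]
lemmas J_a = act_I [OF V(2)]

lemma a_simps [simp]:
  "a u (x + y) = a u x + a u y" "a u (x - y) = a u x - a u y" "a u (r *\<^sub>R x) = r *\<^sub>R a u x"
  "a u (- x) = - a u x" "a u 0 = 0" "n u \<bullet> n u = 1" "n u \<bullet> a u x = 0" "a u x \<bullet> n u = 0"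
  using at_u by (simp_all add: linear_add linear_diff linear_scale linear_neg linear_0 inner_commute)

lemma inner_form_h: "v \<in> V \<Longrightarrow> inner_form (hmetric M c v)"
proof -
  assume v: "v \<in> V"
  note l = a_lin [OF v]
  have "a v x \<noteq> 0" if "x \<noteq> 0" for x
    using a_inj [OF v] that linear_injective_0 [OF l] by blast
  then show ?thesis
    unfolding inner_form_def hmetric [OF v]
    by (simp add: bilinear_def linear_iff hmetric [OF v] linear_add [OF l] linear_scale [OF l] inner_simps inner_commute)
qed

lemma frame: "orthonormal h frame"
  using isometry_frame [OF at_u(1) inner_form_h [OF V(2)] h_a [symmetric]] orthonormal_some_frame by metis

lemma a_eqI: "a u x = a u y \<Longrightarrow> x = y"
  using at_u(2) by (simp add: inj_def)

lemma tangent: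
  assumes "n u \<bullet> q = 0"
  obtains y where "a u y = q"
proof -
  have "n u \<noteq> 0"
    by (metis at_u(3) inner_zero_left zero_neq_one)
  then show ?thesis
    using tangent_surj [OF at_u(1,2) _ at_u(4) assms] that by blast
qed

text \<open>The images of the frame together with the normal behave as an orthonormal basis: any
  vector is its normal component plus a tangent vector expanded in \<open>frame\<close>.\<close>

lemma tangent_trace:
  assumes G: "bilinear (G :: real ^ 7 \<Rightarrow> real ^ 7 \<Rightarrow> real)"
  shows "(\<Sum>j\<in>UNIV. G (axis j 1) (axis j 1)) = (\<Sum>i\<in>UNIV. G (a u (frame i)) (a u (frame i))) + G (n u) (n u)"
proof -
  have l: "linear (G x)" "linear (\<lambda>x. G x y)" for x y
    using G by (simp_all add: bilinear_def)
  have split: "G x q = (\<Sum>i\<in>UNIV. (q \<bullet> a u (frame i)) * G x (a u (frame i))) + (q \<bullet> n u) * G x (n u)" for x q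
  proof -
    define t where "t = q - (q \<bullet> n u) *\<^sub>R n u"
    obtain y where y: "a u y = t"
      using tangent [of t] by (auto simp: t_def inner_simps inner_commute)
    have "linear (\<lambda>y. G x (a u y))"
      using linear_compose [OF at_u(1) l(1)] by (simp add: o_def)
    from frame_expand [OF inner_form_h [OF V(2)] frame this, of y]
    have "G x t = (\<Sum>i\<in>UNIV. (t \<bullet> a u (frame i)) * G x (a u (frame i)))"
      by (simp add: h_a y inner_commute)
    moreover have "t \<bullet> a u (frame i) = q \<bullet> a u (frame i)" for i
      by (simp add: t_def inner_simps)
    moreover have "G x q = G x t + (q \<bullet> n u) * G x (n u)"
      by (simp add: t_def linear_diff [OF l(1)] linear_scale [OF l(1)])
    ultimately show ?thesis by simp
  qed
  have "(\<Sum>j\<in>UNIV. G (axis j 1) (axis j 1)) = (\<Sum>j\<in>UNIV. (\<Sum>i\<in>UNIV. (a u (frame i) \<bullet> axis j 1) * G (axis j 1) (a u (frame i)))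
      + (n u \<bullet> axis j 1) * G (axis j 1) (n u))"
    by (subst split) (simp add: inner_commute)
  also have "\<dots> = (\<Sum>i\<in>UNIV. \<Sum>j\<in>UNIV. (a u (frame i) \<bullet> axis j 1) * G (axis j 1) (a u (frame i)))
      + (\<Sum>j\<in>UNIV. (n u \<bullet> axis j 1) * G (axis j 1) (n u))"
    by (subst sum.swap) (simp add: sum.distrib)
  also have "\<dots> = (\<Sum>i\<in>UNIV. G (a u (frame i)) (a u (frame i))) + G (n u) (n u)"
    by (simp add: sum_axis_linear [OF l(2)])
  finally show ?thesis .
qed

lemma tangent_parseval:
  "(\<Sum>k\<in>UNIV. (p \<bullet> a u (frame k)) * (q \<bullet> a u (frame k))) = p \<bullet> q - (p \<bullet> n u) * (q \<bullet> n u)"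
proof -
  have "bilinear (\<lambda>x y. (p \<bullet> x) * (q \<bullet> y))"
    by (simp add: bilinear_def linear_iff inner_simps algebra_simps)
  from tangent_trace [OF this] show ?thesis
    by (simp add: sum_axis)
qed

lemma phi0_n: "phi0 (n u) (a u x) (a u y) = - h x (J y)"
  by (simp add: h_a J_a inner_cross0 phi0_swap(1) [of "n u"] phi0_swap(2) [of "n u"] phi0_cyc)

lemma su3: "su3 h J psi frame"
proof
  note lin = a_lin [OF V(2)]
  show "inner_form h" "orthonormal h frame"
    using inner_form_h [OF V(2)] frame by blast+
  show "J (x + y) = J x + J y" for x y
    by (rule a_eqI) (simp add: J_a cross0.add_right)
  show "J (r *\<^sub>R x) = r *\<^sub>R J x" for r x
    by (rule a_eqI) (simp add: J_a cross0.scaleR_right)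
  show "J (J x) = - x" for x
    by (rule a_eqI) (simp add: J_a cross0_square)
  show "h (J x) y = - h x (J y)" for x y
    by (simp add: h_a J_a cross0_skew)
  show "trilinear psi"
    by (simp add: trilinear_def linear_iff psi_a)
  show "alternating3 psi"
    unfolding alternating3_def psi_a using phi0_swap by (metis minus_minus)
  show "psi (J x) y z = psi x (J y) z" for x y z
    by (simp add: psi_a J_a phi0_cross0_slide)
  show "(\<Sum>k\<in>UNIV. psi x y (frame k) * psi z w (frame k)) = h x z * h y w - h x w * h y z
      - h x (J z) * h y (J w) + h x (J w) * h y (J z)" for x y z w
  proof -
    have "(\<Sum>k\<in>UNIV. psi x y (frame k) * psi z w (frame k))
        = (\<Sum>k\<in>UNIV. (cross0 (a u x) (a u y) \<bullet> a u (frame k)) * (cross0 (a u z) (a u w) \<bullet> a u (frame k)))"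
      by (simp add: psi_a cross0_inner)
    \<comment> \<open>Summing over a tangent frame loses the normal component of each product. The
      term subtracted for it cancels against the first term of
      \<open>star_phi0_tangent\<close>.\<close>
    also have "\<dots> = cross0 (a u x) (a u y) \<bullet> cross0 (a u z) (a u w)
        - phi0 (n u) (a u x) (a u y) * phi0 (n u) (a u z) (a u w)"
      unfolding tangent_parseval by (simp add: cross0_inner phi0_cyc)
    also have "\<dots> = h x z * h y w - h x w * h y z
       - phi0 (n u) (a u x) (a u z) * phi0 (n u) (a u y) (a u w)
       + phi0 (n u) (a u x) (a u w) * phi0 (n u) (a u y) (a u z)"
      by (simp add: cross0_inner_cross0 star_phi0_tangent [of "n u"] h_a)
    finally show ?thesis
      by (simp add: phi0_n)
  qed
qed

sublocale su3 h J psi frame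
  by (rule su3)

lemma B_sym: "B x y = B y x"
  by (simp add: second_ff II_sym [of x])

lemma bilinear_B: "bilinear B"
  using II by (simp add: bilinear_def linear_iff second_ff inner_simps)

lemma rtt: "rbar_tt M c u x y = b (a u x) (a u y)"
  by (simp add: rbar_tt b_a)

lemma rtn: "rbar_tn M c u x = b (a u x) (n u)"
  by (simp add: rbar_tn b_a)

lemma rtt_skew: "rbar_tt M c u x y = - rbar_tt M c u y x"
  unfolding rtt by (rule b_skew)

lemma bilinear_rtt: "bilinear (rbar_tt M c u)"
  using b by (simp add: bilinear_def linear_iff rtt)

lemma b_simps [simp]:
  "b (x + x') y = b x y + b x' y" "b x (y + y') = b x y + b x y'"
  "b (r *\<^sub>R x) y = r * b x y" "b x (r *\<^sub>R y) = r * b x y" "b x x = 0" "b (- x) y = - b x y" "b x (- y) = - b x y"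
  using b_skew [of x x] by (simp_all add: bilinear_ladd [OF b] bilinear_radd [OF b] bilinear_lmul [OF b] bilinear_rmul [OF b]
    bilinear_lneg [OF b] bilinear_rneg [OF b])

lemma operator_exists:
  assumes "bilinear G"
  obtains R where "linear R" "\<And>x y. h (R x) y = G x y"
proof -
  have "\<exists>w. \<forall>y. h w y = G x y" for x
    using frame_riesz [OF inner_form_h [OF V(2)] frame, of "G x"] assms unfolding bilinear_def by metis
  then obtain R where R: "\<And>x y. h (R x) y = G x y"
    by metis
  have "linear R"
    by (rule linearI; rule inner_form_eqI [OF inner_form_h [OF V(2)]])
      (simp_all add: R bilinear_ladd [OF assms] bilinear_lmul [OF assms])
  then show ?thesis using R by (rule that)
qed

lemma has_derivative_h:
  "((\<lambda>v. hmetric M c v y z) has_derivative (\<lambda>x. II x y \<bullet> a u z + a u y \<bullet> II x z)) (at u)"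
proof (rule has_derivative_cong_open [OF _ V])
  show "((\<lambda>v. a v y \<bullet> a v z) has_derivative (\<lambda>x. II x y \<bullet> a u z + a u y \<bullet> II x z)) (at u)"
  proof (rule has_derivative_eq_rhs [OF has_derivative_inner [OF a_der a_der]], rule ext)
    fix x
    show "a u y \<bullet> (A x (a u z) + II x z) + (A x (a u y) + II x y) \<bullet> a u z
        = II x y \<bullet> a u z + a u y \<bullet> II x z"
      using A_skew [of x "a u y" "a u z"] by (simp add: inner_simps)
  qed
qed (simp add: hmetric)

text \<open>The tangential part of \<open>II\<close> is torsion-free since \<open>II\<close> is
  symmetric, and metric since the skew matrix \<open>A\<close> drops out of the derivative of the
  induced metric. Uniqueness identifies it with \<open>hconn\<close>.\<close>

lemma gauss_formula: "II x y = a u (hconn M c u x y) + B x y *\<^sub>R n u"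
  and levi_civita_hconn: "is_levi_civita (hmetric M c) u (hconn M c u)"
proof -
  have "\<exists>g. a u g = II x y - B x y *\<^sub>R n u" for x y
    using tangent [of "II x y - B x y *\<^sub>R n u"] by (metis (no_types, lifting) a_simps(6) diff_self inner_commute inner_diff_right inner_scaleR_right mult.right_neutral second_ff)
  then obtain \<Gamma> where \<Gamma>: "\<And>x y. a u (\<Gamma> x y) = II x y - B x y *\<^sub>R n u"
    by metis
  have "bilinear \<Gamma>"
    unfolding bilinear_def
    by (intro conjI allI linearI; rule a_eqI)
      (simp_all add: \<Gamma> bilinear_ladd [OF II] bilinear_radd [OF II] bilinear_lmul [OF II] bilinear_rmul [OF II]
        bilinear_ladd [OF bilinear_B] bilinear_radd [OF bilinear_B] bilinear_lmul [OF bilinear_B] bilinear_rmul [OF bilinear_B]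
        algebra_simps)
  moreover have "\<Gamma> x y = \<Gamma> y x" for x y
    by (rule a_eqI) (simp add: \<Gamma> II_sym [of x] B_sym [of x])
  moreover have "ddir (\<lambda>v. hmetric M c v y z) u x = h (\<Gamma> x y) z + h y (\<Gamma> x z)" for x y z
    unfolding ddir_eq [OF has_derivative_h] by (simp add: h_a \<Gamma> inner_simps)
  ultimately have lc: "is_levi_civita (hmetric M c) u \<Gamma>"
    unfolding is_levi_civita_def by blast
  then have "hconn M c u = \<Gamma>"
    using levi_civita_eq [of "induced M" c u \<Gamma>] inner_form_h [OF V(2)] by blast
  with lc \<Gamma> show "II x y = a u (hconn M c u x y) + B x y *\<^sub>R n u" 
    "is_levi_civita (hmetric M c) u (hconn M c u)"
    by simp_all
qed

text \<open>Differentiate \<open>n v \<bullet> n v = 1\<close> and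
  \<open>n v \<bullet> a v y = 0\<close>; skewness of \<open>A\<close> removes the connection
  terms.\<close>

lemma weingarten_formula:
  assumes S: "\<And>x y. h (S x) y = B x y"
  shows "N x = - a u (S x)"
proof -
  have "((\<lambda>v. n v \<bullet> n v) has_derivative (\<lambda>x. n u \<bullet> (A x (n u) + N x) + (A x (n u) + N x) \<bullet> n u)) (at u)"
    by (rule has_derivative_inner [OF n_der n_der])
  moreover have "((\<lambda>v. n v \<bullet> n v) has_derivative (\<lambda>x. 0)) (at u)"
    by (rule has_derivative_cong_open [OF has_derivative_const V]) (simp add: nn)
  ultimately have "(\<lambda>x. n u \<bullet> (A x (n u) + N x) + (A x (n u) + N x) \<bullet> n u) = (\<lambda>x. 0)"
    by (rule has_derivative_unique)
  moreover have "n u \<bullet> A x (n u) = 0"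
    using A_skew [of x "n u" "n u"] inner_commute [of "n u" "A x (n u)"] by simp
  ultimately have 1: "n u \<bullet> N x = 0"
    using fun_cong [of _ "\<lambda>x. 0", of "\<lambda>x. n u \<bullet> (A x (n u) + N x) + (A x (n u) + N x) \<bullet> n u" x]
    by (simp add: inner_simps inner_commute)
  have 2: "N x \<bullet> a u y = - B x y" for y
  proof -
    have "((\<lambda>v. n v \<bullet> a v y) has_derivative (\<lambda>x. n u \<bullet> (A x (a u y) + II x y) + (A x (n u) + N x) \<bullet> a u y)) (at u)"
      by (rule has_derivative_inner [OF n_der a_der])
    moreover have "((\<lambda>v. n v \<bullet> a v y) has_derivative (\<lambda>x. 0)) (at u)"
      by (rule has_derivative_cong_open [OF has_derivative_const V]) (simp add: na)
    ultimately have "(\<lambda>x. n u \<bullet> (A x (a u y) + II x y) + (A x (n u) + N x) \<bullet> a u y) = (\<lambda>x. 0)"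
      by (rule has_derivative_unique)
    from fun_cong [OF this, of x] show ?thesis
      using A_skew [of x "n u" "a u y"] by (simp add: inner_simps second_ff inner_commute)
  qed
  obtain z where z: "a u z = N x"
    using tangent [OF 1] by blast
  have "z = - S x"
  proof (rule inner_form_eqI [OF inner_form_h [OF V(2)]])
    fix y
    show "h z y = h (- S x) y"
      using 2 [of y] by (simp add: h_a [of z] z S)
  qed
  then show ?thesis
    using z by simp
qed

end

section \<open>The torsion of the induced structure\<close>

context moving_frame
begin

text \<open>The g_2 condition, extended linearly from basis vectors to \<open>q\<close>, with both
  traces over \<real>^7 split into tangent and normal parts. The two mixed sums agree because
  \<open>phi0\<close> and \<open>b\<close> are both skew, hence the factor 2.\<close>

lemma trace_identity:
  "(\<Sum>i\<in>UNIV. \<Sum>j\<in>UNIV. phi0 q (a u (frame i)) (a u (frame j)) * rbar_tt M c u (frame i) (frame j))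
    + 2 * (\<Sum>i\<in>UNIV. phi0 q (a u (frame i)) (n u) * rbar_tn M c u (frame i)) = 0"
proof -
  have bil: "bilinear (\<lambda>p r. phi0 q x p * b y r)" "bilinear (\<lambda>p r. phi0 q p x * b r y)" for q x y
    by (simp_all add: bilinear_def linear_iff algebra_simps)
  have 1: "(\<Sum>j\<in>UNIV. \<Sum>k\<in>UNIV. phi0 q (axis j 1) (axis k 1) * b (axis j 1) (axis k 1)) = 0"
  proof -
    have "(\<Sum>j\<in>UNIV. \<Sum>k\<in>UNIV. phi0 q (axis j 1) (axis k 1) * b (axis j 1) (axis k 1))
        = (\<Sum>j\<in>UNIV. \<Sum>k\<in>UNIV. \<Sum>i\<in>UNIV. (q \<bullet> axis i 1) * (phi0 (axis i 1) (axis j 1) (axis k 1) * b (axis j 1) (axis k 1)))"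
    proof (intro sum.cong refl)
      fix j k :: 7
      have "linear (\<lambda>q. phi0 q (axis j 1) (axis k 1))"
        by (simp add: linear_iff)
      from sum_axis_linear [OF this, of q]
      show "phi0 q (axis j 1) (axis k 1) * b (axis j 1) (axis k 1)
          = (\<Sum>i\<in>UNIV. (q \<bullet> axis i 1) * (phi0 (axis i 1) (axis j 1) (axis k 1) * b (axis j 1) (axis k 1)))"
        unfolding mult.assoc [symmetric] sum_distrib_right [symmetric] by simp
    qed
    also have "\<dots> = (\<Sum>i\<in>UNIV. (q \<bullet> axis i 1) * (\<Sum>j\<in>UNIV. \<Sum>k\<in>UNIV. phi0 (axis i 1) (axis j 1) (axis k 1) * b (axis j 1) (axis k 1)))"
    proof -
      define f where "f i j k = (q \<bullet> axis i 1) * (phi0 (axis i 1) (axis j 1) (axis k 1) * b (axis j 1) (axis k 1))" for i j k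
      have "(\<Sum>j\<in>UNIV. \<Sum>k\<in>UNIV. \<Sum>i\<in>UNIV. f i j k) = (\<Sum>j\<in>UNIV. \<Sum>i\<in>UNIV. \<Sum>k\<in>UNIV. f i j k)"
        by (intro sum.cong refl sum.swap)
      also have "\<dots> = (\<Sum>i\<in>UNIV. \<Sum>j\<in>UNIV. \<Sum>k\<in>UNIV. f i j k)"
        by (rule sum.swap)
      finally show ?thesis
        by (simp add: f_def sum_distrib_left)
    qed
    finally show ?thesis
      by (simp add: b_phi0)
  qed
  have 2: "(\<Sum>j\<in>UNIV. \<Sum>k\<in>UNIV. phi0 q (axis j 1) (axis k 1) * b (axis j 1) (axis k 1))
      = (\<Sum>j\<in>UNIV. (\<Sum>i\<in>UNIV. phi0 q (axis j 1) (a u (frame i)) * b (axis j 1) (a u (frame i))) + phi0 q (axis j 1) (n u) * b (axis j 1) (n u))"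
    by (intro sum.cong refl tangent_trace bil)
  have "bilinear (\<lambda>p r. (\<Sum>i\<in>UNIV. phi0 q p (a u (frame i)) * b r (a u (frame i))) + phi0 q p (n u) * b r (n u))"
    by (simp add: bilinear_def linear_iff algebra_simps sum.distrib sum_distrib_left)
  from tangent_trace [OF this]
  have "(\<Sum>i\<in>UNIV. \<Sum>j\<in>UNIV. phi0 q (a u (frame i)) (a u (frame j)) * b (a u (frame i)) (a u (frame j)))
      + (\<Sum>i\<in>UNIV. phi0 q (a u (frame i)) (n u) * b (a u (frame i)) (n u))
      + (\<Sum>i\<in>UNIV. phi0 q (n u) (a u (frame i)) * b (n u) (a u (frame i))) = 0"
    using 1 2 by (simp add: sum.distrib)
  moreover have "phi0 q (n u) x * b (n u) x = phi0 q x (n u) * b x (n u)" for x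
    using phi0_swap(2) [of q x "n u"] b_skew [of "n u" x] by simp
  ultimately show ?thesis
    by (simp add: rtt rtn)
qed

text \<open>For tangent \<open>q\<close> the mixed sum is a contraction with
  \<open>h _ (J z)\<close>, which evaluates \<open>rbar_tn\<close> at \<open>J z\<close>.\<close>

lemma trace_tangent:
  "(\<Sum>i\<in>UNIV. \<Sum>j\<in>UNIV. psi z (frame i) (frame j) * rbar_tt M c u (frame i) (frame j)) = - 2 * rbar_tn M c u (J z)"
proof -
  have "linear (rbar_tn M c u)"
    by (simp add: linear_iff rtn)
  then have "(\<Sum>i\<in>UNIV. h (frame i) (J z) * rbar_tn M c u (frame i)) = rbar_tn M c u (J z)"
    by (rule h_frame_sum)
  moreover have "phi0 (a u z) (a u x) (n u) = h x (J z)" for x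
    using phi0_n [of z x] phi0_cyc [of "n u" "a u z" "a u x"] phi0_cyc [of "a u z" "a u x" "n u"]
    by (simp add: hJ h_sym [of x] flip: phi0_n)
  ultimately show ?thesis
    using trace_identity [of "a u z"] by (simp add: psi_a)
qed

text \<open>For normal \<open>q\<close> the mixed sum vanishes and \<open>phi0 n\<close> is the
  two-form of \<open>J\<close>. This removes the contribution of r(\<phi>) to the trace of the
  torsion operator.\<close>

lemma trace_normal: "(\<Sum>i\<in>UNIV. rbar_tt M c u (frame i) (J (frame i))) = 0"
proof -
  have "(\<Sum>j\<in>UNIV. phi0 (n u) (a u x) (a u (frame j)) * rbar_tt M c u x (frame j)) = rbar_tt M c u x (J x)" for x
  proof -
    have "phi0 (n u) (a u x) (a u y) = h y (J x)" for y
      by (simp add: phi0_n h_sym [of y] hJ)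
    moreover have "linear (rbar_tt M c u x)"
      using bilinear_rtt by (simp add: bilinear_def)
    ultimately show ?thesis
      by (simp add: h_frame_sum)
  qed
  then show ?thesis
    using trace_identity [of "n u"] by simp
qed

text \<open>\<open>A\<close> acts by the derivation, giving the dual form. The tangential part of
  \<open>II\<close> cancels against the induced connection, and its normal part pairs with \<phi> to
  give the terms in \<open>B\<close>.\<close>

lemma nabla_pull_phi:
  "nabla3 (hconn M c u) (pull_phi M c) u x y z w = star_phi0 (torsion_vec (A x)) (a u y) (a u z) (a u w)
     - (B x y * h z (J w) - B x z * h y (J w) + B x w * h y (J z))"
  and differentiable_pull_phi: "(\<lambda>v. pull_phi M c v y z w) differentiable (at u)"
proof -
  have D: "((\<lambda>v. pull_phi M c v y z w) has_derivative (\<lambda>x. phi0 (A x (a u y) + II x y) (a u z) (a u w)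
      + phi0 (a u y) (A x (a u z) + II x z) (a u w) + phi0 (a u y) (a u z) (A x (a u w) + II x w))) (at u)"
    by (rule has_derivative_cong_open [OF has_derivative_phi0 [OF a_der a_der a_der] V]) (simp add: pull_phi)
  then show "(\<lambda>v. pull_phi M c v y z w) differentiable (at u)"
    unfolding differentiable_def by blast
  have n: "phi0 (n u) (a u y) (a u z) = - h y (J z)" "phi0 (a u y) (n u) (a u z) = h y (J z)"
    "phi0 (a u y) (a u z) (n u) = - h y (J z)" for y z
    using phi0_n [of y z] phi0_swap(1) [of "n u" "a u y" "a u z"] phi0_cyc [of "n u" "a u y" "a u z"]
      phi0_cyc [of "a u y" "a u z" "n u"] by simp_all
  show "nabla3 (hconn M c u) (pull_phi M c) u x y z w = star_phi0 (torsion_vec (A x)) (a u y) (a u z) (a u w)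
     - (B x y * h z (J w) - B x z * h y (J w) + B x w * h y (J z))"
    unfolding nabla3_def ddir_eq [OF D] phi0_derivation [OF A_lin A_skew, symmetric] gauss_formula psi_a
    by (simp add: n)
qed

text \<open>\<omega> is \<open>phi0 (n v)\<close> with its arguments exchanged. The normal part of
  \<open>II\<close> is killed by the first slot, so \<open>B\<close> enters only through the
  derivative of the normal.\<close>

lemma nabla_omega_eq:
  assumes S: "\<And>x y. h (S x) y = B x y"
  shows "nabla_omega M c u x y z = psi (S x) y z - star_phi0 (torsion_vec (A x)) (a u z) (n u) (a u y)"
proof -
  have om: "omega M c v y z = phi0 (n v) (a v z) (a v y)" if "v \<in> V" for v y z
    by (simp add: omega_def hmetric [OF that] act_I [OF that] inner_cross0 phi0_cyc [of "n v" "a v z" "a v y"])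
  have D: "((\<lambda>v. omega M c v y z) has_derivative (\<lambda>x. phi0 (A x (n u) + N x) (a u z) (a u y)
      + phi0 (n u) (A x (a u z) + II x z) (a u y) + phi0 (n u) (a u z) (A x (a u y) + II x y))) (at u)"
    by (rule has_derivative_cong_open [OF has_derivative_phi0 [OF n_der a_der a_der] V]) (simp add: om)
  have "nabla_omega M c u x y z = (phi0 (A x (n u)) (a u z) (a u y) + phi0 (n u) (A x (a u z)) (a u y)
      + phi0 (n u) (a u z) (A x (a u y))) - phi0 (a u (S x)) (a u z) (a u y)"
    unfolding nabla_omega_def nabla2_def ddir_eq [OF D] gauss_formula om [OF V(2)] weingarten_formula [OF S] by simp
  then show ?thesis
    unfolding phi0_derivation [OF A_lin A_skew]
    using star_phi0_swap(2) [of "torsion_vec (A x)" "a u z" "n u" "a u y"]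
      phi0_swap(2) [of "a u (S x)" "a u z" "a u y"]
    by (simp add: psi_a)
qed

text \<open>\<open>R\<close> is the shape operator minus \<open>J\<close> composed with the operator
  \<open>T\<close> of r(\<phi>). The normal part of the torsion vector drops out of
  \<nabla>\<omega>, since \<open>star_phi0\<close> vanishes on two equal normals, but survives in
  \<nabla>\<psi> as the last term. The shape operator is symmetric and has no divergence, so the
  divergence comes from \<open>T\<close> alone.\<close>

lemma torsion_operator:
  obtains R where "linear R" "\<And>x y. h (R x) y = B x y + rbar_tt M c u x (J y)"
    "\<And>x y z. nabla_omega M c u x y z = psi (R x) y z"
    "\<And>x y z w. nabla3 (hconn M c u) (pull_phi M c) u x y z w
      = - (h (R x) y * h z (J w) - h (R x) z * h y (J w) + h (R x) w * h y (J z))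
        - rbar_tn M c u x * psi (J y) z w"
    "\<And>z. div_alpha R z = 2 * rbar_tn M c u z"
proof -
  obtain S where S: "linear S" "\<And>x y. h (S x) y = B x y"
    using operator_exists [OF bilinear_B] by blast
  obtain T where T: "linear T" "\<And>x y. h (T x) y = rbar_tt M c u x y"
    using operator_exists [OF bilinear_rtt] by blast
  have rho: "torsion_vec (A x) = a u (T x) + rbar_tn M c u x *\<^sub>R n u" for x
  proof -
    have "n u \<bullet> (torsion_vec (A x) - rbar_tn M c u x *\<^sub>R n u) = 0"
      by (simp add: inner_simps rbar_tn inner_commute)
    then obtain y where y: "a u y = torsion_vec (A x) - rbar_tn M c u x *\<^sub>R n u"
      using tangent by blast
    have "y = T x"
    proof (rule inner_form_eqI [OF h])
      fix z
      show "h y z = h (T x) z"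
        by (simp add: h_a [of y] y T inner_simps rbar_tt)
    qed
    with y show ?thesis by simp
  qed
  define R where "R x = S x - J (T x)" for x
  have R: "linear R"
    using S(1) T(1) by (simp add: linear_iff R_def algebra_simps)
  have hR: "h (R x) y = B x y + rbar_tt M c u x (J y)" for x y
    by (simp add: R_def S T hJ)
  have om: "nabla_omega M c u x y z = psi (R x) y z" for x y z
  proof -
    have "star_phi0 (torsion_vec (A x)) (a u z) (n u) (a u y) = star_phi0 (a u (T x)) (a u z) (n u) (a u y)
        + rbar_tn M c u x * star_phi0 (n u) (a u z) (n u) (a u y)"
      by (simp add: rho)
    also have "\<dots> = star_phi0 (n u) (a u (T x)) (a u z) (a u y)"
      using star_phi0_swap(2) [of "a u (T x)" "n u" "a u z" "a u y"] star_phi0_swap(1) [of "n u" "a u (T x)" "a u z" "a u y"]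
      by simp
    also have "\<dots> = psi (J (T x)) y z"
      using psi_swap(2) [of "J (T x)" y z] by (simp add: star_phi0_normal psi_a J_a)
    finally show ?thesis
      by (simp add: nabla_omega_eq [OF S(2)] R_def)
  qed
  have nab: "nabla3 (hconn M c u) (pull_phi M c) u x y z w
      = - (h (R x) y * h z (J w) - h (R x) z * h y (J w) + h (R x) w * h y (J z))
        - rbar_tn M c u x * psi (J y) z w" for x y z w
  proof -
    have "star_phi0 (torsion_vec (A x)) (a u y) (a u z) (a u w)
        = - (h (T x) (J y) * h z (J w) - h (T x) (J z) * h y (J w) + h (T x) (J w) * h y (J z))
          - rbar_tn M c u x * psi (J y) z w"
      by (simp add: rho star_phi0_normal star_phi0_tangent [of "n u"] phi0_n psi_a J_a)
    then show ?thesis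
      unfolding nabla_pull_phi hR T by (simp add: algebra_simps)
  qed
  have "div_alpha R z = 2 * rbar_tn M c u z" for z
  proof -
    have "h (S x) y = h (S y) x" for x y
      by (simp add: S B_sym [of x])
    then have S0: "div_alpha S z = 0"
      by (rule div_alpha_symmetric [OF S(1)])
    have "div_alpha R z = div_alpha S z - (\<Sum>i\<in>UNIV. psi (T (frame i)) (frame i) (J z))"
      by (simp add: div_alpha_def alpha_def R_def sum_subtractf psiJ2)
    also have "(\<Sum>i\<in>UNIV. psi (T (frame i)) (frame i) (J z))
       = (\<Sum>i\<in>UNIV. \<Sum>j\<in>UNIV. - (psi (J z) (frame i) (frame j) * rbar_tt M c u (frame i) (frame j)))"
    proof (rule sum.cong [OF refl])
      fix i
      have "psi (T (frame i)) (frame i) (J z) = (\<Sum>j\<in>UNIV. h (frame j) (T (frame i)) * psi (frame j) (frame i) (J z))"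
        by (rule h_frame_sum [OF linear_psi(1), symmetric])
      also have "\<dots> = (\<Sum>j\<in>UNIV. - (psi (J z) (frame i) (frame j) * rbar_tt M c u (frame i) (frame j)))"
      proof (rule sum.cong [OF refl])
        fix j
        have "h (frame j) (T (frame i)) = rbar_tt M c u (frame i) (frame j)"
          using T(2) h_sym by metis
        moreover have "psi (frame j) (frame i) (J z) = - psi (J z) (frame i) (frame j)"
          using psi_swap psi_cyc by metis
        ultimately show "h (frame j) (T (frame i)) * psi (frame j) (frame i) (J z)
            = - (psi (J z) (frame i) (frame j) * rbar_tt M c u (frame i) (frame j))"
          by simp
      qed
      finally show "psi (T (frame i)) (frame i) (J z)
          = (\<Sum>j\<in>UNIV. - (psi (J z) (frame i) (frame j) * rbar_tt M c u (frame i) (frame j)))" .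
    qed
    also have "\<dots> = - 2 * rbar_tn M c u z"
      using trace_tangent [of "J z"] by (simp add: sum_negf rtn)
    finally show ?thesis
      by (simp add: S0)
  qed
  with R hR om nab show ?thesis
    by (rule that)
qed

lemma tr_torsion:
  assumes "\<And>x y. h (R x) y = B x y + rbar_tt M c u x (J y)"
  shows "tr R = 6 * mean_curv M c u"
  by (simp add: tr_def assms sum.distrib trace_normal mean_curv_def Let_def)

text \<open>\<open>act_I\<close> is only given as the solution of a linear system with the 7 x 6
  matrix of \<open>a v\<close>. A left inverse of \<open>a u\<close> makes the system square, with
  the identity matrix at \<open>u\<close>.\<close>

lemma differentiable_J: "(\<lambda>v. act_I M c v y) differentiable (at u)"
proof -
  obtain L where L: "linear L" "L \<circ> a u = id"
    using linear_injective_left_inverse [OF at_u(1,2)] by blast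
  define Bm where "Bm v = matrix (\<lambda>x. L (a v x))" for v
  have lin: "linear (\<lambda>x. L (a v x))" if "v \<in> V" for v
    using linear_compose [OF a_lin [OF that] L(1)] by (simp add: o_def)
  have Ld: "(\<lambda>v. L (f v)) differentiable (at u)" if "f differentiable (at u)" for f :: "real ^ 6 \<Rightarrow> real ^ 7"
    using that bounded_linear.has_derivative [OF linear_conv_bounded_linear [THEN iffD1, OF L(1)]]
    unfolding differentiable_def by blast
  have nth: "(\<lambda>v. f v $ i) differentiable (at u)" if "f differentiable (at u)" for f :: "real ^ 6 \<Rightarrow> real ^ 6" and i
    using that bounded_linear.has_derivative [OF bounded_linear_vec_nth] unfolding differentiable_def by blast
  show ?thesis
  proof (rule differentiable_solution [OF _ _ V])
    show "(\<lambda>v. Bm v $ i $ j) differentiable (at u)" for i j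
      unfolding Bm_def matrix_def
      using nth [OF Ld] a_der unfolding differentiable_def by simp blast
    show "(\<lambda>v. L (cross0 (n v) (a v y)) $ i) differentiable (at u)" for i
      using cross0.FDERIV [OF n_der a_der] by (intro nth Ld) (auto simp: differentiable_def)
    show "Bm v *v act_I M c v y = L (cross0 (n v) (a v y))" if "v \<in> V" for v
      unfolding Bm_def using fun_cong [OF matrix_vector_mul(2) [OF lin [OF that]], of "act_I M c v y"]
      by (simp add: act_I [OF that])
    have "(\<lambda>x. L (a u x)) = id"
      using L(2) by (simp add: o_def)
    then have "Bm u = mat 1"
      by (simp add: Bm_def matrix_id_mat_1)
    then show "det (Bm u) \<noteq> 0"
      by simp
  qed
qed

lemma nabla_I_eq:
  assumes om: "\<And>x y z. nabla_omega M c u x y z = psi (R x) y z"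
  shows "h y (nabla_I M c u x z) = psi (R x) y z"
proof -
  have D: "((\<lambda>v. act_I M c v z) has_derivative ddir (\<lambda>v. act_I M c v z) u) (at u)"
    using differentiable_J frechet_derivative_works by blast
  have hd: "(\<lambda>v. hmetric M c v y z) differentiable (at u)" for y z
    using has_derivative_h unfolding differentiable_def by blast
  have "((\<lambda>v. hmetric M c v y (act_I M c v z)) has_derivative
      (\<lambda>w. ddir (\<lambda>v. hmetric M c v y (J z)) u w + h 0 (J z) + h y (ddir (\<lambda>v. act_I M c v z) u w))) (at u)"
    by (rule has_derivative_bilinear_field [OF V inner_form_bilinear [OF inner_form_h] hd has_derivative_const D])
  from ddir_eq [OF this]
  have "ddir (\<lambda>v. omega M c v y z) u x = ddir (\<lambda>v. hmetric M c v y (J z)) u x + h y (ddir (\<lambda>v. act_I M c v z) u x)"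
    by (simp add: omega_def)
  moreover have "ddir (\<lambda>v. hmetric M c v y (J z)) u x = h (hconn M c u x y) (J z) + h y (hconn M c u x (J z))"
    using levi_civita_hconn unfolding is_levi_civita_def by blast
  ultimately have "nabla_omega M c u x y z = h y (nabla_I M c u x z)"
    by (simp add: nabla_omega_def nabla2_def nabla_I_def omega_def)
  then show ?thesis
    by (simp add: om)
qed

section \<open>The connections in the definition of \<open>eta\<close>\<close>

definition su3_conn :: "(real ^ 6 \<Rightarrow> real) \<Rightarrow> real ^ 6 \<Rightarrow> real ^ 6 \<Rightarrow> real ^ 6" where
  "su3_conn m x y = hconn M c u x y + I_one J m x *\<^sub>R J y + xi M c u x y"

lemma omega_u: "omega M c u y z = h y (J z)"
  by (simp add: omega_def)

lemma inner_xi: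
  assumes om: "\<And>x y z. nabla_omega M c u x y z = psi (R x) y z"
  shows "h v (xi M c u x y) = 1 / 2 * psi (R x) (J v) y"
  using nabla_I_eq [OF om, of "J v" x y] by (simp add: xi_def hJ)

text \<open>Each slot of \<omega> receives half of \<nabla>\<omega> from \<open>xi\<close>, and the
  term with \<open>m\<close> cancels because \<open>J\<close> is skew. So \<omega> puts no condition
  on \<open>m\<close>.\<close>

lemma su3_conn_omega:
  assumes om: "\<And>x y z. nabla_omega M c u x y z = psi (R x) y z"
  shows "nabla2 (su3_conn m) (omega M c) u x y z = 0"
proof -
  have "nabla2 (su3_conn m) (omega M c) u x y z = nabla_omega M c u x y z
      - h (xi M c u x y) (J z) - h y (J (xi M c u x z))"
    by (simp add: nabla2_def nabla_omega_def su3_conn_def omega_u algebra_simps)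
  also have "h (xi M c u x y) (J z) = 1 / 2 * psi (R x) y z"
    unfolding h_sym [of "xi M c u x y"] inner_xi [OF om] using psi_swap(2) [of "R x" z y] by simp
  also have "h y (J (xi M c u x z)) = 1 / 2 * psi (R x) y z"
    using inner_xi [OF om, of "J y" x z] by (simp add: hJ)
  finally show ?thesis
    by (simp add: om)
qed

text \<open>By \<open>torsion_action\<close> the term \<open>xi\<close> cancels everything that
  involves \<open>R\<close>. The 3 counts the slots of \<psi>, in each of which \<open>J\<close> can
  be slid to the first.\<close>

lemma su3_conn_phi:
  assumes om: "\<And>x y z. nabla_omega M c u x y z = psi (R x) y z"
    and nab: "\<And>x y z w. nabla3 (hconn M c u) (pull_phi M c) u x y z w
      = - (h (R x) y * h z (J w) - h (R x) z * h y (J w) + h (R x) w * h y (J z))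
        - rbar_tn M c u x * psi (J y) z w"
  shows "nabla3 (su3_conn m) (pull_phi M c) u x y z w
    = - (rbar_tn M c u x + 3 * I_one J m x) * psi (J y) z w"
proof -
  have "nabla3 (su3_conn m) (pull_phi M c) u x y z w = nabla3 (hconn M c u) (pull_phi M c) u x y z w
      - 3 * I_one J m x * psi (J y) z w
      - (psi (xi M c u x y) z w + psi y (xi M c u x z) w + psi y z (xi M c u x w))"
    by (simp add: nabla3_def su3_conn_def psiJ2 algebra_simps)
  then show ?thesis
    unfolding torsion_action [of "xi M c u x" "R x", OF inner_xi [OF om]] nab
    by (simp add: algebra_simps)
qed

lemma su3_conn_J:
  assumes om: "\<And>x y z. nabla_omega M c u x y z = psi (R x) y z"
  shows "ddir (\<lambda>v. act_I M c v y) u x + su3_conn m x (J y) = J (su3_conn m x y)"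
proof (rule inner_form_eqI [OF h])
  fix v
  have "h v (xi M c u x (J y)) = - 1 / 2 * h v (nabla_I M c u x y)"
    unfolding inner_xi [OF om] nabla_I_eq [OF om] by (simp add: psiJ2)
  then have 1: "h (xi M c u x (J y)) v = - 1 / 2 * h (nabla_I M c u x y) v"
    by (simp add: h_sym [of v])
  have 2: "J (xi M c u x y) = (1 / 2) *\<^sub>R nabla_I M c u x y"
    by (simp add: xi_def)
  have "ddir (\<lambda>v. act_I M c v y) u x + su3_conn m x (J y) - J (su3_conn m x y)
      = nabla_I M c u x y + xi M c u x (J y) - J (xi M c u x y)"
    by (simp add: su3_conn_def nabla_I_def)
  then have "h (ddir (\<lambda>v. act_I M c v y) u x + su3_conn m x (J y) - J (su3_conn m x y)) v
      = h (nabla_I M c u x y + xi M c u x (J y) - J (xi M c u x y)) v"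
    by (rule arg_cong)
  also have "\<dots> = 0"
    unfolding 2 by (simp add: 1)
  finally show "h (ddir (\<lambda>v. act_I M c v y) u x + su3_conn m x (J y)) v = h (J (su3_conn m x y)) v"
    by simp
qed

lemma pull_n_star_eq: "v \<in> V \<Longrightarrow> pull_n_star M c v y z w = - pull_phi M c v (act_I M c v y) z w"
  by (simp add: pull_n_star pull_phi act_I star_phi0_normal nn na)

text \<open>\<open>pull_n_star\<close> is minus \<psi> with \<open>J\<close> in the first slot, and
  the connection preserves \<open>J\<close> by \<open>su3_conn_J\<close>; so this form is parallel
  exactly when \<psi> is.\<close>

lemma su3_conn_n_star:
  assumes om: "\<And>x y z. nabla_omega M c u x y z = psi (R x) y z"
  shows "nabla3 (su3_conn m) (pull_n_star M c) u x y z w = - nabla3 (su3_conn m) (pull_phi M c) u x (J y) z w"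
    and "(\<lambda>v. pull_n_star M c v y z w) differentiable (at u)"
proof -
  have bil: "bilinear (\<lambda>y z. pull_phi M c v y z w)" if "v \<in> V" for v
    using a_lin [OF that] by (simp add: bilinear_def linear_iff pull_phi [OF that])
  have "((\<lambda>v. pull_phi M c v (act_I M c v y) z w) has_derivative
      (\<lambda>x. ddir (\<lambda>v. pull_phi M c v (J y) z w) u x + psi (ddir (\<lambda>v. act_I M c v y) u x) z w + psi (J y) 0 w)) (at u)"
    by (rule has_derivative_bilinear_field [OF V bil differentiable_pull_phi
        frechet_derivative_works [THEN iffD1, OF differentiable_J] has_derivative_const])
  then have "((\<lambda>v. - pull_phi M c v (act_I M c v y) z w) has_derivative
      (\<lambda>x. - (ddir (\<lambda>v. pull_phi M c v (J y) z w) u x + psi (ddir (\<lambda>v. act_I M c v y) u x) z w + psi (J y) 0 w))) (at u)"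
    by (rule has_derivative_minus)
  then have D: "((\<lambda>v. pull_n_star M c v y z w) has_derivative
      (\<lambda>x. - (ddir (\<lambda>v. pull_phi M c v (J y) z w) u x + psi (ddir (\<lambda>v. act_I M c v y) u x) z w + psi (J y) 0 w))) (at u)"
    by (rule has_derivative_cong_open [OF _ V]) (simp add: pull_n_star_eq)
  then show "(\<lambda>v. pull_n_star M c v y z w) differentiable (at u)"
    unfolding differentiable_def by blast
  have "J (su3_conn m x y) = ddir (\<lambda>v. act_I M c v y) u x + su3_conn m x (J y)"
    using su3_conn_J [OF om] by simp
  then show "nabla3 (su3_conn m) (pull_n_star M c) u x y z w = - nabla3 (su3_conn m) (pull_phi M c) u x (J y) z w"
    by (simp add: nabla3_def ddir_eq [OF D] pull_n_star_eq [OF V(2)])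
qed

lemma psi_nonzero:
  assumes "\<And>y z w. r * psi (J y) z w = 0"
  shows "r = 0"
proof (rule ccontr)
  assume "r \<noteq> 0"
  then have "psi (J (frame 0)) z w = psi 0 z w" for z w
    using assms by simp
  then have "J (frame 0) = 0"
    by (rule psi_inj)
  then have "h (J (frame 0)) (J (frame 0)) = 0"
    by simp
  then show False
    unfolding hJJ h_frame_self by simp
qed

section \<open>The two constant angles and the resulting types\<close>

context
  fixes \<theta> :: "'a \<Rightarrow> real" and \<epsilon> :: torsion_sign
  assumes \<theta>: "(\<theta> = (\<lambda>_. 0) \<and> \<epsilon> = Plus) \<or> (\<theta> = (\<lambda>_. pi / 2) \<and> \<epsilon> = Minus)"
begin

lemma psi_theta:
  "\<epsilon> = Plus \<and> psi_plus M \<theta> c = pull_phi M c \<and> psi_minus M \<theta> c = pull_n_star M c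
   \<or> \<epsilon> = Minus \<and> psi_plus M \<theta> c = (\<lambda>v y z w. - pull_n_star M c v y z w) \<and> psi_minus M \<theta> c = pull_phi M c"
  using \<theta>
proof (elim disjE conjE)
  assume *: "\<theta> = (\<lambda>_. 0)" "\<epsilon> = Plus"
  have "psi_plus M \<theta> c = pull_phi M c" "psi_minus M \<theta> c = pull_n_star M c"
    by (intro ext; simp add: psi_plus_def psi_minus_def *(1))+
  with *(2) show ?thesis by blast
next
  assume *: "\<theta> = (\<lambda>_. pi / 2)" "\<epsilon> = Minus"
  have "psi_plus M \<theta> c = (\<lambda>v y z w. - pull_n_star M c v y z w)" "psi_minus M \<theta> c = pull_phi M c"
    by (intro ext; simp add: psi_plus_def psi_minus_def *(1))+
  with *(2) show ?thesis by blast
qed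

text \<open>For both angles \<psi>_+ and \<psi>_- are, up to sign and order, the two pulled back
  forms, so parallelism amounts to \<open>rbar_tn + 3 I m = 0\<close>. Substituting
  \<open>J x\<close> solves this for \<open>m\<close> uniquely.\<close>

lemma eta_eq: "eta M \<theta> c u = (\<lambda>x. - rbar_tn M c u (J x) / 3)"
proof -
  obtain R where om: "\<And>x y z. nabla_omega M c u x y z = psi (R x) y z"
    and nab: "\<And>x y z w. nabla3 (hconn M c u) (pull_phi M c) u x y z w
      = - (h (R x) y * h z (J w) - h (R x) z * h y (J w) + h (R x) w * h y (J z))
        - rbar_tn M c u x * psi (J y) z w"
    using torsion_operator by metis
  have neg: "nabla3 D (\<lambda>v y z w. - pull_n_star M c v y z w) u x y z w = - nabla3 D (pull_n_star M c) u x y z w" for D x y z w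
    unfolding nabla3_def
    using ddir_eq [OF has_derivative_minus [OF frechet_derivative_works [THEN iffD1, OF su3_conn_n_star(2) [OF om]]]]
    by simp
  have J_all: "(\<forall>x y z w. f x (J y) z w = 0) \<longleftrightarrow> (\<forall>x y z w. f x y z w = (0 :: real))" for f :: "real ^ 6 \<Rightarrow> real ^ 6 \<Rightarrow> real ^ 6 \<Rightarrow> real ^ 6 \<Rightarrow> real"
    by (metis JJ minus_minus)
  have "(\<forall>x y z w. nabla3 (su3_conn m) (pull_phi M c) u x y z w = 0) \<longleftrightarrow>
      (\<forall>x. rbar_tn M c u x + 3 * I_one J m x = 0)" for m
  proof -
    have "(\<forall>y z w. - r * psi (J y) z w = 0) \<longleftrightarrow> r = 0" for r
      using psi_nonzero [of "- r"] by auto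
    then show ?thesis
      unfolding su3_conn_phi [OF om nab] by blast
  qed
  moreover have "(\<forall>x y z w. nabla3 (su3_conn m) (pull_n_star M c) u x y z w = 0) \<longleftrightarrow>
      (\<forall>x y z w. nabla3 (su3_conn m) (pull_phi M c) u x y z w = 0)" for m
    unfolding su3_conn_n_star(1) [OF om] using J_all [of "nabla3 (su3_conn m) (pull_phi M c) u"] by simp
  ultimately have "(\<forall>x y z w. nabla3 (su3_conn m) (psi_plus M \<theta> c) u x y z w = 0) \<and>
      (\<forall>x y z w. nabla3 (su3_conn m) (psi_minus M \<theta> c) u x y z w = 0) \<longleftrightarrow>
      (\<forall>x. rbar_tn M c u x + 3 * I_one J m x = 0)" for m
    using psi_theta by (elim disjE conjE) (simp_all only: neg neg_equal_0_iff_equal, blast+)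
  moreover have "(\<lambda>x y. hconn M c u x y + I_one J m x *\<^sub>R J y + xi M c u x y) = su3_conn m" for m
    by (simp add: fun_eq_iff su3_conn_def)
  ultimately have eta: "eta M \<theta> c u = (THE m. linear m \<and> (\<forall>x. rbar_tn M c u x + 3 * I_one J m x = 0))"
    unfolding eta_def Let_def by (simp add: su3_conn_omega [OF om])
  have lin: "linear (rbar_tn M c u)"
    by (simp add: linear_iff rtn)
  show ?thesis
    unfolding eta
  proof (rule the_equality)
    have "linear (\<lambda>x. - rbar_tn M c u (J x) / 3)"
      by (simp add: linear_iff linear_add [OF lin] linear_scale [OF lin] field_simps)
    then show "linear (\<lambda>x. - rbar_tn M c u (J x) / 3)
        \<and> (\<forall>x. rbar_tn M c u x + 3 * I_one J (\<lambda>x. - rbar_tn M c u (J x) / 3) x = 0)"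
      by (simp add: I_one_def linear_neg [OF lin])
  next
    fix m
    assume "linear m \<and> (\<forall>x. rbar_tn M c u x + 3 * I_one J m x = 0)"
    then have m: "linear m" "\<And>x. rbar_tn M c u x + 3 * I_one J m x = 0"
      by blast+
    show "m = (\<lambda>x. - rbar_tn M c u (J x) / 3)"
    proof
      fix x
      show "m x = - rbar_tn M c u (J x) / 3"
        using m(2) [of "J x"] by (simp add: I_one_def linear_neg [OF m(1)])
    qed
  qed
qed

lemma I_eta: "I_one J (eta M \<theta> c u) x = - rbar_tn M c u x / 3"
proof -
  have "linear (rbar_tn M c u)"
    by (simp add: linear_iff rtn)
  then show ?thesis
    by (simp add: eta_eq I_one_def linear_neg)
qed

lemma eta_zero_iff: "(\<forall>x. eta M \<theta> c u x = 0) \<longleftrightarrow> (\<forall>x. rbar_tn M c u x = 0)"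
  by (auto simp: eta_eq) (metis JJ minus_minus)

lemma dstar_eq: "dstar_omega M c u x = - 2 * rbar_tn M c u x"
proof -
  obtain R where om: "\<And>x y z. nabla_omega M c u x y z = psi (R x) y z"
    and div: "\<And>z. div_alpha R z = 2 * rbar_tn M c u z"
    using torsion_operator by metis
  show ?thesis
    using div [of x] by (simp add: dstar_omega_def Let_def om div_alpha_def alpha_def)
qed

lemma type_iff:
  "has_torsion_type h J (psi_plus M \<theta> c u) (nabla_omega M c u) U \<longleftrightarrow>
    has_torsion_type h J psi (nabla_omega M c u) (if \<epsilon> = Plus then U else flip_class ` U)"
proof -
  have "psi_plus M \<theta> c u = (\<lambda>x. psi (J x))" if "\<epsilon> = Minus"
    using psi_theta that by (simp add: fun_eq_iff pull_n_star_eq [OF V(2)])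
  moreover have "psi_plus M \<theta> c u = psi" if "\<epsilon> = Plus"
    using psi_theta that by simp
  ultimately show ?thesis
    using has_torsion_type_flip by (cases \<epsilon>) simp_all
qed

text \<open>By \<open>C\<close>, the left-hand side of the third condition is twice the commuting
  part of \<open>R\<close>; having no trace-free part means being 2 h times the metric. By
  \<open>S\<close>, the contributions of r(\<phi>) cancel, so the absence of the symmetric
  anticommuting part is a condition on \<open>B\<close> alone. The sign is first normalised to
  \<open>Plus\<close> by \<open>flip\<close>.\<close>

lemma torsion_types:
  shows "has_torsion_type h J (psi_plus M \<theta> c u) (nabla_omega M c u) {W1 \<epsilon>, W2 \<epsilon>, W3, W4, W5}"
    and "(\<And>x. rbar_tn M c u x = 0) \<Longrightarrow>
      has_torsion_type h J (psi_plus M \<theta> c u) (nabla_omega M c u) {W1 \<epsilon>, W2 \<epsilon>, W3}"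
    and "has_torsion_type h J (psi_plus M \<theta> c u) (nabla_omega M c u) {W1 \<epsilon>, W2 \<epsilon>, W4, W5} \<longleftrightarrow>
      (\<forall>x y. I_both J B x y = B x y)"
    and "has_torsion_type h J (psi_plus M \<theta> c u) (nabla_omega M c u) {W1 \<epsilon>, W3, W4, W5} \<longleftrightarrow>
      (\<forall>x y. (I_first J (rbar_tt M c u) x y - I_second J (rbar_tt M c u) x y) + (B x y + I_both J B x y)
         = 2 * mean_curv M c u * h x y)"
    and "has_torsion_type h J (psi_plus M \<theta> c u) (nabla_omega M c u) {W2 \<epsilon>, W3, W4, W5} \<longleftrightarrow>
      mean_curv M c u = 0"
proof -
  obtain R where R: "linear R" and hR: "\<And>x y. h (R x) y = B x y + rbar_tt M c u x (J y)"
    and om: "\<And>x y z. nabla_omega M c u x y z = psi (R x) y z"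
    and div: "\<And>z. div_alpha R z = 2 * rbar_tn M c u z"
    using torsion_operator by metis
  have nab: "nabla_omega M c u = alpha R"
    by (simp add: fun_eq_iff om alpha_def)
  have rtt_neg: "rbar_tt M c u x (- y) = - rbar_tt M c u x y" for x y
    by (simp add: rtt)
  have C: "h (R x) y + h (R (J x)) (J y) = (I_first J (rbar_tt M c u) x y - I_second J (rbar_tt M c u) x y)
      + (B x y + I_both J B x y)" for x y
    by (simp add: hR rtt_neg I_first_def I_second_def I_both_def)
  have sym: "h (R x) y + h (R (J x)) (J y) = h (R y) x + h (R (J y)) (J x)" for x y
    using rtt_skew [of x "J y"] rtt_skew [of "J x" y] B_sym [of x y] B_sym [of "J x" "J y"]
    by (simp add: hR rtt_neg)
  have tr: "tr R = 6 * mean_curv M c u"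
    by (rule tr_torsion [OF hR])
  have S: "h (R x) y + h (R y) x = h (R (J x)) (J y) + h (R (J y)) (J x) \<longleftrightarrow> I_both J B x y = B x y" for x y
    using rtt_skew [of x "J y"] rtt_skew [of "J x" y] B_sym [of x y] B_sym [of "J x" "J y"]
    by (auto simp: hR rtt_neg I_both_def)
  have flip: "(if \<epsilon> = Plus then {W1 \<epsilon>, W2 \<epsilon>, W3, W4, W5} else flip_class ` {W1 \<epsilon>, W2 \<epsilon>, W3, W4, W5}) = {W1 Plus, W2 Plus, W3, W4, W5}"
    "(if \<epsilon> = Plus then {W1 \<epsilon>, W2 \<epsilon>, W3} else flip_class ` {W1 \<epsilon>, W2 \<epsilon>, W3}) = {W1 Plus, W2 Plus, W3}"
    "(if \<epsilon> = Plus then {W1 \<epsilon>, W2 \<epsilon>, W4, W5} else flip_class ` {W1 \<epsilon>, W2 \<epsilon>, W4, W5}) = {W1 Plus, W2 Plus, W4, W5}"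
    "(if \<epsilon> = Plus then {W1 \<epsilon>, W3, W4, W5} else flip_class ` {W1 \<epsilon>, W3, W4, W5}) = {W1 Plus, W3, W4, W5}"
    "(if \<epsilon> = Plus then {W2 \<epsilon>, W3, W4, W5} else flip_class ` {W2 \<epsilon>, W3, W4, W5}) = {W2 Plus, W3, W4, W5}"
    by (cases \<epsilon>; simp)+
  note typeI = torsion_typeI [OF R sym] and typeD = torsion_typeD [OF _ sym]
  show "has_torsion_type h J (psi_plus M \<theta> c u) (nabla_omega M c u) {W1 \<epsilon>, W2 \<epsilon>, W3, W4, W5}"
    unfolding type_iff flip unfolding nab by (rule typeI) simp_all
  show "has_torsion_type h J (psi_plus M \<theta> c u) (nabla_omega M c u) {W1 \<epsilon>, W2 \<epsilon>, W3}"
    if "\<And>x. rbar_tn M c u x = 0"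
  proof -
    have "div_alpha R z = 0" for z
      by (simp add: div that)
    from W4_condition [OF R this sym] show ?thesis
      unfolding type_iff flip unfolding nab by (intro typeI) blast+
  qed
  show "has_torsion_type h J (psi_plus M \<theta> c u) (nabla_omega M c u) {W1 \<epsilon>, W2 \<epsilon>, W4, W5} \<longleftrightarrow>
      (\<forall>x y. I_both J B x y = B x y)"
    unfolding type_iff flip unfolding nab
  proof
    assume "has_torsion_type h J psi (alpha R) {W1 Plus, W2 Plus, W4, W5}"
    from typeD(3) [OF this] show "\<forall>x y. I_both J B x y = B x y"
      by (simp add: S)
  next
    assume "\<forall>x y. I_both J B x y = B x y"
    then show "has_torsion_type h J psi (alpha R) {W1 Plus, W2 Plus, W4, W5}"
      by (intro typeI) (simp_all add: S)
  qed
  show "has_torsion_type h J (psi_plus M \<theta> c u) (nabla_omega M c u) {W1 \<epsilon>, W3, W4, W5} \<longleftrightarrow>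
      (\<forall>x y. (I_first J (rbar_tt M c u) x y - I_second J (rbar_tt M c u) x y) + (B x y + I_both J B x y)
         = 2 * mean_curv M c u * h x y)"
    unfolding type_iff flip unfolding nab C [symmetric]
  proof
    assume "has_torsion_type h J psi (alpha R) {W1 Plus, W3, W4, W5}"
    from typeD(2) [OF this] show "\<forall>x y. h (R x) y + h (R (J x)) (J y) = 2 * mean_curv M c u * h x y"
      by (simp add: tr)
  next
    assume "\<forall>x y. h (R x) y + h (R (J x)) (J y) = 2 * mean_curv M c u * h x y"
    then show "has_torsion_type h J psi (alpha R) {W1 Plus, W3, W4, W5}"
      by (intro typeI) (simp_all add: tr)
  qed
  show "has_torsion_type h J (psi_plus M \<theta> c u) (nabla_omega M c u) {W2 \<epsilon>, W3, W4, W5} \<longleftrightarrow>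
      mean_curv M c u = 0"
    unfolding type_iff flip unfolding nab
  proof
    assume "has_torsion_type h J psi (alpha R) {W2 Plus, W3, W4, W5}"
    from typeD(1) [OF this] show "mean_curv M c u = 0"
      by (simp add: tr)
  next
    assume "mean_curv M c u = 0"
    then show "has_torsion_type h J psi (alpha R) {W2 Plus, W3, W4, W5}"
      by (intro typeI) (simp_all add: tr)
  qed
qed

end

end

lemma of_type_iff:
  "of_type M \<theta> U \<longleftrightarrow> (\<forall>c\<in>hcharts M. \<forall>u\<in>coord_dom c.
     has_torsion_type (hmetric M c u) (act_I M c u) (psi_plus M \<theta> c u) (nabla_omega M c u) U \<and>
     (W5 \<notin> U \<longrightarrow> (\<forall>x. eta M \<theta> c u x = 0)))"
  unfolding of_type_def has_torsion_type_def ..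

theorem theorem4p8:
  fixes M :: "('a, 'b) hypersurf" and \<theta> :: "'a \<Rightarrow> real" and \<epsilon> :: torsion_sign
  assumes "g2_manifold (amb M)" and "type_X2 (amb M)" and "hypersurface M"
    and "(\<theta> = (\<lambda>_. 0) \<and> \<epsilon> = Plus) \<or> (\<theta> = (\<lambda>_. pi / 2) \<and> \<epsilon> = Minus)"
  shows
    "of_type M \<theta> {W1 \<epsilon>, W2 \<epsilon>, W3, W4, W5} \<and>
     (\<forall>c\<in>hcharts M. \<forall>u\<in>coord_dom c. \<forall>x.
        dstar_omega M c u x = 6 * I_one (act_I M c u) (eta M \<theta> c u) x \<and>
        6 * I_one (act_I M c u) (eta M \<theta> c u) x = - 2 * rbar_tn M c u x) \<and>
     (of_type M \<theta> {W1 \<epsilon>, W2 \<epsilon>, W3} \<longleftrightarrow>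
        (\<forall>c\<in>hcharts M. \<forall>u\<in>coord_dom c. \<forall>x. rbar_tn M c u x = 0)) \<and>
     (of_type M \<theta> {W1 \<epsilon>, W2 \<epsilon>, W4, W5} \<longleftrightarrow>
        (\<forall>c\<in>hcharts M. \<forall>u\<in>coord_dom c. \<forall>x y.
           I_both (act_I M c u) (second_ff M c u) x y = second_ff M c u x y)) \<and>
     (of_type M \<theta> {W1 \<epsilon>, W3, W4, W5} \<longleftrightarrow>
        (\<forall>c\<in>hcharts M. \<forall>u\<in>coord_dom c. \<forall>x y.
           (I_first (act_I M c u) (rbar_tt M c u) x y - I_second (act_I M c u) (rbar_tt M c u) x y)
           + (second_ff M c u x y + I_both (act_I M c u) (second_ff M c u) x y)
           = 2 * mean_curv M c u * hmetric M c u x y)) \<and>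
     (of_type M \<theta> {W2 \<epsilon>, W3, W4, W5} \<longleftrightarrow> minimal_variety M)"
proof -
  interpret immersed M
    by unfold_locales (fact assms)+
  let ?type = "\<lambda>c u. has_torsion_type (hmetric M c u) (act_I M c u) (psi_plus M \<theta> c u) (nabla_omega M c u)"
  have point: "?type c u {W1 \<epsilon>, W2 \<epsilon>, W3, W4, W5}"
    "(\<And>x. rbar_tn M c u x = 0) \<Longrightarrow> ?type c u {W1 \<epsilon>, W2 \<epsilon>, W3}"
    "?type c u {W1 \<epsilon>, W2 \<epsilon>, W4, W5} \<longleftrightarrow>
      (\<forall>x y. I_both (act_I M c u) (second_ff M c u) x y = second_ff M c u x y)"
    "?type c u {W1 \<epsilon>, W3, W4, W5} \<longleftrightarrow>
      (\<forall>x y. (I_first (act_I M c u) (rbar_tt M c u) x y - I_second (act_I M c u) (rbar_tt M c u) x y)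
           + (second_ff M c u x y + I_both (act_I M c u) (second_ff M c u) x y)
           = 2 * mean_curv M c u * hmetric M c u x y)"
    "?type c u {W2 \<epsilon>, W3, W4, W5} \<longleftrightarrow> mean_curv M c u = 0"
    "I_one (act_I M c u) (eta M \<theta> c u) x = - rbar_tn M c u x / 3"
    "(\<forall>x. eta M \<theta> c u x = 0) \<longleftrightarrow> (\<forall>x. rbar_tn M c u x = 0)"
    "dstar_omega M c u x = - 2 * rbar_tn M c u x"
    if cu: "c \<in> hcharts M" "u \<in> coord_dom c" for c u x
    by (rule moving_frame_exists [OF assms(2) cu],
        rule moving_frame.torsion_types [OF _ assms(4)] moving_frame.I_eta [OF _ assms(4)]
          moving_frame.eta_zero_iff [OF _ assms(4)] moving_frame.dstar_eq [OF _ assms(4)]; assumption)+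
  have "of_type M \<theta> {W1 \<epsilon>, W2 \<epsilon>, W3, W4, W5}"
    unfolding of_type_iff using point(1) by blast
  moreover have "\<forall>c\<in>hcharts M. \<forall>u\<in>coord_dom c. \<forall>x.
        dstar_omega M c u x = 6 * I_one (act_I M c u) (eta M \<theta> c u) x \<and>
        6 * I_one (act_I M c u) (eta M \<theta> c u) x = - 2 * rbar_tn M c u x"
    using point(6,8) by simp
  \<comment> \<open>From left to right only \<eta> = 0 is used. Conversely, vanishing of
    \<open>rbar_tn\<close> gives both \<eta> = 0 and the absence of the
    \<open>W4\<close>-component.\<close>
  moreover have "of_type M \<theta> {W1 \<epsilon>, W2 \<epsilon>, W3} \<longleftrightarrow>
        (\<forall>c\<in>hcharts M. \<forall>u\<in>coord_dom c. \<forall>x. rbar_tn M c u x = 0)"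
    unfolding of_type_iff using point(2,7) by (metis empty_iff insert_iff torsion_class.distinct)
  moreover have "of_type M \<theta> {W1 \<epsilon>, W2 \<epsilon>, W4, W5} \<longleftrightarrow>
        (\<forall>c\<in>hcharts M. \<forall>u\<in>coord_dom c. \<forall>x y.
           I_both (act_I M c u) (second_ff M c u) x y = second_ff M c u x y)"
    unfolding of_type_iff using point(3) by simp
  moreover have "of_type M \<theta> {W1 \<epsilon>, W3, W4, W5} \<longleftrightarrow>
        (\<forall>c\<in>hcharts M. \<forall>u\<in>coord_dom c. \<forall>x y.
           (I_first (act_I M c u) (rbar_tt M c u) x y - I_second (act_I M c u) (rbar_tt M c u) x y)
           + (second_ff M c u x y + I_both (act_I M c u) (second_ff M c u) x y)
           = 2 * mean_curv M c u * hmetric M c u x y)"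
    unfolding of_type_iff using point(4) by simp
  moreover have "of_type M \<theta> {W2 \<epsilon>, W3, W4, W5} \<longleftrightarrow> minimal_variety M"
    unfolding of_type_iff minimal_variety_def using point(5) by simp
  ultimately show ?thesis by blast
qed

end
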